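(* Let $\Omega_2\subset\mathbb{C}$ be an intrinsic complex domain and let $f:\Omega_2\to\mathbb{C}$ be a holomorphic intrinsic function. Then for all dimensions $m\in\mathbb{N}$, $$\tau_m\left[f(x_0+\underline{x})\right]=\gamma_m\;\mathrm{GCK}[f^{(m-1)}(x_0)]=\frac{\gamma_m}{\sigma_m}\int_{\mathbb{S}^{m-1}}f^{(m-1)}\left(x_0+\underline{\omega}\,\langle\underline{x},\underline{\omega}\rangle\right)dS_{\underline{\omega}},$$ where $\gamma_m=\frac{(-1)^{\frac{1-m}{2}}2^{m-1}}{(m-1)!}\Gamma\left(\frac{m+1}{2}\right)^2$. In other words, on $\mathcal{A}(\Omega_1)\otimes\mathbb{R}_m$ with $\Omega_1=\Omega_2\cap\mathbb{R}$, $$\tau_m\circ S=\gamma_m\,\mathrm{GCK}\circ\partial_{x_0}^{m-1}=\gamma_m\,\check{R}\circ S\circ\partial_{x_0}^{m-1}.$$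
   Context: $\mathbb{R}_m$ is the real Clifford algebra with generators $e_1,\dots,e_m$, $e_je_\ell+e_\ell e_j=-2\delta_{j\ell}$; $\mathbb{C}_m=\mathbb{C}\otimes\mathbb{R}_m$. Points of $\mathbb{R}^{m+1}$ are identified with paravectors $x=x_0+\underline{x}$, $\underline{x}=\sum_{j=1}^m x_je_j$; $\overline{x}=x_0-\underline{x}$, $x\overline{x}=|x|^2$, $x^{-1}=\overline{x}/|x|^2$. $\Delta=\sum_{j=0}^m\partial_{x_j}^2$. $\langle\cdot,\cdot\rangle$ is the Euclidean inner product in $\mathbb{R}^m$; $\mathbb{S}^{m-1}$ is the unit sphere of vectors in $\mathbb{R}^m$ with surface measure $dS_{\underline{\omega}}$ and area $\sigma_m=\frac{2\pi^{m/2}}{\Gamma(m/2)}$. An intrinsic complex domain $\Omega_2\subset\mathbb{C}$ is a (nonempty) connected open set symmetric with respect to the real axis. A holomorphic function $f=\alpha+i\beta$ on $\Omega_2$ is intrinsic if $\alpha(u,-v)=\alpha(u,v)$, $\beta(u,-v)=-\beta(u,v)$, equivalently $f|_{\Omega_2\cap\mathbb{R}}$ is real-valued. For such $f$ (and its derivatives), its value at a paravector is given by the slice extension $f(x_0+\underline{x}):=\alpha(x_0,|\underline{x}|)+\frac{\underline{x}}{|\underline{x}|}\beta(x_0,|\underline{x}|)$. $\mathcal{A}(\Omega_1)$: $\mathbb{R}$-valued real-analytic functions on $\Omega_1$ with a holomorphic extension to $\Omega_2$. $S[f_0]$ is the slice extension of the holomorphic extension of $f_0$; near $\Omega_1$,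 $S[f_0](x)=\sum_{j\ge0}\frac{\underline{x}^j}{j!}f_0^{(j)}(x_0)$. The dual Radon transform is $\check{R}[f](x_0,\underline{x})=\frac{1}{\sigma_m}\int_{\mathbb{S}^{m-1}}f(x_0,\langle\underline{x},\underline{\omega}\rangle\underline{\omega})\,dS_{\underline{\omega}}$. Axially monogenic function: real-analytic $F$ with $(\partial_{x_0}+\sum_j e_j\partial_{x_j})F=0$ and $F=A(x_0,|\underline{x}|)+\frac{\underline{x}}{|\underline{x}|}B(x_0,|\underline{x}|)$, $A$ even and $B$ odd in the second variable. $\mathrm{GCK}[f_0]$ is the unique axially monogenic function of the form $\sum_{j\ge0}\underline{x}^jf_j(x_0)$ ($f_j$ analytic, in an axially symmetric neighbourhood of the domain of $f_0$) whose restriction to $\underline{x}=0$ is $f_0(x_0)$. Equalities between such extensions are understood on (axially symmetric) neighbourhoods of the real domain $\Omega_1$ where all sides are defined. The Fueter-Sce-Qian mapping $\tau_m$. Kelvin inversion: $I[f](x)=\frac{\overline{x}}{|x|^{m+1}}f\left(\frac{\overline{x}}{|x|^2}\right)$. Put $\lambda_m=2^{m-1}\Gamma\left(\frac{m+1}{2}\right)^2$ and, for $k\ge1$, $P^{(-k)}(x)=\frac{(-1)^{k-1}\lambda_m}{(k-1)!}\partial_{x_0}^{k-1}\left[\frac{\overline{x}}{|x|^{m+1}}\right]$ and $P^{(k-1)}=I[P^{(-k)}]$. By definition, $$\tau_m[x^\ell]=\begin{cases}\operatorname{sgn}(-x_0)^{m-1}\Delta^{\frac{m-1}{2}}[x^\ell],&\ell<0,\\0,&0\le\ell\le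 m-2,\\ I\left[\Delta^{\frac{m-1}{2}}[x^{-\ell+m-2}]\right],&\ell\ge m-1,\end{cases}$$ where the (fractional, if $m$ is even) power of $\Delta$ is defined by the Fourier multiplier $(-\Delta)^{\frac{m-1}{2}}=\mathcal{F}^{-1}(2\pi|\cdot|)^{m-1}\mathcal{F}$; it is a known fact that $(-\Delta)^{\frac{m-1}{2}}[x^{-k}]=P^{(-k)}(x)$ for $k\ge1$, and this gives it meaning here, so that $\tau_m[x^\ell]=(-1)^{\frac{1-m}{2}}\operatorname{sgn}(-x_0)^{m-1}P^{(\ell)}(x)$ for $\ell<0$, $0$ for $0\le\ell\le m-2$, and $(-1)^{\frac{1-m}{2}}P^{(\ell+1-m)}(x)$ for $\ell\ge m-1$. Here $(-1)^{\frac{1-m}{2}}$ is one fixed value (e.g. $e^{i\pi(1-m)/2}$), the same throughout. For $f(z)=\sum_{j\in\mathbb{Z}}a_jz^j$ one sets $\tau_m[f(x_0+\underline{x})]=\sum_j\tau_m[x^j]\,a_j$; for expansions around another real point $a$ one translates, i.e. $f(z)=\sum_jc_j(z-a)^j$ gives $\sum_j(\tau_m[x^j])(x-a)\,c_j$. For $m$ odd, $\tau_m$ coincides with the pointwise differential operator $\Delta^{\frac{m-1}{2}}$. For $m$ even $\gamma_m$ may be non-real, and values in $\mathbb{C}_m$ are understood. *)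

theory Defs
  imports "HOL-Analysis.Analysis"
begin

section \<open>Clifford algebras\<close>

text \<open>
  The Clifford algebra on the generators \<open>e\<^sub>j\<close>, \<open>j :: 'n\<close>, with coefficients in \<open>'a\<close> is
  modelled on \<open>'a ^ ('n set)\<close>: the component at \<open>A\<close> is the coefficient of the ordered product
  \<open>e\<^sub>A\<close> of the \<open>e\<^sub>j\<close> with \<open>j \<in> A\<close>. So \<open>real ^ ('n set)\<close> is \<open>\<real>\<^sub>m\<close> and \<open>complex ^ ('n set)\<close> is
  \<open>\<complex>\<^sub>m\<close>, with \<open>m = CARD('n)\<close>. The linear order on \<open>'n\<close> only fixes the order of the factors.
\<close>

text \<open>
  \<open>e\<^sub>A e\<^sub>B = cl_sign A B e\<^bsub>A \<triangle> B\<^esub>\<close>: pairs with \<open>b < a\<close> count the transpositions needed to sort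
  the product, pairs with \<open>b = a\<close> the contractions \<open>e\<^sub>a\<^sup>2 = -1\<close>.
\<close>

definition cl_sign :: "'n::{finite,linorder} set \<Rightarrow> 'n set \<Rightarrow> 'a::comm_ring_1" where
  "cl_sign A B = (- 1) ^ card {(a, b). a \<in> A \<and> b \<in> B \<and> b \<le> a}"

definition cl_mult :: "'a::comm_ring_1 ^ ('n::{finite,linorder} set) \<Rightarrow> 'a ^ ('n set) \<Rightarrow> 'a ^ ('n set)"
    (infixl \<open>\<star>\<close> 70) where
  "x \<star> y = (\<chi> C. \<Sum>A\<in>UNIV. cl_sign A (sym_diff A C) * x $ A * y $ sym_diff A C)"

definition cl_basis :: "'n set \<Rightarrow> 'a::comm_ring_1 ^ ('n::{finite,linorder} set)" where
  "cl_basis A = axis A 1"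

abbreviation cl_one :: "'a::comm_ring_1 ^ ('n::{finite,linorder} set)" where
  "cl_one \<equiv> cl_basis {}"

abbreviation cl_gen :: "'n \<Rightarrow> 'a::comm_ring_1 ^ ('n::{finite,linorder} set)" where
  "cl_gen j \<equiv> cl_basis {j}"

primrec cl_pow :: "'a::comm_ring_1 ^ ('n::{finite,linorder} set) \<Rightarrow> nat \<Rightarrow> 'a ^ ('n set)" where
  "cl_pow x 0 = cl_one"
| "cl_pow x (Suc k) = x \<star> cl_pow x k"

lemma minus_one_power_card_sym_diff:
  assumes "finite X" "finite Y"
  shows "(- 1 :: 'a::comm_ring_1) ^ card (sym_diff X Y) = (- 1) ^ card X * (- 1) ^ card Y"
proof -
  have X: "card X = card (X - Y) + card (X \<inter> Y)"
    using assms by (metis card_Int_Diff add.commute)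
  have Y: "card Y = card (Y - X) + card (X \<inter> Y)"
    using assms by (metis card_Int_Diff add.commute Int_commute)
  have "card (sym_diff X Y) = card (X - Y) + card (Y - X)"
    using assms by (intro card_Un_disjoint) auto
  moreover have "p * q = p * c * (q * c)" if "c * c = 1" for p q c :: 'a
  proof -
    have "p * c * (q * c) = p * q * (c * c)"
      by (simp only: mult_ac)
    thus ?thesis
      using that by simp
  qed
  moreover have "(- 1 :: 'a) ^ card (X \<inter> Y) * (- 1) ^ card (X \<inter> Y) = 1"
    by (simp flip: power_mult_distrib)
  ultimately show ?thesis
    unfolding X Y by (metis power_add)
qed

lemma cl_sign_sym_diff_left:
  "cl_sign (sym_diff A B) C = (cl_sign A C * cl_sign B C :: 'a::comm_ring_1)"
proof -
  have *: "{(a, b). a \<in> sym_diff A B \<and> b \<in> C \<and> b \<le> a} =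
      sym_diff {(a, b). a \<in> A \<and> b \<in> C \<and> b \<le> a} {(a, b). a \<in> B \<and> b \<in> C \<and> b \<le> a}"
    by auto
  show ?thesis
    unfolding cl_sign_def * by (rule minus_one_power_card_sym_diff) auto
qed

lemma cl_sign_sym_diff_right:
  "cl_sign A (sym_diff B C) = (cl_sign A B * cl_sign A C :: 'a::comm_ring_1)"
proof -
  have *: "{(a, b). a \<in> A \<and> b \<in> sym_diff B C \<and> b \<le> a} =
      sym_diff {(a, b). a \<in> A \<and> b \<in> B \<and> b \<le> a} {(a, b). a \<in> A \<and> b \<in> C \<and> b \<le> a}"
    by auto
  show ?thesis
    unfolding cl_sign_def * by (rule minus_one_power_card_sym_diff) auto
qed

lemma cl_mult_assoc:
  fixes x y z :: "'a::comm_ring_1 ^ ('b::{finite,linorder} set)"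
  shows "(x \<star> y) \<star> z = x \<star> (y \<star> z)"
proof (rule vec_eq_iff[THEN iffD2], rule allI)
  fix D :: "'b set"
  have sd: "sym_diff (sym_diff A C) (sym_diff A D) = sym_diff C D" for A C D :: "'b set"
    by auto
  have bij: "bij (\<lambda>C. sym_diff A C)" for A :: "'b set"
    by (rule o_bij[of "\<lambda>C. sym_diff A C"]) (auto simp: fun_eq_iff)
  have sgn: "cl_sign C (sym_diff C D) * cl_sign A (sym_diff A C) =
      (cl_sign A (sym_diff A D) * cl_sign (sym_diff A C) (sym_diff C D) :: 'a)" for A C
  proof -
    have "sym_diff A D = sym_diff (sym_diff A C) (sym_diff C D)"
      by auto
    hence 1: "cl_sign A (sym_diff A D) =
        (cl_sign A (sym_diff A C) * cl_sign A (sym_diff C D) :: 'a)"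
      using cl_sign_sym_diff_right by metis
    have "C = sym_diff A (sym_diff A C)"
      by auto
    hence 2: "cl_sign C (sym_diff C D) =
        (cl_sign A (sym_diff C D) * cl_sign (sym_diff A C) (sym_diff C D) :: 'a)"
      using cl_sign_sym_diff_left by metis
    show ?thesis
      unfolding 1 2 by (simp add: mult_ac)
  qed
  have "(x \<star> (y \<star> z)) $ D = (\<Sum>A\<in>UNIV. \<Sum>B\<in>UNIV. cl_sign A (sym_diff A D) * x $ A *
      (cl_sign B (sym_diff B (sym_diff A D)) * y $ B * z $ sym_diff B (sym_diff A D)))"
    by (simp add: cl_mult_def sum_distrib_left)
  also have "\<dots> = (\<Sum>A\<in>UNIV. \<Sum>C\<in>UNIV. cl_sign A (sym_diff A D) * x $ A *
      (cl_sign (sym_diff A C) (sym_diff C D) * y $ sym_diff A C * z $ sym_diff C D))"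
  proof (rule sum.cong[OF refl])
    fix A
    show "(\<Sum>B\<in>UNIV. cl_sign A (sym_diff A D) * x $ A *
        (cl_sign B (sym_diff B (sym_diff A D)) * y $ B * z $ sym_diff B (sym_diff A D))) =
      (\<Sum>C\<in>UNIV. cl_sign A (sym_diff A D) * x $ A *
        (cl_sign (sym_diff A C) (sym_diff C D) * y $ sym_diff A C * z $ sym_diff C D))"
      by (subst sum.reindex_bij_betw[OF bij[of A], symmetric]) (simp only: sd)
  qed
  also have "\<dots> = (\<Sum>A\<in>UNIV. \<Sum>C\<in>UNIV. cl_sign C (sym_diff C D) *
      (cl_sign A (sym_diff A C) * x $ A * y $ sym_diff A C) * z $ sym_diff C D)"
  proof (intro sum.cong refl)
    fix A C
    show "cl_sign A (sym_diff A D) * x $ A *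
        (cl_sign (sym_diff A C) (sym_diff C D) * y $ sym_diff A C * z $ sym_diff C D) =
      cl_sign C (sym_diff C D) *
        (cl_sign A (sym_diff A C) * x $ A * y $ sym_diff A C) * z $ sym_diff C D"
      using arg_cong[OF sgn[of C A],
          of "\<lambda>s. s * (x $ A * y $ sym_diff A C * z $ sym_diff C D)"]
      by (simp only: mult_ac)
  qed
  also have "\<dots> = ((x \<star> y) \<star> z) $ D"
    by (subst sum.swap) (simp add: cl_mult_def sum_distrib_left sum_distrib_right)
  finally show "((x \<star> y) \<star> z) $ D = (x \<star> (y \<star> z)) $ D"
    by simp
qed

lemma cl_basis_mult: "cl_basis A \<star> cl_basis B = (cl_sign A B *s cl_basis (sym_diff A B) :: 'a::comm_ring_1 ^ _)"
proof (rule vec_eq_iff[THEN iffD2], rule allI)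
  fix C
  have "(cl_basis A \<star> cl_basis B :: 'a ^ _) $ C =
      (\<Sum>A'\<in>UNIV. if A' = A then cl_sign A (sym_diff A C) * (if sym_diff A C = B then 1 else 0) else 0)"
    unfolding cl_mult_def cl_basis_def axis_def vec_lambda_beta by (intro sum.cong) auto
  also have "\<dots> = (if sym_diff A C = B then cl_sign A B else 0)"
    by (subst sum.delta) auto
  also have "sym_diff A C = B \<longleftrightarrow> C = sym_diff A B"
    by auto
  finally show "(cl_basis A \<star> cl_basis B :: 'a ^ _) $ C = (cl_sign A B *s cl_basis (sym_diff A B)) $ C"
    by (auto simp: cl_basis_def axis_def)
qed

lemma
  fixes x :: "'a::comm_ring_1 ^ ('b::{finite,linorder} set)"
  shows cl_one_left: "cl_one \<star> x = x" and cl_one_right: "x \<star> cl_one = x"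
proof -
  show "cl_one \<star> x = x"
  proof (rule vec_eq_iff[THEN iffD2], rule allI)
    fix C :: "'b set"
    have "(cl_one \<star> x) $ C = (\<Sum>A\<in>(UNIV :: 'b set set). if A = {} then x $ C else 0)"
      unfolding cl_mult_def cl_basis_def axis_def vec_lambda_beta
      by (intro sum.cong refl) (auto simp: cl_sign_def)
    thus "(cl_one \<star> x) $ C = x $ C"
      by simp
  qed
  show "x \<star> cl_one = x"
  proof (rule vec_eq_iff[THEN iffD2], rule allI)
    fix C :: "'b set"
    have sd: "sym_diff A C = {} \<longleftrightarrow> A = C" for A
      by auto
    have "(x \<star> cl_one) $ C = (\<Sum>A\<in>UNIV. if A = C then x $ C else 0)"
      unfolding cl_mult_def cl_basis_def axis_def vec_lambda_beta
      by (intro sum.cong refl) (simp only: sd, simp add: cl_sign_def)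
    thus "(x \<star> cl_one) $ C = x $ C"
      by simp
  qed
qed

lemma cl_gen_anticommute:
  "cl_gen j \<star> cl_gen l + cl_gen l \<star> cl_gen j =
    (if j = l then - 2 else 0) *s (cl_one :: 'a::comm_ring_1 ^ ('n::{finite,linorder} set))"
proof -
  have sg: "cl_sign {j} {l} = (if l \<le> j then - 1 else 1 :: 'a)" for j l :: 'n
  proof -
    have "{(a, b). a \<in> {j} \<and> b \<in> {l} \<and> b \<le> a} = (if l \<le> j then {(j, l)} else {})"
      by auto
    thus ?thesis
      by (auto simp: cl_sign_def)
  qed
  show ?thesis
  proof (cases "j = l")
    case True
    thus ?thesis
      by (simp add: cl_basis_mult sg vec_eq_iff)
  next
    case False
    have "sym_diff {l} {j} = sym_diff {j} {l}"
      by (rule Un_commute)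
    hence "cl_gen j \<star> cl_gen l + cl_gen l \<star> cl_gen j =
        (cl_sign {j} {l} + cl_sign {l} {j}) *s (cl_basis (sym_diff {j} {l}) :: 'a ^ _)"
      by (simp only: cl_basis_mult vector_sadd_rdistrib)
    also have "cl_sign {j} {l} + cl_sign {l} {j} = (0 :: 'a)"
      using False by (auto simp: sg)
    finally show ?thesis
      using False by simp
  qed
qed


section \<open>Paravectors\<close>

text \<open>A point \<open>x\<^sub>0 + \<underline>x\<close> of \<open>\<real>\<^bsup>m+1\<^esup>\<close> is the pair \<open>(x\<^sub>0, \<underline>x)\<close>.\<close>

type_synonym 'n paravector = "real \<times> (real, 'n) vec"
type_synonym 'n clifford = "(complex, 'n set) vec"

definition cl_vec :: "real ^ 'n::{finite,linorder} \<Rightarrow> 'n clifford" where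
  "cl_vec v = (\<Sum>j\<in>UNIV. complex_of_real (v $ j) *s cl_gen j)"

definition cl_pv :: "'n paravector \<Rightarrow> 'n::{finite,linorder} clifford" where
  "cl_pv x = complex_of_real (fst x) *s cl_one + cl_vec (snd x)"

definition pv_cnj :: "'n paravector \<Rightarrow> 'n::finite paravector" where
  "pv_cnj x = (fst x, - snd x)"

definition pv_inverse :: "'n paravector \<Rightarrow> 'n::finite paravector" where
  "pv_inverse x = pv_cnj x /\<^sub>R (norm x)\<^sup>2"

definition pv_powi :: "'n paravector \<Rightarrow> int \<Rightarrow> 'n::{finite,linorder} clifford" where
  "pv_powi x l = (if l \<ge> 0 then cl_pow (cl_pv x) (nat l) else cl_pow (cl_pv (pv_inverse x)) (nat (- l)))"

definition pv_real :: "real \<Rightarrow> 'n::finite paravector" where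
  "pv_real a = (a, 0)"

definition partial0 :: "('n paravector \<Rightarrow> 'n clifford) \<Rightarrow> 'n paravector \<Rightarrow> 'n::finite clifford" where
  "partial0 F x = vector_derivative (\<lambda>t. F (t, snd x)) (at (fst x))"

definition cauchy_riemann :: "('n paravector \<Rightarrow> 'n clifford) \<Rightarrow> 'n paravector \<Rightarrow> 'n::{finite,linorder} clifford" where
  "cauchy_riemann F x = partial0 F x +
     (\<Sum>j\<in>UNIV. cl_gen j \<star> vector_derivative (\<lambda>t. F (fst x, snd x + t *\<^sub>R axis j 1)) (at 0))"


section \<open>Real analyticity and the surface measure of the sphere\<close>

text \<open>
  Local power series expansions in the coordinates with respect to the standard basis; the
  multi-indices are the functions on \<^term>\<open>Basis\<close>, extended by \<open>0\<close>.
\<close>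

definition real_analytic_on :: "('a::euclidean_space \<Rightarrow> 'b::real_normed_vector) \<Rightarrow> 'a set \<Rightarrow> bool" where
  "real_analytic_on F U \<longleftrightarrow>
     (\<forall>p\<in>U. \<exists>r>0. \<exists>c :: ('a \<Rightarrow> nat) \<Rightarrow> 'b. \<forall>h. norm h < r \<longrightarrow>
        ((\<lambda>\<alpha>. (\<Prod>b\<in>Basis. (h \<bullet> b) ^ \<alpha> b) *\<^sub>R c \<alpha>) has_sum F (p + h)) {\<alpha>. \<forall>b. b \<notin> Basis \<longrightarrow> \<alpha> b = 0})"

text \<open>
  The surface measure on the unit sphere, obtained from Lebesgue measure through polar
  coordinates: \<open>S(E) = m \<cdot> \<lambda>{t \<omega> | 0 < t < 1, \<omega> \<in> E}\<close>. For \<open>m = 1\<close> it is the counting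
  measure on \<open>{-1, 1}\<close>.
\<close>

definition sphere_measure :: "(real ^ 'n::finite) measure" where
  "sphere_measure = scale_measure (of_nat CARD('n))
     (distr (restrict_space lborel (ball 0 1 - {0})) (restrict_space borel (sphere 0 1)) sgn)"

definition sphere_area :: "nat \<Rightarrow> real" where
  "sphere_area m = 2 * pi powr (real m / 2) / Gamma (real m / 2)"


lemma emeasure_sphere_measure:
  "emeasure (sphere_measure :: (real ^ 'n::finite) measure) (sphere 0 1) = ennreal (sphere_area CARD('n))"
proof -
  let ?B = "ball 0 1 - {0} :: (real ^ 'n) set"
  have meas: "sgn \<in> restrict_space lborel ?B \<rightarrow>\<^sub>M restrict_space borel (sphere 0 1 :: (real ^ 'n) set)"
    by (rule measurable_restrict_space3) (auto simp: norm_sgn sgn_div_norm[abs_def])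
  have pre: "sgn -` sphere 0 1 \<inter> ?B = ?B"
    by (auto simp: norm_sgn)
  have "emeasure lborel ?B = emeasure lborel (ball 0 1 :: (real ^ 'n) set)"
    by (rule emeasure_Diff_null_set) auto
  also have "\<dots> = ennreal (unit_ball_vol (real CARD('n)))"
    by (simp add: emeasure_ball)
  finally have "emeasure sphere_measure (sphere 0 1 :: (real ^ 'n) set) =
      of_nat CARD('n) * ennreal (unit_ball_vol (real CARD('n)))"
    using meas pre
    by (simp add: sphere_measure_def emeasure_distr emeasure_restrict_space space_restrict_space
        sets_restrict_space_iff)
  also have "\<dots> = ennreal (real CARD('n) * unit_ball_vol (real CARD('n)))"
    by (simp add: ennreal_of_nat_eq_real_of_nat ennreal_mult)
  also have "real CARD('n) * unit_ball_vol (real CARD('n)) = sphere_area CARD('n)"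
  proof -
    have "Gamma (real CARD('n) / 2 + 1) = real CARD('n) / 2 * Gamma (real CARD('n) / 2)"
      by (rule Gamma_plus1) auto
    moreover have "Gamma (real CARD('n) / 2) \<noteq> 0"
      by (rule less_imp_neq[symmetric], rule Gamma_real_pos) simp
    ultimately show ?thesis
      unfolding sphere_area_def unit_ball_vol_def by (auto simp: divide_simps)
  qed
  finally show ?thesis .
qed


section \<open>Intrinsic functions and slice extensions\<close>

definition intrinsic_domain :: "complex set \<Rightarrow> bool" where
  "intrinsic_domain \<Omega> \<longleftrightarrow> open \<Omega> \<and> connected \<Omega> \<and> \<Omega> \<noteq> {} \<and> (\<forall>z\<in>\<Omega>. cnj z \<in> \<Omega>)"

definition intrinsic_on :: "complex set \<Rightarrow> (complex \<Rightarrow> complex) \<Rightarrow> bool" where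
  "intrinsic_on \<Omega> f \<longleftrightarrow> f holomorphic_on \<Omega> \<and>
     (\<forall>z\<in>\<Omega>. Re (f (cnj z)) = Re (f z) \<and> Im (f (cnj z)) = - Im (f z))"

definition real_trace :: "complex set \<Rightarrow> real set" where
  "real_trace \<Omega> = {t. complex_of_real t \<in> \<Omega>}"

definition slice_ext :: "(complex \<Rightarrow> complex) \<Rightarrow> 'n paravector \<Rightarrow> 'n::{finite,linorder} clifford" where
  "slice_ext f x = (let w = f (Complex (fst x) (norm (snd x))) in
     complex_of_real (Re w) *s cl_one + complex_of_real (Im w) *s cl_vec (sgn (snd x)))"

text \<open>
  \<open>\<A>(\<Omega>\<^sub>1)\<close>, \<open>\<A>(\<Omega>\<^sub>1) \<otimes> \<real>\<^sub>m\<close> and the slice extension operator \<open>S\<close>, extended to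
  \<open>\<A>(\<Omega>\<^sub>1) \<otimes> \<real>\<^sub>m\<close> with the coefficients on the right. Functions are total; only the values on
  \<open>\<Omega>\<^sub>1 = real_trace \<Omega>\<close> matter.
\<close>

definition hol_extends :: "complex set \<Rightarrow> (real \<Rightarrow> real) \<Rightarrow> (complex \<Rightarrow> complex) \<Rightarrow> bool" where
  "hol_extends \<Omega> f\<^sub>0 g \<longleftrightarrow> g holomorphic_on \<Omega> \<and>
     (\<forall>t\<in>real_trace \<Omega>. g (complex_of_real t) = complex_of_real (f\<^sub>0 t))"

definition analytic_space :: "complex set \<Rightarrow> (real \<Rightarrow> real) set" where
  "analytic_space \<Omega> = {f\<^sub>0. real_analytic_on f\<^sub>0 (real_trace \<Omega>) \<and> (\<exists>g. hol_extends \<Omega> f\<^sub>0 g)}"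

definition analytic_tensor :: "complex set \<Rightarrow> (real \<Rightarrow> real ^ ('n::finite set)) set" where
  "analytic_tensor \<Omega> = {f\<^sub>0. \<forall>A. (\<lambda>t. f\<^sub>0 t $ A) \<in> analytic_space \<Omega>}"

definition hol_ext :: "complex set \<Rightarrow> (real \<Rightarrow> real) \<Rightarrow> complex \<Rightarrow> complex" where
  "hol_ext \<Omega> f\<^sub>0 = (SOME g. hol_extends \<Omega> f\<^sub>0 g)"

definition slice_op :: "complex set \<Rightarrow> (real \<Rightarrow> real ^ ('n set)) \<Rightarrow> 'n paravector \<Rightarrow> 'n::{finite,linorder} clifford" where
  "slice_op \<Omega> f\<^sub>0 x = (\<Sum>A\<in>UNIV. slice_ext (hol_ext \<Omega> (\<lambda>t. f\<^sub>0 t $ A)) x \<star> cl_basis A)"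

definition vderiv :: "(real \<Rightarrow> 'a::real_normed_vector) \<Rightarrow> real \<Rightarrow> 'a" where
  "vderiv g t = vector_derivative g (at t)"

definition complexify :: "real ^ 'i \<Rightarrow> complex ^ 'i" where
  "complexify v = (\<chi> i. complex_of_real (v $ i))"

definition dual_radon :: "('n paravector \<Rightarrow> 'n clifford) \<Rightarrow> 'n paravector \<Rightarrow> 'n::{finite,linorder} clifford" where
  "dual_radon F x = (LINT \<omega>|sphere_measure. F (fst x, (snd x \<bullet> \<omega>) *\<^sub>R \<omega>)) /\<^sub>R sphere_area CARD('n)"


section \<open>The generalised Cauchy-Kovalevskaya extension\<close>

definition axially_monogenic_on :: "'n paravector set \<Rightarrow> ('n paravector \<Rightarrow> 'n::{finite,linorder} clifford) \<Rightarrow> bool" where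
  "axially_monogenic_on U F \<longleftrightarrow> real_analytic_on F U \<and> (\<forall>x\<in>U. cauchy_riemann F x = 0) \<and>
     (\<exists>A B. (\<forall>u v. A u (- v) = A u v \<and> B u (- v) = - B u v) \<and>
        (\<forall>x\<in>U. F x = A (fst x) (norm (snd x)) + cl_vec (sgn (snd x)) \<star> B (fst x) (norm (snd x))))"

definition axial_nbhd :: "real set \<Rightarrow> 'n::finite paravector set \<Rightarrow> bool" where
  "axial_nbhd \<Omega>\<^sub>1 U \<longleftrightarrow> open U \<and> (\<forall>t\<in>\<Omega>\<^sub>1. (t, 0) \<in> U) \<and>
     (\<forall>t v w. (t, v) \<in> U \<and> norm w = norm v \<longrightarrow> (t, w) \<in> U)"

text \<open>
  Since the \<open>f\<^sub>j\<close> live on \<open>\<Omega>\<^sub>1\<close>, so do the real parts of the points of \<open>U\<close>. Monogenicity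
  determines the \<open>f\<^sub>j\<close> recursively from \<open>f\<^sub>0\<close>, hence any two such \<open>F\<close> agree wherever
  both are defined and the value \<open>GCK \<Omega>\<^sub>1 f\<^sub>0 x\<close> does not depend on \<open>U\<close>.
\<close>

definition is_GCK :: "real set \<Rightarrow> (real \<Rightarrow> 'n clifford) \<Rightarrow> 'n paravector set \<Rightarrow>
    ('n paravector \<Rightarrow> 'n::{finite,linorder} clifford) \<Rightarrow> bool" where
  "is_GCK \<Omega>\<^sub>1 f\<^sub>0 U F \<longleftrightarrow> axial_nbhd \<Omega>\<^sub>1 U \<and> fst ` U \<subseteq> \<Omega>\<^sub>1 \<and> axially_monogenic_on U F \<and>
     (\<exists>f. (\<forall>j. real_analytic_on (f j) \<Omega>\<^sub>1) \<and>
        (\<forall>x\<in>U. (\<lambda>j. cl_pow (cl_vec (snd x)) j \<star> f j (fst x)) sums F x)) \<and>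
     (\<forall>t\<in>\<Omega>\<^sub>1. F (pv_real t) = f\<^sub>0 t)"

definition GCK :: "real set \<Rightarrow> (real \<Rightarrow> 'n clifford) \<Rightarrow> 'n paravector \<Rightarrow> 'n::{finite,linorder} clifford" where
  "GCK \<Omega>\<^sub>1 f\<^sub>0 x = (THE v. \<exists>U F. is_GCK \<Omega>\<^sub>1 f\<^sub>0 U F \<and> x \<in> U \<and> v = F x)"


section \<open>The Fueter-Sce-Qian mapping\<close>

definition fueter_unit :: "nat \<Rightarrow> complex" where
  "fueter_unit m = (- 1) powr ((1 - of_nat m) / 2)"

definition fueter_lambda :: "nat \<Rightarrow> real" where
  "fueter_lambda m = 2 ^ (m - 1) * (Gamma ((real m + 1) / 2))\<^sup>2"

definition fueter_gamma :: "nat \<Rightarrow> complex" where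
  "fueter_gamma m = fueter_unit m * 2 ^ (m - 1) / fact (m - 1) * of_real ((Gamma ((real m + 1) / 2))\<^sup>2)"

definition cauchy_kernel :: "'n paravector \<Rightarrow> 'n::{finite,linorder} clifford" where
  "cauchy_kernel x = cl_pv (pv_cnj x) /\<^sub>R norm x ^ (CARD('n) + 1)"

definition kelvin :: "('n paravector \<Rightarrow> 'n clifford) \<Rightarrow> 'n paravector \<Rightarrow> 'n::{finite,linorder} clifford" where
  "kelvin F x = cauchy_kernel x \<star> F (pv_inverse x)"

definition fueter_P_neg :: "nat \<Rightarrow> 'n paravector \<Rightarrow> 'n::{finite,linorder} clifford" where
  "fueter_P_neg k x =
     ((- 1) ^ (k - 1) * fueter_lambda CARD('n) / fact (k - 1)) *\<^sub>R (partial0 ^^ (k - 1)) cauchy_kernel x"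

text \<open>
  For \<open>l \<ge> 0\<close> the Kelvin inversion is a polynomial away from the origin; its value at the
  origin is the continuous one.
\<close>

definition fueter_P :: "int \<Rightarrow> 'n paravector \<Rightarrow> 'n::{finite,linorder} clifford" where
  "fueter_P l x =
     (if l < 0 then fueter_P_neg (nat (- l)) x
      else if x = 0 then Lim (at 0) (kelvin (fueter_P_neg (nat l + 1)))
      else kelvin (fueter_P_neg (nat l + 1)) x)"

definition tau_power :: "int \<Rightarrow> 'n paravector \<Rightarrow> 'n::{finite,linorder} clifford" where
  "tau_power l x =
     (if l < 0 then
        (fueter_unit CARD('n) * complex_of_real (sgn (- fst x) ^ (CARD('n) - 1))) *s fueter_P l x
      else if l \<le> int CARD('n) - 2 then 0
      else fueter_unit CARD('n) *s fueter_P (l + 1 - int CARD('n)) x)"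

text \<open>
  \<open>\<tau>\<^sub>m\<close> acts on a function \<open>F\<close> of the paravector variable through its expansions
  \<open>\<Sum>j\<in>\<int>. (y - a)\<^sup>j c\<^sub>j\<close> around real points \<open>a\<close>, on annuli \<open>r < \<bar>z - a\<bar> < R\<close> in \<open>\<Omega>\<close>; a
  negative \<open>r\<close> gives a disc, that is, a Taylor expansion. The value at \<open>x\<close> may be computed from
  such an expansion if \<open>r < \<bar>x\<^sub>0 - a\<bar>\<close> and \<open>\<bar>x - a\<bar> < R\<close>, i.e. if the whole vertical segment from
  \<open>x\<^sub>0\<close> to \<open>x\<close> lies in the annulus; these \<open>x\<close> form a neighbourhood of the real points of the
  annulus. The condition \<open>r < \<bar>x - a\<bar>\<close> would not be enough: for even \<open>m\<close>
  the factor \<open>sgn (-x\<^sub>0)\<close> then makes expansions around different points disagree.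
\<close>

definition tau_expansion :: "complex set \<Rightarrow> ('n paravector \<Rightarrow> 'n clifford) \<Rightarrow> 'n paravector \<Rightarrow>
    real \<Rightarrow> (int \<Rightarrow> 'n::{finite,linorder} clifford) \<Rightarrow> bool" where
  "tau_expansion \<Omega> F x a c \<longleftrightarrow>
     (\<exists>(r::real) (R::real).
        {z. r < cmod (z - of_real a) \<and> cmod (z - of_real a) < R} \<subseteq> \<Omega> \<and>
        (\<forall>y. r < norm (y - pv_real a) \<and> norm (y - pv_real a) < R \<longrightarrow>
           ((\<lambda>j. pv_powi (y - pv_real a) j \<star> c j) has_sum F y) UNIV) \<and>
        r < \<bar>fst x - a\<bar> \<and> norm (x - pv_real a) < R)"

text \<open>
  \<open>\<tau>\<^sub>m[F]\<close> has the value \<open>v\<close> at \<open>x\<close> if there is an expansion to compute it from and every such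
  expansion gives \<open>v\<close>.
\<close>

definition has_tau :: "complex set \<Rightarrow> ('n paravector \<Rightarrow> 'n clifford) \<Rightarrow> 'n paravector \<Rightarrow>
    'n::{finite,linorder} clifford \<Rightarrow> bool" where
  "has_tau \<Omega> F x v \<longleftrightarrow> (\<exists>a c. tau_expansion \<Omega> F x a c) \<and>
     (\<forall>a c. tau_expansion \<Omega> F x a c \<longrightarrow> ((\<lambda>j. tau_power j (x - pv_real a) \<star> c j) has_sum v) UNIV)"

definition tau_dom :: "complex set \<Rightarrow> ('n paravector \<Rightarrow> 'n clifford) \<Rightarrow> 'n::{finite,linorder} paravector set" where
  "tau_dom \<Omega> F = {x. \<exists>v. has_tau \<Omega> F x v}"

definition tau :: "complex set \<Rightarrow> ('n paravector \<Rightarrow> 'n clifford) \<Rightarrow> 'n paravector \<Rightarrow> 'n::{finite,linorder} clifford" where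
  "tau \<Omega> F x = (THE v. has_tau \<Omega> F x v)"

end

theory Submission
  imports Defs "HOL-Complex_Analysis.Complex_Analysis"
begin

text \<open>
  Write a paravector as \<open>x = x\<^sub>0 + v\<close> with vector part \<open>v\<close>. All three sides of the identity are one
  integral. For a Clifford-valued holomorphic \<open>G\<close> let the plane wave integral \<open>PW[G](x)\<close> be the mean of
  \<open>(1 - i \<omega>) G(x\<^sub>0 + i \<langle>v, \<omega>\<rangle>)\<close> over the unit vectors \<open>\<omega>\<close>. The antipodal map turns it into the
  mean of the slice function with stem \<open>G\<close> over its values at \<open>x\<^sub>0 + \<langle>v, \<omega>\<rangle> \<omega>\<close>, which is the dual
  Radon transform (\<open>slice_vec_dual_radon\<close>).

  \<^emph>\<open>Plane waves are the Cauchy-Kovalevskaya extension.\<close> The Cauchy-Riemann operator multiplies the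
  integrand of the derivative from the left by \<open>1 + i \<omega>\<close>, and \<open>(1 + i \<omega>)(1 - i \<omega>) = 0\<close>. Hence
  \<open>PW[G]\<close> is monogenic. Expanding \<open>G\<close> at \<open>x\<^sub>0\<close> and inserting the moments of the sphere gives
  the series \<open>\<Sum>n. c\<^sub>n v\<^sup>n G\<^sup>(\<^sup>n\<^sup>)(x\<^sub>0)\<close>, so \<open>PW[G]\<close> extends \<open>G\<close> from the real
  axis (\<open>is_GCK_plane_wave\<close>). Monogenicity forces \<open>f\<^sub>n' = d\<^sub>n f\<^bsub>n+1\<^esub>\<close> with \<open>d\<^sub>n > 0\<close> on the
  coefficients of any extension \<open>\<Sum>n. v\<^sup>n f\<^sub>n(x\<^sub>0)\<close>, so the extension is unique
  (\<open>is_GCK_unique\<close>).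

  \<^emph>\<open>The mapping \<open>\<tau>\<^sub>m\<close> on powers.\<close> The Cauchy kernel \<open>E(x) = x\<^sup>-/|x|\<^bsup>m+1\<^esup>\<close>, \<open>x\<^sup>-\<close> being the
  conjugate of \<open>x\<close>, is
  \<open>sgn (x\<^sub>0)\<^bsup>m-1\<^esup> PW[z\<^bsup>-m\<^esup>]\<close> off the hyperplane \<open>x\<^sub>0 = 0\<close> (\<open>cauchy_kernel_plane_wave\<close>). Its
  derivatives along the real axis give the negative powers. For the others, the Kelvin
  inversion turns the Taylor coefficients of \<open>E\<close> at \<open>1/x\<close> into those of \<open>t \<mapsto> E(1 - t x)\<close> at
  \<open>0\<close>, and these are binomial multiples of \<open>PW[z\<^sup>n](x)\<close>. Altogether \<open>\<tau>\<^sub>m[x\<^sup>l]\<close> is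
  \<open>\<gamma>\<^sub>m PW\<close> of the derivative of order \<open>m - 1\<close> of \<open>z\<^sup>l\<close>, off this hyperplane if \<open>l < 0\<close>
  (\<open>tau_power_eq\<close>).

  \<^emph>\<open>From powers to functions.\<close> If \<open>r < |x\<^sub>0 - a|\<close> and \<open>|x - a| < R\<close>, the points
  \<open>x\<^sub>0 + i \<langle>v, \<omega>\<rangle>\<close> fill a compact segment inside the annulus of an admissible expansion. The
  coefficients of the expansion are the Laurent coefficients, by restriction to the real axis and
  the identity theorem, and the differentiated Laurent series converges uniformly on the segment.
  Thus sum and integral may be exchanged (\<open>tau_expansion_value\<close>). The common domain consists of the
  \<open>x\<close> for which a disc around \<open>x\<^sub>0\<close> of radius greater than \<open>|v|\<close> lies in \<open>\<Omega>\<^sub>2\<close>.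
\<close>

section \<open>Bilinearity of the Clifford product\<close>

lemma cl_mult_add_left: "(x + y) \<star> z = x \<star> z + y \<star> z"
  by (simp add: cl_mult_def vec_eq_iff algebra_simps sum.distrib)

lemma cl_mult_add_right: "z \<star> (x + y) = z \<star> x + z \<star> y"
  by (simp add: cl_mult_def vec_eq_iff algebra_simps sum.distrib)

lemma cl_mult_scale_left [simp]: "(c *s x) \<star> y = c *s (x \<star> y)"
  by (simp add: cl_mult_def vec_eq_iff sum_distrib_left mult_ac)

lemma cl_mult_scale_right [simp]: "x \<star> (c *s y) = c *s (x \<star> y)"
  by (simp add: cl_mult_def vec_eq_iff sum_distrib_left mult_ac)

lemma scaleR_eq_scale: "r *\<^sub>R x = complex_of_real r *s (x :: complex ^ 'i)"
  by (simp add: vec_eq_iff scaleR_conv_of_real[where 'a = complex])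

lemma bounded_bilinear_cl_mult:
  "bounded_bilinear ((\<star>) :: 'n::{finite,linorder} clifford \<Rightarrow> 'n clifford \<Rightarrow> 'n clifford)"
  by (auto simp: bilinear_conv_bounded_bilinear[symmetric] bilinear_def scaleR_eq_scale
    cl_mult_add_left cl_mult_add_right intro!: linearI)

lemma bounded_bilinear_scale:
  "bounded_bilinear ((*s) :: complex \<Rightarrow> complex ^ 'i::finite \<Rightarrow> complex ^ 'i)"
  by (auto simp: bilinear_conv_bounded_bilinear[symmetric] bilinear_def scaleR_eq_scale
     scaleR_conv_of_real[where 'a = complex] vec_eq_iff algebra_simps intro!: linearI)

interpretation cl: bounded_bilinear "(\<star>) :: 'n::{finite,linorder} clifford \<Rightarrow> 'n clifford \<Rightarrow> 'n clifford"
  by (rule bounded_bilinear_cl_mult)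

interpretation sc: bounded_bilinear "(*s) :: complex \<Rightarrow> complex ^ 'i::finite \<Rightarrow> complex ^ 'i"
  by (rule bounded_bilinear_scale)

lemma norm_scale: "norm (c *s x) = cmod c * norm (x :: complex ^ 'i::finite)"
  by (simp add: norm_vec_def norm_mult L2_set_right_distrib)

lemma bounded_linear_cl_vec: "bounded_linear (cl_vec :: real ^ 'n::{finite,linorder} \<Rightarrow> _)"
  unfolding linear_conv_bounded_linear[symmetric]
  by (auto intro!: linearI simp: cl_vec_def sum.distrib vector_sadd_rdistrib scaleR_eq_scale
    vec_eq_iff sum_distrib_left algebra_simps)

lemmas cl_vec_add = linear_add[OF bounded_linear.linear[OF bounded_linear_cl_vec]]
  and cl_vec_scaleR = linear_scale[OF bounded_linear.linear[OF bounded_linear_cl_vec]]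
  and cl_vec_zero [simp] = linear_0[OF bounded_linear.linear[OF bounded_linear_cl_vec]]
  and cl_vec_minus = linear_neg[OF bounded_linear.linear[OF bounded_linear_cl_vec]]

text \<open>Symmetrizing the double sum leaves the anticommutators, which vanish off the diagonal.\<close>

lemma cl_vec_square: "cl_vec v \<star> cl_vec v = complex_of_real (- (norm v)\<^sup>2) *s cl_one"
proof -
  let ?q = "\<lambda>j l. complex_of_real (v $ j * v $ l) *s (cl_gen j \<star> cl_gen l :: 'a clifford)"
  have sq: "cl_vec v \<star> cl_vec v = (\<Sum>j\<in>UNIV. \<Sum>l\<in>UNIV. ?q j l)"
    by (simp add: cl_vec_def cl.sum_left cl.sum_right sc.sum_right)
      (subst sum.swap, simp add: mult.commute)
  have sw: "(\<Sum>j\<in>UNIV. \<Sum>l\<in>UNIV. ?q j l) = (\<Sum>j\<in>UNIV. \<Sum>l\<in>UNIV. ?q l j)"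
    by (rule sum.swap)
  have "2 *\<^sub>R (cl_vec v \<star> cl_vec v) = (\<Sum>j\<in>UNIV. \<Sum>l\<in>UNIV. ?q j l + ?q l j)"
    unfolding scaleR_2 sum.distrib by (simp only: sq sw[symmetric])
  also have "\<dots> = (\<Sum>j\<in>UNIV. \<Sum>l\<in>UNIV. complex_of_real (v $ j * v $ l) *s
      ((if j = l then - 2 else 0) *s cl_one))"
    by (simp only: cl_gen_anticommute[symmetric] mult.commute[of "v $ b" "v $ a" for a b]
       vector_add_ldistrib)
  also have "\<dots> = (\<Sum>j\<in>UNIV. \<Sum>l\<in>UNIV. if j = l then (complex_of_real (v $ j * v $ l) * (- 2)) *s cl_one else 0)"
    by (intro sum.cong refl) (simp add: vec_eq_iff)
  also have "\<dots> = (\<Sum>j\<in>UNIV. (complex_of_real (v $ j * v $ j) * (- 2)) *s cl_one)"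
    by simp
  also have "\<dots> = 2 *\<^sub>R (complex_of_real (- (norm v)\<^sup>2) *s cl_one)"
    by (simp only: power2_norm_eq_inner inner_vec_def sc.sum_left[symmetric])
       (simp add: vec_eq_iff scaleR_conv_of_real sum_distrib_left sum_negf mult_ac)
  finally show ?thesis
    by (rule scaleR_left_imp_eq[rotated]) simp
qed

lemma cl_vec_axis: "cl_vec (axis j 1) = cl_gen j"
proof -
  have "cl_vec (axis j 1) = (\<Sum>i\<in>UNIV. if i = j then cl_gen j else 0)"
    unfolding cl_vec_def by (intro sum.cong) (auto simp: axis_def)
  thus ?thesis by simp
qed

lemma cl_pow_scale: "cl_pow (c *s x) k = c ^ k *s cl_pow x k"
  by (induction k) (simp_all add: mult.commute)

lemma cl_pow_vec_even: "cl_pow (cl_vec v) (2 * i) = complex_of_real ((- 1) ^ i * norm v ^ (2 * i)) *s cl_one"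
proof (induction i)
  case (Suc i)
  have "cl_pow (cl_vec v) (2 * Suc i) = cl_vec v \<star> cl_vec v \<star> cl_pow (cl_vec v) (2 * i)"
    by (simp add: cl_mult_assoc)
  thus ?case unfolding Suc cl_vec_square by (simp add: cl_one_left power2_eq_square mult_ac cl.minus_left)
qed simp

lemma cl_pow_vec_odd: "cl_pow (cl_vec v) (2 * i + 1) = complex_of_real ((- 1) ^ i * norm v ^ (2 * i)) *s cl_vec v"
  unfolding Suc_eq_plus1[symmetric] cl_pow.simps cl_pow_vec_even by (simp add: cl_one_right)

section \<open>Rotation invariance of the surface measure\<close>

lemma space_sphere_measure [simp]: "space sphere_measure = sphere (0 :: real ^ 'n) 1"
  by (simp add: sphere_measure_def space_scale_measure)

lemma sets_sphere_measure [simp, measurable_cong]: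
  "sets sphere_measure = sets (restrict_space borel (sphere (0 :: real ^ 'n) 1))"
  by (simp add: sphere_measure_def)

lemma finite_measure_sphere_measure: "finite_measure (sphere_measure :: (real ^ 'n::finite) measure)"
  by (rule finite_measureI) (simp add: emeasure_sphere_measure)

lemma sphere_area_pos: "m > 0 \<Longrightarrow> sphere_area m > 0"
  by (simp add: sphere_area_def Gamma_real_pos)

lemma measure_sphere_measure: "measure (sphere_measure :: (real ^ 'n::finite) measure) (sphere 0 1) = sphere_area CARD('n)"
  using sphere_area_pos[of "CARD('n)"] by (simp add: measure_def emeasure_sphere_measure)

lemma integrable_sphere_measure:
  fixes f :: "real ^ 'n::finite \<Rightarrow> 'b::{banach, second_countable_topology}"
  assumes "continuous_on (sphere 0 1) f"
  shows "integrable sphere_measure f"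
proof -
  interpret finite_measure "sphere_measure :: (real ^ 'n) measure"
    by (rule finite_measure_sphere_measure)
  have "compact (f ` sphere 0 1)" using assms by (intro compact_continuous_image) auto
  then obtain B where "\<And>w. w \<in> sphere 0 1 \<Longrightarrow> norm (f w) \<le> B"
    using compact_imp_bounded bounded_iff by (metis imageI)
  moreover have "f \<in> borel_measurable sphere_measure"
    using borel_measurable_continuous_on_restrict[OF assms] by (simp cong: measurable_cong_sets)
  ultimately show ?thesis
    by (intro integrable_const_bound[of _ B]) (auto intro!: AE_I2)
qed

lemma nn_integral_lborel_translation:
  fixes f :: "'a::euclidean_space \<Rightarrow> ennreal"
  assumes [measurable]: "f \<in> borel_measurable borel"
  shows "(\<integral>\<^sup>+x. f (c + x) \<partial>lborel) = (\<integral>\<^sup>+x. f x \<partial>lborel)"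
  by (subst (2) lborel_distr_plus[symmetric, of c]) (simp add: nn_integral_distr)

lemma nn_integral_lborel_uminus:
  fixes f :: "'a::euclidean_space \<Rightarrow> ennreal"
  assumes [measurable]: "f \<in> borel_measurable borel"
  shows "(\<integral>\<^sup>+x. f (- x) \<partial>lborel) = (\<integral>\<^sup>+x. f x \<partial>lborel)"
proof -
  have "(lborel :: 'a measure) = distr lborel borel uminus"
    using lborel_affine[of "-1" "0 :: 'a"] by (simp add: density_1 one_ennreal_def[symmetric])
  hence "(\<integral>\<^sup>+x. f x \<partial>lborel) = (\<integral>\<^sup>+x. f x \<partial>distr lborel borel uminus)" by simp
  thus ?thesis by (simp add: nn_integral_distr)
qed

text \<open>
  The proof compares the two measures through the unit ball \<open>B\<close>, which \<open>T\<close>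
  preserves. Integrating \<open>1\<^sub>E(T x) 1\<^sub>B(T x - y)\<close> over \<open>x\<close> and
  \<open>y\<close> in the two possible orders gives \<open>\<lambda>(T\<^sup>-\<^sup>1 E)
  \<lambda>(B) = \<lambda>(E) \<lambda>(T\<^sup>-\<^sup>1 B)\<close>, and
  \<open>\<lambda>(B)\<close> cancels.
\<close>

lemma distr_lborel_orthogonal:
  fixes T :: "'a::euclidean_space \<Rightarrow> 'a"
  assumes T: "orthogonal_transformation T"
  shows "distr lborel borel T = lborel"
proof (rule measure_eqI)
  have linT: "linear T" using T by (rule orthogonal_transformation_linear)
  hence [measurable]: "T \<in> borel_measurable borel"
    by (intro borel_measurable_continuous_onI linear_continuous_on) (simp add: linear_conv_bounded_linear)
  define S where "S = inv T"
  have S: "T (S y) = y" for y unfolding S_def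
    using orthogonal_transformation_surj[OF T] by (simp add: surj_f_inv_f)
  define B :: "'a \<Rightarrow> ennreal" where "B = indicator (ball 0 1)"
  have [measurable]: "B \<in> borel_measurable borel" unfolding B_def by (intro borel_measurable_indicator) simp
  have Bneg: "B (- x) = B x" for x by (simp add: B_def indicator_def)
  have BT: "B (T x) = B x" for x using orthogonal_transformation_norm[OF T] by (simp add: B_def indicator_def)
  define b where "b = (\<integral>\<^sup>+x. B x \<partial>lborel)"
  have b: "b = emeasure lborel (ball 0 1 :: 'a set)" by (simp add: b_def B_def)
  fix E :: "'a set" assume "E \<in> sets (distr lborel borel T)"
  hence [measurable]: "E \<in> sets borel" by simp
  have "(\<integral>\<^sup>+x. indicator E (T x) \<partial>lborel) * b =
      (\<integral>\<^sup>+x. indicator E (T x) * (\<integral>\<^sup>+y. B (T x - y) \<partial>lborel) \<partial>lborel)"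
  proof -
    have "(\<integral>\<^sup>+y. B (z - y) \<partial>lborel) = b" for z
      using nn_integral_lborel_uminus[of "\<lambda>y. B (z + y)"] nn_integral_lborel_translation[of B z]
      by (simp add: b_def)
    thus ?thesis by (simp add: nn_integral_multc)
  qed
  also have "\<dots> = (\<integral>\<^sup>+x. \<integral>\<^sup>+y. indicator E (T x) * B (T x - y) \<partial>lborel \<partial>lborel)"
    by (simp add: nn_integral_cmult)
  also have "\<dots> = (\<integral>\<^sup>+y. \<integral>\<^sup>+x. indicator E (T x) * B (T x - y) \<partial>lborel \<partial>lborel)"
    by (rule lborel_pair.Fubini') measurable
  also have "\<dots> = (\<integral>\<^sup>+y. \<integral>\<^sup>+x. indicator E (y + T x) * B (T x) \<partial>lborel \<partial>lborel)"
  proof (rule nn_integral_cong)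
    fix y
    show "(\<integral>\<^sup>+x. indicator E (T x) * B (T x - y) \<partial>lborel) = (\<integral>\<^sup>+x. indicator E (y + T x) * B (T x) \<partial>lborel)"
      by (subst nn_integral_lborel_translation[of _ "S y", symmetric])
         (simp_all add: linear_add[OF linT] S)
  qed
  also have "\<dots> = (\<integral>\<^sup>+x. \<integral>\<^sup>+y. indicator E (y + T x) * B (T x) \<partial>lborel \<partial>lborel)"
    by (rule lborel_pair.Fubini') measurable
  also have "\<dots> = (\<integral>\<^sup>+x. (\<integral>\<^sup>+y. indicator E y \<partial>lborel) * B (T x) \<partial>lborel)"
  proof (rule nn_integral_cong)
    fix x
    have "(\<integral>\<^sup>+y. indicator E (y + T x) * B (T x) \<partial>lborel) = (\<integral>\<^sup>+y. indicator E (T x + y) \<partial>lborel) * B (T x)"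
      by (simp add: nn_integral_multc add.commute)
    thus "(\<integral>\<^sup>+y. indicator E (y + T x) * B (T x) \<partial>lborel) = (\<integral>\<^sup>+y. indicator E y \<partial>lborel) * B (T x)"
      by (subst (asm) nn_integral_lborel_translation) simp_all
  qed
  also have "\<dots> = emeasure lborel E * b"
    by (simp add: nn_integral_cmult BT b_def)
  also have "(\<integral>\<^sup>+x. indicator E (T x) \<partial>lborel) = (\<integral>\<^sup>+x. indicator E x \<partial>distr lborel borel T)"
    by (subst nn_integral_distr) simp_all
  finally have "emeasure (distr lborel borel T) E * b = emeasure lborel E * b"
    by simp
  moreover have "b \<noteq> 0" "b \<noteq> top"
    using b less_imp_neq[OF unit_ball_vol_pos[of "real DIM('a)"]] by (auto simp: emeasure_ball)
  ultimately show "emeasure (distr lborel borel T) E = emeasure lborel E"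
    by (simp add: ennreal_mult_cancel_left mult.commute[of _ b])
qed simp

lemma scale_measure_eq_density: "scale_measure c M = density M (\<lambda>_. c)"
  by (rule measure_eqI) (simp_all add: emeasure_density_const)

lemma integral_sphere_measure:
  fixes f :: "real ^ 'n::finite \<Rightarrow> 'b::{banach, second_countable_topology}"
  assumes "continuous_on (sphere 0 1) f"
  shows "integral\<^sup>L sphere_measure f =
    real CARD('n) *\<^sub>R (LINT x|lborel. indicator (ball 0 1 - {0}) x *\<^sub>R f (sgn x))"
proof -
  let ?B = "ball 0 1 - {0} :: (real ^ 'n) set"
  have meas: "sgn \<in> restrict_space lborel ?B \<rightarrow>\<^sub>M restrict_space borel (sphere 0 1 :: (real ^ 'n) set)"
    by (rule measurable_restrict_space3) (auto simp: norm_sgn sgn_div_norm[abs_def])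
  have f: "f \<in> borel_measurable (restrict_space borel (sphere 0 1))"
    using borel_measurable_continuous_on_restrict[OF assms] .
  have "integral\<^sup>L sphere_measure f = real CARD('n) *\<^sub>R
     (LINT x|distr (restrict_space lborel ?B) (restrict_space borel (sphere 0 1)) sgn. f x)"
    unfolding sphere_measure_def scale_measure_eq_density ennreal_of_nat_eq_real_of_nat using f
    by (subst integral_density) auto
  also have "\<dots> = real CARD('n) *\<^sub>R (LINT x|lborel. indicator ?B x *\<^sub>R f (sgn x))"
    by (subst integral_distr[OF meas f]) (simp add: integral_restrict_space)
  finally show ?thesis .
qed

text \<open>
  The surface measure is the image of Lebesgue measure on the ball under \<open>sgn\<close>, and
  \<open>sgn\<close> commutes with \<open>T\<close>.
\<close>

lemma integral_sphere_orthogonal: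
  fixes T :: "real ^ 'n::finite \<Rightarrow> real ^ 'n" and f :: "real ^ 'n::finite \<Rightarrow> 'b::{banach, second_countable_topology}"
  assumes T: "orthogonal_transformation T" and f: "continuous_on (sphere 0 1) f"
  shows "(LINT w|sphere_measure. f (T w)) = (LINT w|sphere_measure. f w)"
proof -
  let ?B = "ball 0 1 - {0} :: (real ^ 'n) set"
  have linT: "linear T" using T by (rule orthogonal_transformation_linear)
  hence cT: "continuous_on A T" for A
    by (intro linear_continuous_on) (simp add: linear_conv_bounded_linear)
  have nT: "norm (T x) = norm x" for x using T by (rule orthogonal_transformation_norm)
  have [measurable]: "T \<in> borel_measurable borel"
    by (intro borel_measurable_continuous_onI cT)
  have "continuous_on (sphere 0 1) (\<lambda>w. f (T w))"
    by (rule continuous_on_compose2[OF f cT]) (auto simp: nT)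
  hence "(LINT w|sphere_measure. f (T w)) = real CARD('n) *\<^sub>R (LINT x|lborel. indicator ?B x *\<^sub>R f (T (sgn x)))"
    by (rule integral_sphere_measure)
  also have "(LINT x|lborel. indicator ?B x *\<^sub>R f (T (sgn x))) = (LINT x|lborel. indicator ?B (T x) *\<^sub>R f (sgn (T x)))"
  proof (rule Bochner_Integration.integral_cong[OF refl])
    fix x
    have "T x = 0 \<longleftrightarrow> x = 0" using nT[of x] by (metis norm_eq_zero)
    hence "indicator ?B (T x) = (indicator ?B x :: real)" by (simp add: indicator_def nT)
    moreover have "sgn (T x) = T (sgn x)" by (simp add: sgn_div_norm nT linear_scale[OF linT])
    ultimately show "indicator ?B x *\<^sub>R f (T (sgn x)) = indicator ?B (T x) *\<^sub>R f (sgn (T x))" by simp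
  qed
  also have "\<dots> = (LINT x|distr lborel borel T. indicator ?B x *\<^sub>R f (sgn x))"
  proof (rule integral_distr[symmetric])
    have "continuous_on ?B (\<lambda>x. f (sgn x))"
      by (rule continuous_on_compose2[OF f]) (auto simp: norm_sgn intro!: continuous_on_sgn continuous_intros split: if_splits)
    thus "(\<lambda>x. indicator ?B x *\<^sub>R f (sgn x)) \<in> borel_measurable borel"
      by (intro borel_measurable_continuous_on_indicator) auto
  qed simp
  also have "\<dots> = (LINT x|lborel. indicator ?B x *\<^sub>R f (sgn x))"
    by (simp only: distr_lborel_orthogonal[OF T])
  finally show ?thesis by (simp only: integral_sphere_measure[OF f])
qed

section \<open>Moments of the surface measure\<close>

text \<open>
  The numbers \<open>c\<^sub>n\<close> of the series \<open>\<Sum>n. c\<^sub>n v\<^sup>n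
  f\<^sup>(\<^sup>n\<^sup>)(x\<^sub>0)\<close>. The divisor \<open>d\<^sub>n\<close> is the factor
  in \<open>D v\<^bsup>n+1\<^esup> = - d\<^sub>n v\<^sup>n\<close> for the Dirac operator
  \<open>D\<close>; up to \<open>n!\<close> they are also the normalized moments of the sphere.
\<close>

primrec gck_coeff :: "nat \<Rightarrow> nat \<Rightarrow> real" where
  "gck_coeff m 0 = 1"
| "gck_coeff m (Suc n) = gck_coeff m n / (if even n then real m + real n else real n + 1)"

text \<open>
  The integral is a polynomial in \<open>s\<close>, so its derivative at \<open>0\<close> is a
  coefficient of the binomial expansion and no exchange of derivative and integral has to be
  justified.
\<close>

lemma sphere_moment_derivative:
  fixes v u :: "real ^ 'n::finite"
  assumes q: "continuous_on (sphere 0 1) q"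
  shows "((\<lambda>s. LINT w|sphere_measure. ((v + s *\<^sub>R u) \<bullet> w) ^ k * q w) has_real_derivative
     real k * (LINT w|sphere_measure. (v \<bullet> w) ^ (k - 1) * (u \<bullet> w) * q w)) (at 0)"
proof -
  define c where "c = (\<lambda>l. real (k choose l) * (LINT w|sphere_measure. (v \<bullet> w) ^ (k - l) * (u \<bullet> w) ^ l * q w))"
  have int: "integrable sphere_measure (\<lambda>w. (v \<bullet> w) ^ (k - l) * (u \<bullet> w) ^ l * q w)" for l
    by (intro integrable_sphere_measure continuous_intros q)
  have eq: "(LINT w|sphere_measure. ((v + s *\<^sub>R u) \<bullet> w) ^ k * q w) = (\<Sum>l\<le>k. c l * s ^ l)" for s
  proof -
    have "((v + s *\<^sub>R u) \<bullet> w) ^ k * q w =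
       (\<Sum>l\<le>k. (real (k choose l) * s ^ l) * ((v \<bullet> w) ^ (k - l) * (u \<bullet> w) ^ l * q w))" for w
    proof -
      have *: "(v + s *\<^sub>R u) \<bullet> w = s * (u \<bullet> w) + v \<bullet> w"
        by (simp add: inner_add_left add.commute)
      show ?thesis unfolding * binomial_ring sum_distrib_right
        by (simp add: power_mult_distrib mult_ac)
    qed
    hence "(LINT w|sphere_measure. ((v + s *\<^sub>R u) \<bullet> w) ^ k * q w) = (LINT w|sphere_measure.
       (\<Sum>l\<le>k. (real (k choose l) * s ^ l) * ((v \<bullet> w) ^ (k - l) * (u \<bullet> w) ^ l * q w)))"
      by (simp only:)
    also have "\<dots> = (\<Sum>l\<le>k. c l * s ^ l)"
      by (subst Bochner_Integration.integral_sum, rule integrable_mult_right[OF int])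
         (simp only: integral_mult_right_zero c_def, simp only: mult_ac)
    finally show ?thesis .
  qed
  have "((\<lambda>s. \<Sum>l\<le>k. c l * s ^ l) has_real_derivative (\<Sum>l\<le>k. c l * (real l * 0 ^ (l - 1)))) (at 0)"
    by (auto intro!: derivative_eq_intros sum.cong)
  also have "(\<Sum>l\<le>k. c l * (real l * 0 ^ (l - 1))) = (\<Sum>l\<le>k. if l = 1 then c 1 else 0)"
    by (intro sum.cong) (auto simp: power_0_left)
  also have "\<dots> = real k * (LINT w|sphere_measure. (v \<bullet> w) ^ (k - 1) * (u \<bullet> w) * q w)"
    by (auto simp: c_def)
  finally show ?thesis unfolding eq .
qed

lemma sphere_moment_odd:
  fixes v :: "real ^ 'n::finite"
  assumes "odd k"
  shows "(LINT w|sphere_measure. (v \<bullet> w) ^ k) = 0"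
proof -
  have "(LINT w|sphere_measure. (v \<bullet> (- w)) ^ k) = (LINT w|sphere_measure. (v \<bullet> w) ^ k)"
    by (intro integral_sphere_orthogonal continuous_intros)
       (simp add: orthogonal_transformation_def linear_uminus)
  thus ?thesis using assms by simp
qed

lemma sphere_moment_even_radial:
  fixes v e :: "real ^ 'n::finite"
  assumes "norm e = 1"
  shows "(LINT w|sphere_measure. (v \<bullet> w) ^ (2 * n)) = (LINT w|sphere_measure. (e \<bullet> w) ^ (2 * n)) * (v \<bullet> v) ^ n"
proof -
  obtain T where T: "orthogonal_transformation T" "T (norm v *\<^sub>R e) = v"
    using orthogonal_transformation_exists[of "norm v *\<^sub>R e" v] assms by auto
  have "(LINT w|sphere_measure. (v \<bullet> w) ^ (2 * n)) = (LINT w|sphere_measure. (v \<bullet> T w) ^ (2 * n))"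
    by (rule integral_sphere_orthogonal[symmetric]) (auto intro!: T continuous_intros)
  also have "\<dots> = (LINT w|sphere_measure. ((norm v *\<^sub>R e) \<bullet> w) ^ (2 * n))"
    using T by (metis orthogonal_transformation_def)
  also have "\<dots> = (LINT w|sphere_measure. (e \<bullet> w) ^ (2 * n)) * (v \<bullet> v) ^ n"
    by (simp add: power_mult_distrib power_mult power2_norm_eq_inner)
  finally show ?thesis .
qed

text \<open>
  By rotation invariance the even moment is \<open>\<mu>\<^sub>n |v|\<^bsup>2n\<^esup>\<close>. One
  derivative in \<open>v\<close> expresses the vector moment by
  \<open>\<mu>\<^bsub>n+1\<^esub>\<close>; a second one, summed over the coordinate directions, uses
  \<open>|\<omega>| = 1\<close> to return to \<open>\<mu>\<^sub>n\<close>. This amounts to applying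
  the Laplacian, and gives \<open>(2n + 1) \<mu>\<^sub>n = (m + 2n)
  \<mu>\<^bsub>n+1\<^esub>\<close>.
\<close>

lemma sphere_moments:
  fixes v u :: "real ^ 'n::finite"
  shows sphere_moment_even: "(LINT w|sphere_measure. (v \<bullet> w) ^ (2 * n)) =
     sphere_area CARD('n) * fact (2 * n) * gck_coeff CARD('n) (2 * n) * (v \<bullet> v) ^ n"
  and sphere_moment_vector: "(LINT w|sphere_measure. (v \<bullet> w) ^ (2 * n + 1) * (u \<bullet> w)) =
     sphere_area CARD('n) * fact (2 * n + 1) * gck_coeff CARD('n) (2 * n + 1) * (v \<bullet> v) ^ n * (v \<bullet> u)"
proof -
  define e :: "real ^ 'n" where "e = axis undefined 1"
  have e: "norm e = 1" "e \<bullet> e = 1" by (simp_all add: e_def inner_axis_axis)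
  define \<mu> where "\<mu> = (\<lambda>n. LINT w|sphere_measure. (e \<bullet> w) ^ (2 * n))"
  have M: "(LINT w|sphere_measure. (v \<bullet> w) ^ (2 * n)) = \<mu> n * (v \<bullet> v) ^ n" for n and v :: "real ^ 'n"
    unfolding \<mu>_def by (rule sphere_moment_even_radial[OF e(1)])
  have V: "(LINT w|sphere_measure. (v \<bullet> w) ^ (2 * n + 1) * (u \<bullet> w)) = \<mu> (Suc n) * (v \<bullet> v) ^ n * (v \<bullet> u)"
    for n and v u :: "real ^ 'n"
  proof -
    have "((\<lambda>s. LINT w|sphere_measure. ((v + s *\<^sub>R u) \<bullet> w) ^ (2 * Suc n) * 1) has_real_derivative
      real (2 * Suc n) * (LINT w|sphere_measure. (v \<bullet> w) ^ (2 * Suc n - 1) * (u \<bullet> w) * 1)) (at 0)"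
      by (rule sphere_moment_derivative) simp
    moreover have "((\<lambda>s. (v + s *\<^sub>R u) \<bullet> (v + s *\<^sub>R u)) has_real_derivative 2 * (v \<bullet> u)) (at 0)"
      by (auto intro!: derivative_eq_intros simp: inner_add_left inner_add_right inner_commute)
    from DERIV_cmult[OF DERIV_power_Suc[OF this, of n], of "\<mu> (Suc n)"]
    have "((\<lambda>s. \<mu> (Suc n) * ((v + s *\<^sub>R u) \<bullet> (v + s *\<^sub>R u)) ^ Suc n) has_real_derivative
       \<mu> (Suc n) * (real (Suc n) * (v \<bullet> v) ^ n * (2 * (v \<bullet> u)))) (at 0)"
      by (simp add: mult_ac)
    ultimately have "real (2 * Suc n) * (LINT w|sphere_measure. (v \<bullet> w) ^ (2 * Suc n - 1) * (u \<bullet> w))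
       = \<mu> (Suc n) * (real (Suc n) * (v \<bullet> v) ^ n * (2 * (v \<bullet> u)))"
      unfolding mult_1_right M by (rule DERIV_unique)
    hence "(2 * real (Suc n)) * (LINT w|sphere_measure. (v \<bullet> w) ^ (2 * n + 1) * (u \<bullet> w)) =
       (2 * real (Suc n)) * (\<mu> (Suc n) * (v \<bullet> v) ^ n * (v \<bullet> u))"
      by (simp add: algebra_simps)
    thus ?thesis unfolding mult_left_cancel[OF mult_pos_pos[THEN less_imp_neq[symmetric]], OF zero_less_numeral of_nat_0_less_iff[THEN iffD2, OF zero_less_Suc]] by simp
  qed
  have rec: "real (2 * n + 1) * \<mu> n = \<mu> (Suc n) * (real CARD('n) + 2 * real n)" for n
  proof -
    have "real (2 * n + 1) * (LINT w|sphere_measure. (e \<bullet> w) ^ (2 * n) * ((u \<bullet> w) * (u \<bullet> w))) =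
       \<mu> (Suc n) * (real n * 2 * (e \<bullet> u)\<^sup>2 + u \<bullet> u)" for u
    proof -
      have "((\<lambda>s. LINT w|sphere_measure. ((e + s *\<^sub>R u) \<bullet> w) ^ (2 * n + 1) * (u \<bullet> w)) has_real_derivative
        real (2 * n + 1) * (LINT w|sphere_measure. (e \<bullet> w) ^ (2 * n + 1 - 1) * (u \<bullet> w) * (u \<bullet> w))) (at 0)"
        by (rule sphere_moment_derivative) (intro continuous_intros)
      moreover have "((\<lambda>s. \<mu> (Suc n) * ((e + s *\<^sub>R u) \<bullet> (e + s *\<^sub>R u)) ^ n * ((e + s *\<^sub>R u) \<bullet> u)) has_real_derivative
         \<mu> (Suc n) * (real n * 2 * (e \<bullet> u)\<^sup>2 + u \<bullet> u)) (at 0)"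
        by (auto intro!: derivative_eq_intros simp: e inner_add_left inner_add_right inner_commute
           power2_eq_square algebra_simps)
      ultimately show ?thesis
        unfolding V by (simp add: DERIV_unique mult.assoc)
    qed
    hence "(\<Sum>j\<in>UNIV. real (2 * n + 1) * (LINT w|sphere_measure. (e \<bullet> w) ^ (2 * n) * ((axis j 1 \<bullet> w) * (axis j 1 \<bullet> w))))
       = (\<Sum>j\<in>UNIV. \<mu> (Suc n) * (real n * 2 * (e \<bullet> axis j 1)\<^sup>2 + axis j 1 \<bullet> axis j (1::real)))"
      by simp
    also have "\<dots> = \<mu> (Suc n) * (real n * 2 * (e \<bullet> e) + real CARD('n))"
    proof -
      have "(\<Sum>j\<in>UNIV. (e \<bullet> axis j 1)\<^sup>2) = e \<bullet> e"
        unfolding inner_vec_def[of e e] by (simp add: inner_axis power2_eq_square)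
      thus ?thesis
        unfolding sum_distrib_left[symmetric] sum.distrib by (simp add: inner_axis_axis)
    qed
    also have "(\<Sum>j\<in>UNIV. real (2 * n + 1) * (LINT w|sphere_measure. (e \<bullet> w) ^ (2 * n) * ((axis j 1 \<bullet> w) * (axis j 1 \<bullet> w))))
       = real (2 * n + 1) * (LINT w|sphere_measure. (\<Sum>j\<in>UNIV. (e \<bullet> w) ^ (2 * n) * ((axis j 1 \<bullet> w) * (axis j 1 \<bullet> w))))"
      by (subst Bochner_Integration.integral_sum)
         (auto intro!: integrable_sphere_measure continuous_intros simp: sum_distrib_left)
    also have "(LINT w|sphere_measure. (\<Sum>j\<in>UNIV. (e \<bullet> w) ^ (2 * n) * ((axis j 1 \<bullet> w) * (axis j 1 \<bullet> w)))) =
       (LINT w|sphere_measure. (e \<bullet> w) ^ (2 * n))"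
    proof (rule Bochner_Integration.integral_cong[OF refl])
      fix w :: "real ^ 'n" assume "w \<in> space sphere_measure"
      hence "w \<bullet> w = 1" by (simp add: norm_eq_1)
      moreover have "(\<Sum>j\<in>UNIV. (axis j 1 \<bullet> w) * (axis j 1 \<bullet> w)) = w \<bullet> w"
        unfolding inner_vec_def[of w w] by (intro sum.cong refl) (simp add: inner_axis')
      ultimately show "(\<Sum>j\<in>UNIV. (e \<bullet> w) ^ (2 * n) * ((axis j 1 \<bullet> w) * (axis j 1 \<bullet> w))) = (e \<bullet> w) ^ (2 * n)"
        by (simp add: sum_distrib_left[symmetric])
    qed
    finally show ?thesis by (simp add: \<mu>_def e algebra_simps)
  qed
  have mu: "\<mu> n = sphere_area CARD('n) * fact (2 * n) * gck_coeff CARD('n) (2 * n)" for n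
  proof (induction n)
    case 0
    show ?case by (simp add: \<mu>_def measure_sphere_measure)
  next
    case (Suc n)
    have "\<mu> (Suc n) = real (2 * n + 1) * \<mu> n / (real CARD('n) + 2 * real n)"
    proof -
      have "real CARD('n) + 2 * real n > 0" by (intro add_pos_nonneg) simp_all
      thus ?thesis by (subst rec) simp
    qed
    thus ?case unfolding Suc by (simp add: divide_simps)
  qed
  show "(LINT w|sphere_measure. (v \<bullet> w) ^ (2 * n)) =
     sphere_area CARD('n) * fact (2 * n) * gck_coeff CARD('n) (2 * n) * (v \<bullet> v) ^ n"
    unfolding M mu ..
  show "(LINT w|sphere_measure. (v \<bullet> w) ^ (2 * n + 1) * (u \<bullet> w)) =
     sphere_area CARD('n) * fact (2 * n + 1) * gck_coeff CARD('n) (2 * n + 1) * (v \<bullet> v) ^ n * (v \<bullet> u)"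
    unfolding V mu by (simp add: divide_simps)
qed

lemma sphere_moment_cl_vec:
  fixes v :: "real ^ 'n::{finite,linorder}"
  shows "(LINT w|sphere_measure. complex_of_real ((v \<bullet> w) ^ (2 * n + 1)) *s (cl_vec w :: 'n clifford)) =
     complex_of_real (sphere_area CARD('n) * fact (2 * n + 1) * gck_coeff CARD('n) (2 * n + 1) * (v \<bullet> v) ^ n) *s cl_vec v"
proof -
  have "(LINT w|sphere_measure. complex_of_real ((v \<bullet> w) ^ (2 * n + 1)) *s (cl_vec w :: 'n clifford)) =
     (LINT w|sphere_measure. (\<Sum>j\<in>UNIV. ((v \<bullet> w) ^ (2 * n + 1) * (axis j 1 \<bullet> w)) *\<^sub>R cl_gen j))"
    unfolding cl_vec_def sc.sum_right
    by (intro Bochner_Integration.integral_cong refl sum.cong)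
       (simp add: scaleR_eq_scale inner_axis')
  also have "\<dots> = (\<Sum>j\<in>UNIV. (LINT w|sphere_measure. (v \<bullet> w) ^ (2 * n + 1) * (axis j 1 \<bullet> w)) *\<^sub>R cl_gen j)"
    by (subst Bochner_Integration.integral_sum)
       (auto intro!: integrable_sphere_measure continuous_intros sum.cong integral_scaleR_left)
  also have "\<dots> = complex_of_real (sphere_area CARD('n) * fact (2 * n + 1) * gck_coeff CARD('n) (2 * n + 1) * (v \<bullet> v) ^ n) *s cl_vec v"
    unfolding sphere_moment_vector cl_vec_def sc.sum_right
    by (intro sum.cong refl) (simp add: scaleR_eq_scale inner_axis)
  finally show ?thesis .
qed

lemma integral_scale:
  assumes "integrable M f"
  shows "(LINT w|M. c *s f w) = c *s (LINT w|M. f w :: complex ^ 'i::finite)"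
  using integral_bounded_linear[OF sc.bounded_linear_right assms] .

lemma integrable_scale:
  assumes "integrable M f"
  shows "integrable M (\<lambda>w. c *s (f w :: complex ^ 'i::finite))"
  using integrable_bounded_linear[OF sc.bounded_linear_right assms] .

lemma uminus_eq_self_imp_zero:
  fixes x :: "'a::real_vector"
  assumes "- x = x"
  shows "x = 0"
proof -
  have "2 *\<^sub>R x = x + - x" unfolding scaleR_2 assms ..
  thus ?thesis by simp
qed

text \<open>
  Even powers pair with the scalar part of \<open>1 - i \<omega>\<close> and odd powers with its
  vector part; the remaining integrals are odd under the antipodal map.
\<close>

lemma plane_wave_moment:
  fixes v :: "real ^ 'n::{finite,linorder}"
  shows "(LINT w|sphere_measure. (\<i> * complex_of_real (v \<bullet> w)) ^ n *s (cl_one - \<i> *s cl_vec w :: 'n clifford)) =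
     complex_of_real (sphere_area CARD('n) * fact n * gck_coeff CARD('n) n) *s cl_pow (cl_vec v) n"
proof -
  have cont: "continuous_on A (\<lambda>w. cl_vec w :: 'n clifford)" for A
    by (intro linear_continuous_on bounded_linear_cl_vec)
  have int1: "integrable sphere_measure (\<lambda>w. complex_of_real ((v \<bullet> w) ^ n) *s cl_one :: 'n clifford)"
    and int2: "integrable sphere_measure (\<lambda>w. complex_of_real ((v \<bullet> w) ^ n) *s cl_vec w :: 'n clifford)"
    by (intro integrable_sphere_measure sc.continuous_on continuous_intros cont)+
  have "(LINT w|sphere_measure. (\<i> * complex_of_real (v \<bullet> w)) ^ n *s (cl_one - \<i> *s cl_vec w :: 'n clifford)) =
    (LINT w|sphere_measure. (\<i> ^ n) *s (complex_of_real ((v \<bullet> w) ^ n) *s cl_one) - (\<i> ^ Suc n) *s (complex_of_real ((v \<bullet> w) ^ n) *s cl_vec w))"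
    by (intro Bochner_Integration.integral_cong) (simp_all add: sc.diff_right power_mult_distrib mult_ac)
  also have "\<dots> = (\<i> ^ n) *s (LINT w|sphere_measure. complex_of_real ((v \<bullet> w) ^ n) *s cl_one) -
      (\<i> ^ Suc n) *s (LINT w|sphere_measure. complex_of_real ((v \<bullet> w) ^ n) *s cl_vec w)"
    using int1 int2 by (simp only: integral_scale integrable_scale Bochner_Integration.integral_diff)
  also have "(LINT w|sphere_measure. complex_of_real ((v \<bullet> w) ^ n) *s cl_one :: 'n clifford) =
      complex_of_real (LINT w|sphere_measure. (v \<bullet> w) ^ n) *s cl_one"
    by (subst integral_bounded_linear[OF sc.bounded_linear_left])
       (auto intro!: integrable_sphere_measure continuous_intros simp del: of_real_power)
  finally have eq: "(LINT w|sphere_measure. (\<i> * complex_of_real (v \<bullet> w)) ^ n *s (cl_one - \<i> *s cl_vec w :: 'n clifford)) =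
    (\<i> ^ n) *s (complex_of_real (LINT w|sphere_measure. (v \<bullet> w) ^ n) *s cl_one) -
      (\<i> ^ Suc n) *s (LINT w|sphere_measure. complex_of_real ((v \<bullet> w) ^ n) *s cl_vec w)" .
  show ?thesis
  proof (cases "even n")
    case True
    then obtain i where n: "n = 2 * i" by blast
    have "(LINT w|sphere_measure. complex_of_real ((v \<bullet> (- w)) ^ n) *s (cl_vec (- w) :: 'n clifford)) =
       (LINT w|sphere_measure. complex_of_real ((v \<bullet> w) ^ n) *s (cl_vec w :: 'n clifford))"
      by (rule integral_sphere_orthogonal[where T = uminus],
          simp add: orthogonal_transformation_def linear_uminus)
         (intro sc.continuous_on continuous_intros cont)
    hence "- (LINT w|sphere_measure. complex_of_real ((v \<bullet> w) ^ n) *s (cl_vec w :: 'n clifford)) =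
        (LINT w|sphere_measure. complex_of_real ((v \<bullet> w) ^ n) *s (cl_vec w :: 'n clifford))"
      using True by (simp add: cl_vec_minus sc.minus_right del: of_real_power)
    hence "(LINT w|sphere_measure. complex_of_real ((v \<bullet> w) ^ n) *s (cl_vec w :: 'n clifford)) = 0"
      by (rule uminus_eq_self_imp_zero)
    thus ?thesis unfolding eq unfolding n sphere_moment_even cl_pow_vec_even
      by (simp add: power_mult power2_norm_eq_inner)
  next
    case False
    then obtain i where n: "n = 2 * i + 1" by (metis oddE)
    show ?thesis unfolding eq sphere_moment_odd[OF False]
      unfolding n sphere_moment_cl_vec cl_pow_vec_odd
      by (simp add: power_mult power2_norm_eq_inner vec_eq_iff)
  qed
qed

section \<open>Power series in a real variable\<close>

text \<open>
  Term by term differentiation for coefficients in a Euclidean space, one coordinate at a time.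
\<close>

lemma powser_has_vector_derivative:
  fixes a :: "nat \<Rightarrow> 'a::euclidean_space"
  assumes G: "\<And>s. \<bar>s\<bar> < r \<Longrightarrow> (\<lambda>n. s ^ n *\<^sub>R a n) sums G s" and s: "\<bar>s\<bar> < r"
  shows "\<exists>D. (G has_vector_derivative D) (at s) \<and> (\<lambda>n. s ^ n *\<^sub>R (real (Suc n) *\<^sub>R a (Suc n))) sums D"
proof -
  define c where "c = (\<lambda>b n. a n \<bullet> b)"
  have c: "(\<lambda>n. c b n * s ^ n) sums (G s \<bullet> b)" if "\<bar>s\<bar> < r" for b s
    using bounded_linear.sums[OF bounded_linear_inner_left G[OF that], of b]
    by (simp add: c_def mult.commute)
  define D where "D = (\<Sum>b\<in>Basis. (\<Sum>n. diffs (c b) n * s ^ n) *\<^sub>R b)"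
  have Db: "(\<lambda>n. diffs (c b) n * s ^ n) sums (D \<bullet> b)" if "b \<in> Basis" for b
  proof -
    have "summable (\<lambda>n. diffs (c b) n * s ^ n)"
      by (rule termdiff_converges[of _ r]) (use c s in \<open>auto simp: sums_iff\<close>)
    thus ?thesis using that
      by (simp add: D_def inner_sum_left inner_Basis if_distrib[of "\<lambda>x. _ * x"] sum.delta' summable_sums
         cong: if_cong)
  qed
  have "((\<lambda>t. G t \<bullet> b) has_real_derivative D \<bullet> b) (at s)" if "b \<in> Basis" for b
  proof -
    have "((\<lambda>t. \<Sum>n. c b n * t ^ n) has_real_derivative (\<Sum>n. diffs (c b) n * s ^ n)) (at s)"
      by (rule termdiffs_strong'[of r]) (use c s in \<open>auto simp: sums_iff\<close>)
    moreover have "\<forall>\<^sub>F t in nhds s. t \<in> {-r<..<r}"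
      by (rule eventually_nhds_in_open) (use s in auto)
    hence "\<forall>\<^sub>F t in nhds s. (\<Sum>n. c b n * t ^ n) = G t \<bullet> b"
      by eventually_elim (rule sums_unique[OF c, symmetric], auto)
    ultimately show ?thesis using Db[OF that]
      by (subst (asm) DERIV_cong_ev[OF refl _ refl]) (auto simp: sums_iff)
  qed
  hence "(G has_vector_derivative D) (at s)"
    unfolding has_vector_derivative_def has_derivative_componentwise_within[of G]
    by (simp add: has_field_derivative_def mult_commute_abs)
  moreover have "(\<lambda>n. s ^ n *\<^sub>R (real (Suc n) *\<^sub>R a (Suc n))) sums D"
  proof -
    have "(\<lambda>n. \<Sum>b\<in>Basis. (diffs (c b) n * s ^ n) *\<^sub>R b) sums (\<Sum>b\<in>Basis. (D \<bullet> b) *\<^sub>R b)"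
      by (intro sums_sum bounded_linear.sums[OF bounded_linear_scaleR_left] Db)
    moreover have "(\<Sum>b\<in>Basis. (diffs (c b) n * s ^ n) *\<^sub>R b) = s ^ n *\<^sub>R (real (Suc n) *\<^sub>R a (Suc n))" for n
    proof -
      have "s ^ n *\<^sub>R (real (Suc n) *\<^sub>R a (Suc n)) =
         (\<Sum>b\<in>Basis. ((s ^ n *\<^sub>R (real (Suc n) *\<^sub>R a (Suc n))) \<bullet> b) *\<^sub>R b)"
        by (simp only: euclidean_representation)
      also have "\<dots> = (\<Sum>b\<in>Basis. (diffs (c b) n * s ^ n) *\<^sub>R b)"
        by (intro sum.cong refl) (simp add: diffs_def c_def mult_ac)
      finally show ?thesis by simp
    qed
    ultimately show ?thesis by (simp add: euclidean_representation)
  qed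
  ultimately show ?thesis by blast
qed

lemma vderiv_cong:
  assumes "eventually (\<lambda>t. f t = g t) (nhds t)"
  shows "vderiv f t = vderiv g t"
  unfolding vderiv_def
  by (rule vector_derivative_cong_eq) (use assms in auto)

text \<open>The iterated derivatives of the definitions are read off from power series in this way.\<close>

lemma higher_vderiv_powser:
  fixes a :: "nat \<Rightarrow> 'a::euclidean_space"
  assumes "\<And>s. \<bar>s\<bar> < r \<Longrightarrow> (\<lambda>n. s ^ n *\<^sub>R a n) sums G s" and "r > 0"
  shows "(vderiv ^^ n) G 0 = fact n *\<^sub>R a n"
  using assms(1)
proof (induction n arbitrary: G a)
  case 0
  have "(\<lambda>n. 0 ^ n *\<^sub>R a n) sums G 0" using 0 \<open>r > 0\<close> by simp
  moreover have "(\<lambda>n. 0 ^ n *\<^sub>R a n) sums a 0"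
    using sums_single[of 0 a] by (simp add: power_0_left if_distrib[of "\<lambda>x. x *\<^sub>R _"] cong: if_cong)
  ultimately show ?case using sums_unique2 by auto
next
  case (Suc n)
  have "(\<lambda>n. s ^ n *\<^sub>R (real (Suc n) *\<^sub>R a (Suc n))) sums vderiv G s" if "\<bar>s\<bar> < r" for s
    using powser_has_vector_derivative[OF Suc.prems that] vector_derivative_at unfolding vderiv_def by metis
  hence "(vderiv ^^ n) (vderiv G) 0 = fact n *\<^sub>R (real (Suc n) *\<^sub>R a (Suc n))"
    by (rule Suc.IH)
  thus ?case by (simp add: funpow_swap1 mult.commute del: of_nat_Suc)
qed

lemma powser_unique:
  fixes a b :: "nat \<Rightarrow> 'a::euclidean_space"
  assumes "\<And>s. \<bar>s\<bar> < r \<Longrightarrow> (\<lambda>n. s ^ n *\<^sub>R a n) sums G s" "\<And>s. \<bar>s\<bar> < r \<Longrightarrow> (\<lambda>n. s ^ n *\<^sub>R b n) sums G s" and "r > 0"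
  shows "a n = b n"
  using higher_vderiv_powser[OF assms(1,3), of n] higher_vderiv_powser[OF assms(2,3), of n] by simp

section \<open>Power series indexed by words\<close>

text \<open>
  The multinomial theorem without multinomial coefficients: the terms of the expanded power are
  indexed by words in \<open>B\<close>.
\<close>

lemma sum_lists_length_prod:
  fixes y :: "'b \<Rightarrow> 'c::comm_semiring_1"
  assumes "finite B"
  shows "(\<Sum>xs | set xs \<subseteq> B \<and> length xs = n. prod_list (map y xs)) = (\<Sum>b\<in>B. y b) ^ n"
proof (induction n)
  case (Suc n)
  have "(\<Sum>xs | set xs \<subseteq> B \<and> length xs = Suc n. prod_list (map y xs)) =
    (\<Sum>(xs, b) \<in> {xs. set xs \<subseteq> B \<and> length xs = n} \<times> B. y b * prod_list (map y xs))"
    unfolding lists_length_Suc_eq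
    by (subst sum.reindex) (auto simp: inj_on_def case_prod_unfold)
  also have "\<dots> = (\<Sum>b\<in>B. y b) ^ Suc n"
    by (simp add: sum.cartesian_product[symmetric] sum_distrib_right[symmetric] sum_distrib_left[symmetric] Suc)
  finally show ?case .
qed (simp cong: conj_cong)

text \<open>Grouping words by their length reduces absolute summability to a geometric series.\<close>

lemma has_sum_listsI:
  fixes f :: "'b list \<Rightarrow> 'a::banach"
  assumes B: "finite B" and g: "(g has_sum S) UNIV"
    and fg: "\<And>n. (\<Sum>xs | set xs \<subseteq> B \<and> length xs = n. f xs) = g n"
    and bound: "\<And>xs. set xs \<subseteq> B \<Longrightarrow> norm (f xs) \<le> C * prod_list (map q xs)"
    and q: "\<And>b. b \<in> B \<Longrightarrow> q b \<ge> (0::real)" "(\<Sum>b\<in>B. q b) < 1" and C: "C \<ge> 0"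
  shows "(f has_sum S) (lists B)" and "(\<lambda>xs. C * prod_list (map q xs)) summable_on lists B"
proof -
  let ?L = "\<lambda>n. {xs. set xs \<subseteq> B \<and> length xs = n}"
  have fin: "finite (?L n)" for n using B by (rule finite_lists_length_eq)
  have bij: "bij_betw snd (Sigma UNIV ?L) (lists B)"
    by (rule bij_betwI[of _ _ _ "\<lambda>xs. (length xs, xs)"]) auto
  have q': "\<And>xs. set xs \<subseteq> B \<Longrightarrow> prod_list (map q xs) \<ge> 0"
    using q by (intro prod_list_nonneg) auto
  have "(\<lambda>(n, xs). C * prod_list (map q xs)) summable_on (Sigma UNIV ?L)"
  proof (rule summable_on_SigmaI)
    fix n
    show "((\<lambda>xs. case (n, xs) of (n, xs) \<Rightarrow> C * prod_list (map q xs)) has_sum C * (\<Sum>b\<in>B. q b) ^ n) (?L n)"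
      using has_sum_finite[OF fin[of n], of "\<lambda>xs. C * prod_list (map q xs)"]
      by (simp add: sum_distrib_left[symmetric] sum_lists_length_prod[OF B])
  next
    have "0 \<le> (\<Sum>b\<in>B. q b)" using q by (intro sum_nonneg) auto
    thus "(\<lambda>n. C * (\<Sum>b\<in>B. q b) ^ n) summable_on UNIV"
      using q(2) by (intro summable_on_cmult_right norm_summable_imp_summable_on) simp
  qed (use q' C in auto)
  hence s: "(\<lambda>p. C * prod_list (map q (snd p))) summable_on (Sigma UNIV ?L)"
    by (simp add: case_prod_unfold)
  show "(\<lambda>xs. C * prod_list (map q xs)) summable_on lists B"
    using s by (subst summable_on_reindex_bij_betw[OF bij, symmetric])
  have "((\<lambda>p. f (snd p)) has_sum S) (Sigma UNIV ?L)"
  proof (rule has_sum_SigmaI[OF _ g])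
    fix n show "((\<lambda>xs. f (snd (n, xs))) has_sum g n) (?L n)"
      using has_sum_finite[OF fin[of n], of f] by (simp add: fg)
  next
    show "(\<lambda>p. f (snd p)) summable_on (Sigma UNIV ?L)"
      by (rule abs_summable_summable, rule Infinite_Sum.abs_summable_on_comparison_test'[OF s]) (auto intro!: bound)
  qed
  thus "(f has_sum S) (lists B)"
    by (subst (asm) has_sum_reindex_bij_betw[OF bij])
qed

lemma prod_list_map_count:
  fixes y :: "'b \<Rightarrow> 'c::comm_monoid_mult"
  assumes "finite B" "set xs \<subseteq> B"
  shows "prod_list (map y xs) = (\<Prod>b\<in>B. y b ^ count_list xs b)"
  using assms(2)
proof (induction xs)
  case (Cons x xs)
  have "(\<Prod>b\<in>B. y b ^ count_list (x # xs) b) = (\<Prod>b\<in>B. y b ^ count_list xs b * (if b = x then y x else 1))"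
    by (intro prod.cong) (auto simp: mult.commute)
  also have "\<dots> = (\<Prod>b\<in>B. y b ^ count_list xs b) * y x"
    using Cons.prems assms(1) by (simp add: prod.distrib)
  finally show ?case using Cons by (simp add: mult.commute)
qed simp

text \<open>
  It suffices to expand in noncommuting words of basis vectors. Only finitely many words have a
  given multi-index, so collecting them yields an expansion in monomials.
\<close>

lemma real_analytic_onI_lists:
  fixes F :: "'a::euclidean_space \<Rightarrow> 'b::banach"
  assumes "\<And>p. p \<in> U \<Longrightarrow> \<exists>r>0. \<exists>c :: 'a list \<Rightarrow> 'b. \<forall>h. norm h < r \<longrightarrow>
     ((\<lambda>xs. prod_list (map (\<lambda>b. h \<bullet> b) xs) *\<^sub>R c xs) has_sum F (p + h)) (lists Basis)"
  shows "real_analytic_on F U"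
  unfolding real_analytic_on_def
proof
  fix p assume "p \<in> U"
  then obtain r and c :: "'a list \<Rightarrow> 'b" where r: "r > 0" and c: "\<And>h. norm h < r \<Longrightarrow>
     ((\<lambda>xs. prod_list (map (\<lambda>b. h \<bullet> b) xs) *\<^sub>R c xs) has_sum F (p + h)) (lists Basis)"
    using assms by meson
  let ?A = "{\<alpha> :: 'a \<Rightarrow> nat. \<forall>b. b \<notin> Basis \<longrightarrow> \<alpha> b = 0}"
  define X where "X = (\<lambda>\<alpha> :: 'a \<Rightarrow> nat. {xs \<in> lists Basis. \<forall>b. count_list xs b = \<alpha> b})"
  have len: "length xs = (\<Sum>b\<in>Basis. \<alpha> b)" if "xs \<in> X \<alpha>" for xs and \<alpha>
  proof -
    have "length xs = (\<Sum>b\<in>set xs. count_list xs b)" by (rule sum_count_set[symmetric, of xs]) auto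
    also have "\<dots> = (\<Sum>b\<in>Basis. count_list xs b)"
    proof (rule sum.mono_neutral_left)
      show "set xs \<subseteq> Basis" using that by (auto simp: X_def)
    qed (auto simp: count_notin)
    finally show ?thesis using that by (simp add: X_def)
  qed
  have finX: "finite (X \<alpha>)" for \<alpha>
    by (rule finite_subset[OF _ finite_lists_length_eq[OF finite_Basis, of "\<Sum>b\<in>Basis. \<alpha> b"]])
       (use len in \<open>auto simp: X_def\<close>)
  have bij: "bij_betw snd (Sigma ?A X) (lists Basis)"
    by (rule bij_betwI[of _ _ _ "\<lambda>xs. (count_list xs, xs)"])
       (auto simp: X_def count_list_0_iff intro!: ext)
  have "((\<lambda>\<alpha>. (\<Prod>b\<in>Basis. (h \<bullet> b) ^ \<alpha> b) *\<^sub>R (\<Sum>xs\<in>X \<alpha>. c xs)) has_sum F (p + h)) ?A" if "norm h < r" for h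
  proof (rule has_sum_SigmaD)
    show "((\<lambda>q. prod_list (map (\<lambda>b. h \<bullet> b) (snd q)) *\<^sub>R c (snd q)) has_sum F (p + h)) (Sigma ?A X)"
      using c[OF that] by (subst has_sum_reindex_bij_betw[OF bij])
  next
    fix \<alpha> :: "'a \<Rightarrow> nat"
    have "prod_list (map (\<lambda>b. h \<bullet> b) xs) = (\<Prod>b\<in>Basis. (h \<bullet> b) ^ \<alpha> b)" if "xs \<in> X \<alpha>" for xs
      using that prod_list_map_count[of Basis xs "\<lambda>b. h \<bullet> b"] by (auto simp: X_def)
    hence "(\<Sum>xs\<in>X \<alpha>. prod_list (map (\<lambda>b. h \<bullet> b) xs) *\<^sub>R c xs) = (\<Prod>b\<in>Basis. (h \<bullet> b) ^ \<alpha> b) *\<^sub>R (\<Sum>xs\<in>X \<alpha>. c xs)"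
      by (simp add: scaleR_sum_right)
    thus "((\<lambda>xs. prod_list (map (\<lambda>b. h \<bullet> b) (snd (\<alpha>, xs))) *\<^sub>R c (snd (\<alpha>, xs))) has_sum (\<Prod>b\<in>Basis. (h \<bullet> b) ^ \<alpha> b) *\<^sub>R (\<Sum>xs\<in>X \<alpha>. c xs)) (X \<alpha>)"
      using has_sum_finite[OF finX, of "\<lambda>xs. prod_list (map (\<lambda>b. h \<bullet> b) xs) *\<^sub>R c xs" \<alpha>] by simp
  qed
  thus "\<exists>r>0. \<exists>c :: ('a \<Rightarrow> nat) \<Rightarrow> 'b. \<forall>h. norm h < r \<longrightarrow>
        ((\<lambda>\<alpha>. (\<Prod>b\<in>Basis. (h \<bullet> b) ^ \<alpha> b) *\<^sub>R c \<alpha>) has_sum F (p + h)) ?A"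
    using r by (intro exI[of _ r] conjI exI[of _ "\<lambda>\<alpha>. \<Sum>xs\<in>X \<alpha>. c xs"] allI impI)
qed

section \<open>Plane waves\<close>

text \<open>
  The point \<open>x\<^sub>0 + i \<langle>v, \<omega>\<rangle>\<close> at which the plane wave in
  the direction \<open>\<omega>\<close> is evaluated.
\<close>

definition slice_pt :: "real ^ 'n::finite \<Rightarrow> 'n paravector \<Rightarrow> complex" where
  "slice_pt w x = Complex (fst x) (snd x \<bullet> w)"

text \<open>
  Twice an idempotent with \<open>\<omega>\<close> acting as \<open>i\<close>: \<open>\<omega> (1 -
  i \<omega>) = i (1 - i \<omega>)\<close> if \<open>|\<omega>| = 1\<close>.
\<close>

definition wave_kernel :: "real ^ 'n::{finite,linorder} \<Rightarrow> 'n clifford" where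
  "wave_kernel w = cl_one - \<i> *s cl_vec w"

definition plane_wave :: "(complex \<Rightarrow> 'n clifford) \<Rightarrow> 'n paravector \<Rightarrow> 'n::{finite,linorder} clifford" where
  "plane_wave G x = (LINT w|sphere_measure. wave_kernel w \<star> G (slice_pt w x)) /\<^sub>R sphere_area CARD('n)"

definition vderivs :: "nat \<Rightarrow> (complex \<Rightarrow> complex ^ 'i) \<Rightarrow> complex \<Rightarrow> complex ^ 'i" where
  "vderivs n G z = (\<chi> A. (deriv ^^ n) (\<lambda>z. G z $ A) z)"

definition vholomorphic_on :: "(complex \<Rightarrow> complex ^ 'i) \<Rightarrow> complex set \<Rightarrow> bool" where
  "vholomorphic_on G S \<longleftrightarrow> (\<forall>A. (\<lambda>z. G z $ A) holomorphic_on S)"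

lemma vderivs_0 [simp]: "vderivs 0 G = G"
  by (simp add: vderivs_def fun_eq_iff)

lemma vderivs_vderivs: "vderivs n (vderivs k G) = vderivs (n + k) G"
proof -
  have "(\<lambda>z. (deriv ^^ k) (\<lambda>z. G z $ A) z) = (deriv ^^ k) (\<lambda>z. G z $ A)" for A ..
  thus ?thesis by (simp add: vderivs_def fun_eq_iff funpow_add)
qed

lemma vholomorphic_vderivs:
  assumes "vholomorphic_on G S" "open S"
  shows "vholomorphic_on (vderivs n G) S"
  using assms by (auto simp: vholomorphic_on_def vderivs_def intro: holomorphic_higher_deriv)

lemma vholomorphic_continuous_on:
  fixes G :: "complex \<Rightarrow> complex ^ 'i::finite"
  assumes "vholomorphic_on G S"
  shows "continuous_on S G"
proof -
  have "continuous_on S (\<lambda>z. \<chi> A. G z $ A)"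
    using assms unfolding vholomorphic_on_def
    by (intro continuous_on_vec_lambda holomorphic_on_imp_continuous_on) auto
  thus ?thesis by simp
qed

lemma slice_pt_add: "slice_pt w (x + y) = slice_pt w x + slice_pt w y"
  by (simp add: slice_pt_def complex_eq_iff inner_add_left)

lemma slice_pt_scaleR: "slice_pt w (c *\<^sub>R x) = of_real c * slice_pt w x"
  by (simp add: slice_pt_def complex_eq_iff)

lemma linear_slice_pt: "linear (slice_pt w)"
  by (rule linearI) (simp_all add: slice_pt_add slice_pt_scaleR scaleR_conv_of_real)

lemma slice_pt_basis_sum:
  "slice_pt w h = (\<Sum>b\<in>Basis. of_real (h \<bullet> b) * slice_pt w b)"
proof -
  have "slice_pt w h = slice_pt w (\<Sum>b\<in>Basis. (h \<bullet> b) *\<^sub>R b)"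
    by (simp add: euclidean_representation)
  thus ?thesis by (simp add: linear_sum[OF linear_slice_pt] slice_pt_scaleR)
qed

lemma inner_sphere_le: "norm w = 1 \<Longrightarrow> \<bar>v \<bullet> w\<bar> \<le> norm v"
  using Cauchy_Schwarz_ineq2[of v w] by simp

lemma norm_slice_pt:
  assumes "norm w = 1" shows "cmod (slice_pt w h) \<le> norm h"
proof -
  have "(snd h \<bullet> w)\<^sup>2 \<le> (norm (snd h))\<^sup>2"
    using inner_sphere_le[OF assms] by (metis power2_abs abs_ge_zero power_mono)
  thus ?thesis by (simp add: slice_pt_def norm_prod_def complex_norm norm_Pair real_sqrt_le_mono)
qed

lemma continuous_on_slice_pt [continuous_intros]:
  "continuous_on A (\<lambda>w. slice_pt w x)"
  unfolding slice_pt_def Complex_eq by (intro continuous_intros)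

lemma continuous_on_wave_kernel [continuous_intros]:
  "continuous_on A (\<lambda>w :: real ^ 'n::{finite,linorder}. wave_kernel w)"
  unfolding wave_kernel_def
  by (intro continuous_intros sc.continuous_on linear_continuous_on bounded_linear_cl_vec)

lemma wave_kernel_bound:
  "\<exists>K\<ge>0. \<forall>w\<in>sphere 0 1. \<forall>y. norm (wave_kernel w \<star> y :: 'n::{finite,linorder} clifford) \<le> K * norm y"
proof -
  obtain K where K: "\<And>x y :: 'n clifford. norm (x \<star> y) \<le> norm x * norm y * K" "K \<ge> 0"
    using cl.nonneg_bounded by auto
  have "compact (wave_kernel ` sphere (0 :: (real, 'n) vec) 1)"
    by (intro compact_continuous_image continuous_intros) auto
  then obtain B where B: "\<And>w. w \<in> sphere 0 1 \<Longrightarrow> norm (wave_kernel w :: 'n clifford) \<le> B"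
    using compact_imp_bounded bounded_iff by (metis imageI)
  have "norm (axis undefined 1 :: (real, 'n) vec) = 1" by simp
  hence "axis undefined 1 \<in> sphere (0 :: (real, 'n) vec) 1" by simp
  from B[OF this] have "B \<ge> 0" using norm_ge_zero order_trans by blast
  have "norm (wave_kernel w \<star> y) \<le> (B * K) * norm y" if "w \<in> sphere 0 1" for w and y :: "'n clifford"
  proof -
    have "norm (wave_kernel w \<star> y) \<le> norm (wave_kernel w :: 'n clifford) * norm y * K" by (rule K)
    also have "\<dots> \<le> B * norm y * K" using B[OF that] K(2) by (intro mult_right_mono) auto
    finally show ?thesis by (simp add: mult_ac)
  qed
  thus ?thesis using \<open>B \<ge> 0\<close> K(2) by (intro exI[of _ "B * K"]) auto
qed

text \<open>
  A majorant that is independent of the direction makes the partial sums converge uniformly on the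
  sphere, whose measure is finite.
\<close>

lemma has_sum_sphere_integral:
  fixes f :: "'i \<Rightarrow> real ^ 'n::finite \<Rightarrow> 'b::{banach, second_countable_topology}"
  assumes f: "\<And>i. i \<in> I \<Longrightarrow> continuous_on (sphere 0 1) (f i)"
    and g: "\<And>w. w \<in> sphere 0 1 \<Longrightarrow> ((\<lambda>i. f i w) has_sum g w) I"
    and M: "\<And>i w. i \<in> I \<Longrightarrow> w \<in> sphere 0 1 \<Longrightarrow> norm (f i w) \<le> M i" "M summable_on I"
  shows "((\<lambda>i. LINT w|sphere_measure. f i w) has_sum (LINT w|sphere_measure. g w)) I"
    and "continuous_on (sphere 0 1) g"
proof -
  let ?F = "finite_subsets_at_top I"
  have ul: "uniform_limit (sphere 0 1) (\<lambda>X w. \<Sum>i\<in>X. f i w) g ?F"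
    by (rule Weierstrass_m_test_general'[OF M(1) g M(2)])
  have ev: "\<forall>\<^sub>F X in ?F. finite X \<and> X \<subseteq> I"
    by (simp add: eventually_finite_subsets_at_top_weakI)
  show contg: "continuous_on (sphere 0 1) g"
    by (rule uniform_limit_theorem[OF _ ul], use ev in eventually_elim)
       (auto intro!: continuous_on_sum f)
  interpret finite_measure "sphere_measure :: (real ^ 'n) measure"
    by (rule finite_measure_sphere_measure)
  let ?s = "sphere_area CARD('n)"
  have s: "?s > 0" by (rule sphere_area_pos) simp
  show "((\<lambda>i. LINT w|sphere_measure. f i w) has_sum (LINT w|sphere_measure. g w)) I"
    unfolding has_sum_def tendsto_iff
  proof (intro allI impI)
    fix e :: real assume "e > 0"
    hence "e / (2 * ?s) > 0" using s by simp
    with ul have "\<forall>\<^sub>F X in ?F. \<forall>w\<in>sphere 0 1. dist (\<Sum>i\<in>X. f i w) (g w) < e / (2 * ?s)"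
      unfolding uniform_limit_iff by blast
    thus "\<forall>\<^sub>F X in ?F. dist (\<Sum>i\<in>X. (LINT w|sphere_measure. f i w)) (LINT w|sphere_measure. g w) < e"
      using ev
    proof eventually_elim
      case (elim X)
      have cX: "continuous_on (sphere 0 1) (\<lambda>w. \<Sum>i\<in>X. f i w)"
        using elim by (auto intro!: continuous_on_sum f)
      have "(\<Sum>i\<in>X. (LINT w|sphere_measure. f i w)) = (LINT w|sphere_measure. (\<Sum>i\<in>X. f i w))"
        using elim f by (intro Bochner_Integration.integral_sum[symmetric] integrable_sphere_measure) auto
      hence "dist (\<Sum>i\<in>X. (LINT w|sphere_measure. f i w)) (LINT w|sphere_measure. g w) =
         norm (LINT w|sphere_measure. (\<Sum>i\<in>X. f i w) - g w)"
        by (subst Bochner_Integration.integral_diff) (auto intro!: integrable_sphere_measure cX contg simp: dist_norm)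
      also have "\<dots> \<le> (LINT w|sphere_measure. norm ((\<Sum>i\<in>X. f i w) - g w))"
        by (rule integral_norm_bound)
      also have "\<dots> \<le> (LINT w|(sphere_measure :: (real ^ 'n) measure). e / (2 * ?s))"
        using elim
        by (intro integral_mono integrable_sphere_measure continuous_intros cX contg)
           (auto simp: dist_norm less_imp_le)
      also have "\<dots> = e / 2" using s by (simp add: measure_sphere_measure)
      also have "\<dots> < e" using \<open>e > 0\<close> by simp
      finally show ?case .
    qed
  qed
qed

text \<open>Cauchy estimates with a constant that is uniform on a compact set.\<close>

lemma vderivs_bound:
  fixes G :: "complex \<Rightarrow> complex ^ 'i::finite"
  assumes G: "vholomorphic_on G S" and \<delta>: "\<delta> > 0"
    and K: "compact K" and KS: "\<And>z. z \<in> K \<Longrightarrow> cball z \<delta> \<subseteq> S"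
  shows "\<exists>C\<ge>0. \<forall>z\<in>K. \<forall>n. norm (vderivs n G z) \<le> fact n * C / \<delta> ^ n"
proof -
  define L where "L = (\<lambda>(x, y). x + y) ` (K \<times> cball 0 \<delta>)"
  have "compact L" unfolding L_def case_prod_unfold
    by (intro compact_continuous_image continuous_intros compact_Times K) auto
  have cb: "cball z \<delta> \<subseteq> L" if "z \<in> K" for z
  proof
    fix y assume "y \<in> cball z \<delta>"
    hence "(z, y - z) \<in> K \<times> cball 0 \<delta>" using that by (simp add: dist_norm norm_minus_commute)
    thus "y \<in> L" unfolding L_def by (rule rev_image_eqI) simp
  qed
  have LS: "L \<subseteq> S" using KS by (force simp: L_def dist_norm)
  have "\<exists>B. \<forall>z\<in>L. cmod (G z $ A) \<le> B" for A
  proof -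
    have "continuous_on L (\<lambda>z. G z $ A)"
      using G LS unfolding vholomorphic_on_def
      by (meson holomorphic_on_imp_continuous_on holomorphic_on_subset)
    hence "compact ((\<lambda>z. G z $ A) ` L)" using \<open>compact L\<close> by (rule compact_continuous_image)
    thus ?thesis using compact_imp_bounded bounded_iff by (metis imageI)
  qed
  then obtain B where B: "\<And>A z. z \<in> L \<Longrightarrow> cmod (G z $ A) \<le> B A" by metis
  have "norm (vderivs n G z) \<le> fact n * (\<Sum>A\<in>UNIV. \<bar>B A\<bar>) / \<delta> ^ n" if "z \<in> K" for z n
  proof -
    have hol: "(\<lambda>z. G z $ A) holomorphic_on cball z \<delta>" for A
      using G KS[OF that] by (auto simp: vholomorphic_on_def intro: holomorphic_on_subset)
    have "norm (vderivs n G z) \<le> (\<Sum>A\<in>UNIV. cmod (vderivs n G z $ A))"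
      unfolding norm_vec_def by (rule L2_set_le_sum) simp
    also have "\<dots> \<le> (\<Sum>A\<in>UNIV. fact n * \<bar>B A\<bar> / \<delta> ^ n)"
    proof (rule sum_mono)
      fix A
      show "cmod (vderivs n G z $ A) \<le> fact n * \<bar>B A\<bar> / \<delta> ^ n"
        unfolding vderivs_def vec_lambda_beta
      proof (rule Cauchy_inequality[OF _ _ \<delta>])
        show "(\<lambda>z. G z $ A) holomorphic_on ball z \<delta>"
          using hol ball_subset_cball by (rule holomorphic_on_subset)
        show "continuous_on (cball z \<delta>) (\<lambda>z. G z $ A)"
          using hol by (rule holomorphic_on_imp_continuous_on)
        fix y assume "cmod (z - y) = \<delta>"
        hence "y \<in> L" using cb[OF that] by (auto simp: dist_norm)
        thus "cmod (G y $ A) \<le> \<bar>B A\<bar>" using B[of y A] by linarith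
      qed
    qed
    also have "\<dots> = fact n * (\<Sum>A\<in>UNIV. \<bar>B A\<bar>) / \<delta> ^ n"
      by (simp add: sum_divide_distrib sum_distrib_left)
    finally show ?thesis .
  qed
  thus ?thesis by (intro exI[of _ "\<Sum>A\<in>UNIV. \<bar>B A\<bar>"]) (auto intro: sum_nonneg)
qed

lemma taylor_vec:
  fixes G :: "complex \<Rightarrow> complex ^ 'i::finite"
  assumes "vholomorphic_on G (ball z \<delta>)" "cmod y < \<delta>"
  shows "(\<lambda>n. (y ^ n / fact n) *s vderivs n G z) sums G (z + y)"
proof -
  have "(\<lambda>n. ((y ^ n / fact n) *s vderivs n G z) $ A) sums (G (z + y) $ A)" for A
    using holomorphic_power_series[of "\<lambda>z. G z $ A" z \<delta> "z + y"] assms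
    by (simp add: vholomorphic_on_def vderivs_def dist_norm mult_ac)
  thus ?thesis unfolding sums_def by (intro vec_tendstoI) simp
qed

text \<open>
  The radius \<open>\<delta>\<close> of convergence at \<open>p\<close> is governed by the vertical segment that the points
  \<open>p\<^sub>0 + i \<langle>v, \<omega>\<rangle>\<close> fill.
\<close>

locale wave_expansion =
  fixes G :: "complex \<Rightarrow> 'n::{finite,linorder} clifford" and S :: "complex set"
    and p :: "'n paravector" and \<delta> :: real
  assumes hol: "vholomorphic_on G S" and open_S: "open S" and delta: "\<delta> > 0"
    and segment: "\<And>s. \<bar>s\<bar> \<le> norm (snd p) \<Longrightarrow> cball (Complex (fst p) s) \<delta> \<subseteq> S"
begin

lemma cball_slice_pt: "w \<in> sphere 0 1 \<Longrightarrow> cball (slice_pt w p) \<delta> \<subseteq> S"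
  unfolding slice_pt_def using inner_sphere_le[of w "snd p"] by (intro segment) auto

lemma continuous_on_vderivs_slice_pt:
  "continuous_on (sphere 0 1) (\<lambda>w. vderivs n G (slice_pt w p))"
proof -
  have "continuous_on S (vderivs n G)"
    by (intro vholomorphic_continuous_on vholomorphic_vderivs hol open_S)
  thus ?thesis
    by (rule continuous_on_compose2) (use cball_slice_pt delta in \<open>force intro!: continuous_intros\<close>)+
qed

lemma bound: "\<exists>C\<ge>0. \<forall>w\<in>sphere 0 1. \<forall>n. norm (vderivs n G (slice_pt w p)) \<le> fact n * C / \<delta> ^ n"
proof -
  have "compact ((\<lambda>w. slice_pt w p) ` sphere 0 1)"
    by (intro compact_continuous_image continuous_intros) auto
  from vderivs_bound[OF hol delta this] cball_slice_pt show ?thesis by fast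
qed

lemma taylor:
  assumes w: "w \<in> sphere 0 1" and "cmod y < \<delta>"
  shows "(\<lambda>n. (y ^ n / fact n) *s vderivs n G (slice_pt w p)) sums G (slice_pt w p + y)"
proof (rule taylor_vec[OF _ assms(2)])
  show "vholomorphic_on G (ball (slice_pt w p) \<delta>)"
    using hol cball_slice_pt[OF w] ball_subset_cball unfolding vholomorphic_on_def
    by (meson holomorphic_on_subset order_trans)
qed

text \<open>
  The plane wave of the derivative of order \<open>n\<close> with a weight \<open>q\<close> in the
  direction; weights that are monomials in \<open>\<omega>\<close> give the coefficients of the
  expansion at \<open>p\<close>.
\<close>

definition coef :: "nat \<Rightarrow> ((real, 'n) vec \<Rightarrow> complex) \<Rightarrow> 'n clifford" where
  "coef n q = (LINT w|sphere_measure. wave_kernel w \<star> ((q w / fact n) *s vderivs n G (slice_pt w p))) /\<^sub>R sphere_area CARD('n)"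

lemma coef_cmult:
  assumes "continuous_on (sphere 0 1) q"
  shows "coef n (\<lambda>w. of_real c * q w) = c *\<^sub>R coef n q"
proof -
  have "(LINT w|sphere_measure. wave_kernel w \<star> (((of_real c * q w) / fact n) *s vderivs n G (slice_pt w p))) =
     (LINT w|sphere_measure. c *\<^sub>R (wave_kernel w \<star> ((q w / fact n) *s vderivs n G (slice_pt w p))))"
    by (intro Bochner_Integration.integral_cong refl) (simp add: scaleR_eq_scale)
  thus ?thesis by (simp add: coef_def)
qed

text \<open>The majorant of all expansions at \<open>p\<close>, uniform in the direction.\<close>

lemma term_bound:
  "\<exists>M\<ge>0. \<forall>w\<in>sphere 0 1. \<forall>n y. norm (wave_kernel w \<star> ((y / fact n) *s vderivs n G (slice_pt w p))) \<le> M * (cmod y / \<delta> ^ n)"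
proof -
  obtain C where C: "C \<ge> 0" "\<And>w n. w \<in> sphere 0 1 \<Longrightarrow> norm (vderivs n G (slice_pt w p)) \<le> fact n * C / \<delta> ^ n"
    using bound by blast
  obtain K where K: "K \<ge> 0" "\<And>w y. w \<in> sphere 0 1 \<Longrightarrow> norm (wave_kernel w \<star> y :: 'n clifford) \<le> K * norm y"
    using wave_kernel_bound by blast
  have "norm (wave_kernel w \<star> ((y / fact n) *s vderivs n G (slice_pt w p))) \<le> K * C * (cmod y / \<delta> ^ n)"
    if w: "w \<in> sphere 0 1" for w n y
  proof -
    have "norm (wave_kernel w \<star> ((y / fact n) *s vderivs n G (slice_pt w p))) \<le>
       K * (cmod y / fact n * norm (vderivs n G (slice_pt w p)))"
      by (rule order_trans[OF K(2)[OF w]]) (simp add: norm_scale norm_divide)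
    also have "\<dots> \<le> K * (cmod y / fact n * (fact n * C / \<delta> ^ n))"
      using w K(1) C by (intro mult_left_mono) auto
    also have "\<dots> = K * C * (cmod y / \<delta> ^ n)" by simp
    finally show ?thesis .
  qed
  thus ?thesis using K(1) C(1) by (intro exI[of _ "K * C"]) auto
qed

lemma taylor_has_sum:
  assumes w: "w \<in> sphere 0 1" and y: "cmod y < \<delta>"
  shows "((\<lambda>n. wave_kernel w \<star> ((y ^ n / fact n) *s vderivs n G (slice_pt w p))) has_sum
     wave_kernel w \<star> G (slice_pt w p + y)) UNIV"
proof (rule norm_summable_imp_has_sum)
  obtain M where M: "M \<ge> 0" "\<And>n. norm (wave_kernel w \<star> ((y ^ n / fact n) *s vderivs n G (slice_pt w p))) \<le> M * (cmod (y ^ n) / \<delta> ^ n)"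
    using term_bound w by blast
  show "summable (\<lambda>n. norm (wave_kernel w \<star> ((y ^ n / fact n) *s vderivs n G (slice_pt w p))))"
  proof (rule summable_comparison_test'[where N = 0])
    show "summable (\<lambda>n. M * (cmod y / \<delta>) ^ n)"
      using y delta by (intro summable_mult summable_geometric) simp
  qed (use M(2) in \<open>simp add: norm_power power_divide\<close>)
  show "(\<lambda>n. wave_kernel w \<star> ((y ^ n / fact n) *s vderivs n G (slice_pt w p))) sums (wave_kernel w \<star> G (slice_pt w p + y))"
    by (rule bounded_linear.sums[OF cl.bounded_linear_right taylor[OF w y]])
qed

lemma continuous_on_term:
  assumes "continuous_on (sphere 0 1) q"
  shows "continuous_on (sphere 0 1) (\<lambda>w. wave_kernel w \<star> ((q w / fact n) *s vderivs n G (slice_pt w p)))"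
  by (intro cl.continuous_on sc.continuous_on continuous_intros continuous_on_vderivs_slice_pt assms) auto

lemma expansion:
  assumes h: "norm h < \<delta>"
  shows "((\<lambda>n. coef n (\<lambda>w. slice_pt w h ^ n)) has_sum plane_wave G (p + h)) UNIV"
proof -
  obtain M where M: "M \<ge> 0" "\<And>w n y. w \<in> sphere 0 1 \<Longrightarrow> norm (wave_kernel w \<star> ((y / fact n) *s vderivs n G (slice_pt w p))) \<le> M * (cmod y / \<delta> ^ n)"
    using term_bound by blast
  have "((\<lambda>n. LINT w|sphere_measure. wave_kernel w \<star> ((slice_pt w h ^ n / fact n) *s vderivs n G (slice_pt w p))) has_sum
     (LINT w|sphere_measure. wave_kernel w \<star> G (slice_pt w (p + h)))) UNIV"
  proof (rule has_sum_sphere_integral)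
    fix w :: "(real, 'n) vec" assume w: "w \<in> sphere 0 1"
    have "cmod (slice_pt w h) < \<delta>" using norm_slice_pt[of w h] h w by simp
    from taylor_has_sum[OF w this]
    show "((\<lambda>n. wave_kernel w \<star> ((slice_pt w h ^ n / fact n) *s vderivs n G (slice_pt w p))) has_sum
            wave_kernel w \<star> G (slice_pt w (p + h))) UNIV"
      by (simp only: slice_pt_add)
    fix n
    have "cmod (slice_pt w h ^ n) \<le> norm h ^ n"
      unfolding norm_power using w by (intro power_mono norm_slice_pt) auto
    hence "M * (cmod (slice_pt w h ^ n) / \<delta> ^ n) \<le> M * (norm h / \<delta>) ^ n"
      unfolding power_divide using M(1) delta by (intro mult_left_mono divide_right_mono) auto
    with M(2)[OF w, of "slice_pt w h ^ n" n]
    show "norm (wave_kernel w \<star> ((slice_pt w h ^ n / fact n) *s vderivs n G (slice_pt w p))) \<le> M * (norm h / \<delta>) ^ n"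
      by linarith
  next
    show "(\<lambda>n. M * (norm h / \<delta>) ^ n) summable_on UNIV"
      using h delta by (intro summable_on_cmult_right norm_summable_imp_summable_on) simp
  qed (intro continuous_on_term continuous_intros)
  from has_sum_bounded_linear[OF bounded_linear_scaleR_right this]
  show ?thesis by (simp add: coef_def plane_wave_def)
qed

text \<open>
  Expanding \<open>(\<Sum>b. h\<^sub>b L\<^sub>\<omega>(b))\<^sup>n\<close> into words separates the coordinates of \<open>h\<close> from the direction \<open>\<omega>\<close>;
  this is the source of real analyticity.
\<close>

lemma list_expansion:
  assumes h: "(\<Sum>b\<in>Basis. \<bar>h \<bullet> b\<bar>) < \<delta>"
  shows "((\<lambda>xs. prod_list (map (\<lambda>b. h \<bullet> b) xs) *\<^sub>R coef (length xs) (\<lambda>w. prod_list (map (slice_pt w) xs)))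
     has_sum plane_wave G (p + h)) (lists Basis)"
proof -
  obtain M where M: "M \<ge> 0" "\<And>w n y. w \<in> sphere 0 1 \<Longrightarrow> norm (wave_kernel w \<star> ((y / fact n) *s vderivs n G (slice_pt w p))) \<le> M * (cmod y / \<delta> ^ n)"
    using term_bound by blast
  define y where "y = (\<lambda>w b. complex_of_real (h \<bullet> b) * slice_pt w b)"
  define f where "f = (\<lambda>xs w. wave_kernel w \<star> ((prod_list (map (y w) xs) / fact (length xs)) *s vderivs (length xs) G (slice_pt w p)))"
  have prod_y: "prod_list (map (y w) xs) = complex_of_real (prod_list (map (\<lambda>b. h \<bullet> b) xs)) * prod_list (map (slice_pt w) xs)" for w xs
    by (induction xs) (simp_all add: y_def)
  have cont_prod: "continuous_on A (\<lambda>w. prod_list (map (slice_pt w) xs))" for A and xs :: "'n paravector list"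
    by (induction xs) (auto intro!: continuous_intros)
  have f_bound: "norm (f xs w) \<le> M * prod_list (map (\<lambda>b. \<bar>h \<bullet> b\<bar> / \<delta>) xs)"
    if w: "w \<in> sphere 0 1" and xs: "set xs \<subseteq> Basis" for xs w
  proof -
    have "cmod (prod_list (map (y w) xs)) / \<delta> ^ length xs \<le> prod_list (map (\<lambda>b. \<bar>h \<bullet> b\<bar> / \<delta>) xs)" using xs
    proof (induction xs)
      case (Cons b xs)
      have "cmod (y w b) \<le> \<bar>h \<bullet> b\<bar> * 1"
        unfolding y_def norm_mult norm_of_real
        using norm_slice_pt[of w b] w Cons.prems by (intro mult_left_mono) auto
      hence "(cmod (y w b) / \<delta>) * (cmod (prod_list (map (y w) xs)) / \<delta> ^ length xs) \<le> (\<bar>h \<bullet> b\<bar> / \<delta>) * prod_list (map (\<lambda>b. \<bar>h \<bullet> b\<bar> / \<delta>) xs)"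
        using Cons delta by (intro mult_mono divide_right_mono) auto
      thus ?case by (simp add: norm_mult)
    qed simp
    hence "M * (cmod (prod_list (map (y w) xs)) / \<delta> ^ length xs) \<le> M * prod_list (map (\<lambda>b. \<bar>h \<bullet> b\<bar> / \<delta>) xs)"
      using M(1) by (rule mult_left_mono)
    with M(2)[OF w] show ?thesis unfolding f_def by (rule order_trans)
  qed
  have f_sum: "(\<Sum>xs | set xs \<subseteq> Basis \<and> length xs = n. f xs w) =
      wave_kernel w \<star> ((slice_pt w h ^ n / fact n) *s vderivs n G (slice_pt w p))" for n w
  proof -
    have "(\<Sum>xs | set xs \<subseteq> Basis \<and> length xs = n. f xs w) =
       wave_kernel w \<star> (((\<Sum>xs | set xs \<subseteq> Basis \<and> length xs = n. prod_list (map (y w) xs)) / fact n) *s vderivs n G (slice_pt w p))"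
      unfolding sum_divide_distrib sc.sum_left cl.sum_right by (intro sum.cong) (auto simp: f_def)
    also have "(\<Sum>xs | set xs \<subseteq> Basis \<and> length xs = n. prod_list (map (y w) xs)) = slice_pt w h ^ n"
      unfolding sum_lists_length_prod[OF finite_Basis] slice_pt_basis_sum[of w h] y_def ..
    finally show ?thesis .
  qed
  have q: "(\<Sum>b\<in>Basis. \<bar>h \<bullet> b\<bar> / \<delta>) < 1"
    unfolding sum_divide_distrib[symmetric] using h delta by simp
  have nh: "norm h < \<delta>"
    using norm_le_l1[of h] h by linarith
  have pointwise: "((\<lambda>xs. f xs w) has_sum wave_kernel w \<star> G (slice_pt w (p + h))) (lists Basis) \<and>
     (\<lambda>xs. M * prod_list (map (\<lambda>b. \<bar>h \<bullet> b\<bar> / \<delta>) xs)) summable_on (lists Basis :: 'n paravector list set)"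
    if w: "w \<in> sphere 0 1" for w
  proof -
    have "cmod (slice_pt w h) < \<delta>" using norm_slice_pt[of w h] nh w by simp
    hence "((\<lambda>n. wave_kernel w \<star> ((slice_pt w h ^ n / fact n) *s vderivs n G (slice_pt w p))) has_sum
       wave_kernel w \<star> G (slice_pt w (p + h))) UNIV"
      using taylor_has_sum[OF w] by (simp only: slice_pt_add)
    from has_sum_listsI[OF finite_Basis this f_sum f_bound[OF w] _ q M(1)]
    show ?thesis using delta by simp
  qed
  have "((\<lambda>xs. LINT w|sphere_measure. f xs w) has_sum (LINT w|sphere_measure. wave_kernel w \<star> G (slice_pt w (p + h)))) (lists Basis)"
  proof (rule has_sum_sphere_integral)
    have "norm (axis undefined 1 :: (real, 'n) vec) = 1" by simp
    hence "axis undefined 1 \<in> sphere (0 :: (real, 'n) vec) 1" by simp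
    from pointwise[OF this] show "(\<lambda>xs. M * prod_list (map (\<lambda>b. \<bar>h \<bullet> b\<bar> / \<delta>) xs)) summable_on (lists Basis :: 'n paravector list set)" ..
    show "continuous_on (sphere 0 1) (f xs)" for xs
      unfolding f_def prod_y by (intro continuous_on_term continuous_intros cont_prod)
  qed (use pointwise f_bound in auto)
  from has_sum_bounded_linear[OF bounded_linear_scaleR_right[of "inverse (sphere_area CARD('n))"] this]
  have "((\<lambda>xs. coef (length xs) (\<lambda>w. prod_list (map (y w) xs))) has_sum plane_wave G (p + h)) (lists Basis)"
    by (simp add: coef_def plane_wave_def f_def)
  thus ?thesis unfolding prod_y by (simp add: coef_cmult cont_prod)
qed

lemma directional_derivative:
  "((\<lambda>s. plane_wave G (p + s *\<^sub>R b)) has_vector_derivative coef 1 (\<lambda>w. slice_pt w b)) (at 0)"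
proof -
  have "(\<lambda>n. s ^ n *\<^sub>R coef n (\<lambda>w. slice_pt w b ^ n)) sums plane_wave G (p + s *\<^sub>R b)" if "\<bar>s\<bar> < \<delta> / (norm b + 1)" for s
  proof -
    have "norm (s *\<^sub>R b) \<le> \<bar>s\<bar> * (norm b + 1)" by (simp add: mult_left_mono)
    also have "\<dots> < \<delta>" using that by (simp add: pos_less_divide_eq add_nonneg_pos)
    finally have "(\<lambda>n. coef n (\<lambda>w. slice_pt w (s *\<^sub>R b) ^ n)) sums plane_wave G (p + s *\<^sub>R b)"
      by (intro has_sum_imp_sums expansion)
    thus ?thesis
      unfolding slice_pt_scaleR power_mult_distrib of_real_power[symmetric]
      by (subst (asm) coef_cmult) (auto intro!: continuous_intros)
  qed
  moreover have "\<delta> / (norm b + 1) > 0" using delta by (simp add: add_nonneg_pos)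
  ultimately obtain D where D: "((\<lambda>s. plane_wave G (p + s *\<^sub>R b)) has_vector_derivative D) (at 0)"
     "(\<lambda>n. 0 ^ n *\<^sub>R (real (Suc n) *\<^sub>R coef (Suc n) (\<lambda>w. slice_pt w b ^ Suc n))) sums D"
    using powser_has_vector_derivative[of "\<delta> / (norm b + 1)" "\<lambda>n. coef n (\<lambda>w. slice_pt w b ^ n)" "\<lambda>s. plane_wave G (p + s *\<^sub>R b)" 0] by auto
  have "(\<lambda>n. 0 ^ n *\<^sub>R (real (Suc n) *\<^sub>R coef (Suc n) (\<lambda>w. slice_pt w b ^ Suc n))) sums coef 1 (\<lambda>w. slice_pt w b)"
    using sums_single[of 0 "\<lambda>_. coef 1 (\<lambda>w. slice_pt w b)"]
    by (rule back_subst[of "\<lambda>f. f sums _"]) (auto simp: fun_eq_iff power_0_left)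
  with D show ?thesis using sums_unique2 by blast
qed

lemma axis_expansion:
  assumes "\<bar>s\<bar> < \<delta>"
  shows "(\<lambda>n. s ^ n *\<^sub>R (plane_wave (vderivs n G) p /\<^sub>R fact n)) sums plane_wave G (fst p + s, snd p)"
proof -
  have "(\<lambda>n. coef n (\<lambda>w. slice_pt w (s, 0) ^ n)) sums plane_wave G (p + (s, 0))"
    using assms by (intro has_sum_imp_sums expansion) (simp add: norm_Pair)
  moreover have "coef n (\<lambda>w. slice_pt w (s, 0) ^ n) = s ^ n *\<^sub>R (plane_wave (vderivs n G) p /\<^sub>R fact n)" for n
  proof -
    have sp: "slice_pt w (s, 0 :: (real, 'n) vec) ^ n / fact n = of_real (s ^ n / fact n)" for w
      by (simp add: slice_pt_def Complex_eq)
    show ?thesis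
      unfolding coef_def sp scaleR_eq_scale[symmetric] cl.scaleR_right integral_scaleR_right plane_wave_def
      by (simp add: field_simps)
  qed
  moreover have "p + (s, 0) = (fst p + s, snd p)" by (simp add: prod_eq_iff)
  ultimately show ?thesis by simp
qed

end

section \<open>Plane waves are monogenic\<close>

lemma has_vector_derivative_shift:
  assumes "((\<lambda>s. f (x + s)) has_vector_derivative D) (at (0::real))"
  shows "(f has_vector_derivative D) (at x)"
proof -
  have "((\<lambda>t. t - x) has_real_derivative 1) (at x)" by (auto intro!: derivative_eq_intros)
  hence "((\<lambda>t. t - x) has_vector_derivative 1) (at x)"
    by (simp add: has_real_derivative_iff_has_vector_derivative)
  from vector_diff_chain_at[OF this, of "\<lambda>s. f (x + s)" D] assms
  show ?thesis by (simp add: o_def)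
qed

text \<open>
  The symbol of the Cauchy-Riemann operator annihilates the kernel, because \<open>\<omega>\<^sup>2
  = - 1\<close>.
\<close>

lemma wave_kernel_annihilated:
  assumes "norm w = 1"
  shows "(cl_one + \<i> *s cl_vec w) \<star> wave_kernel w = (0 :: 'n::{finite,linorder} clifford)"
  unfolding wave_kernel_def cl.add_left cl.diff_right
  by (simp add: cl_one_left cl_one_right cl_vec_square assms vec_eq_iff)

lemma cl_vec_eq_sum: "cl_vec w = (\<Sum>j\<in>UNIV. complex_of_real (w \<bullet> axis j 1) *s cl_gen j)"
  by (simp add: cl_vec_def inner_axis)

context wave_expansion
begin

text \<open>The first order coefficients of the expansion are the partial derivatives.\<close>

lemma cauchy_riemann_plane_wave: "cauchy_riemann (plane_wave G) p = 0"
proof -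
  let ?F = "plane_wave G"
  have "((\<lambda>s. ?F (fst p + s, snd p)) has_vector_derivative coef 1 (\<lambda>w. slice_pt w (1, 0))) (at 0)"
    using directional_derivative[of "(1, 0)"] by (simp add: plus_prod_def)
  hence 0: "partial0 ?F p = coef 1 (\<lambda>w. slice_pt w (1, 0))"
    unfolding partial0_def by (intro vector_derivative_at) (rule has_vector_derivative_shift)
  have j: "vector_derivative (\<lambda>t. ?F (fst p, snd p + t *\<^sub>R axis j 1)) (at 0) = coef 1 (\<lambda>w. slice_pt w (0, axis j 1))" for j
    using directional_derivative[of "(0, axis j 1)"] by (intro vector_derivative_at) (simp add: plus_prod_def)
  let ?g = "\<lambda>w. wave_kernel w \<star> vderivs 1 G (slice_pt w p)"
  have c: "coef 1 q = (LINT w|sphere_measure. q w *s ?g w) /\<^sub>R sphere_area CARD('n)" for q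
    by (simp add: coef_def)
  have cont: "continuous_on (sphere 0 1) ?g"
    by (intro cl.continuous_on continuous_intros continuous_on_vderivs_slice_pt)
  have s0: "slice_pt w (1, 0 :: (real, 'n) vec) = 1" for w by (simp add: slice_pt_def complex_eq_iff)
  have sj: "slice_pt w (0, axis j 1) = \<i> * complex_of_real (w \<bullet> axis j 1)" for w and j :: 'n
    by (simp add: slice_pt_def complex_eq_iff inner_commute)
  have int: "integrable sphere_measure (\<lambda>w. (\<i> * complex_of_real (w \<bullet> axis j 1)) *s ?g w)" for j
    by (intro integrable_sphere_measure sc.continuous_on continuous_intros cont)
  have "cauchy_riemann ?F p = ((LINT w|sphere_measure. ?g w) +
     (\<Sum>j\<in>UNIV. cl_gen j \<star> (LINT w|sphere_measure. (\<i> * complex_of_real (w \<bullet> axis j 1)) *s ?g w))) /\<^sub>R sphere_area CARD('n)"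
    unfolding cauchy_riemann_def 0 j c s0 sj by (simp add: cl.scaleR_right scaleR_sum_right scaleR_right_distrib)
  also have "(\<Sum>j\<in>UNIV. cl_gen j \<star> (LINT w|sphere_measure. (\<i> * complex_of_real (w \<bullet> axis j 1)) *s ?g w)) =
     (LINT w|sphere_measure. (\<Sum>j\<in>UNIV. cl_gen j \<star> ((\<i> * complex_of_real (w \<bullet> axis j 1)) *s ?g w)))"
    by (subst Bochner_Integration.integral_sum)
       (auto intro!: sum.cong integral_bounded_linear[OF cl.bounded_linear_right int, symmetric]
         integrable_bounded_linear[OF cl.bounded_linear_right int] simp del: cl_mult_scale_right One_nat_def)
  also have "(LINT w|sphere_measure. ?g w) + \<dots> = (LINT w|sphere_measure. ?g w + (\<Sum>j\<in>UNIV. cl_gen j \<star> ((\<i> * complex_of_real (w \<bullet> axis j 1)) *s ?g w)))"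
    by (intro Bochner_Integration.integral_add[symmetric] integrable_sphere_measure continuous_intros cont)
       (intro cl.continuous_on sc.continuous_on continuous_intros cont)
  also have "\<dots> = (LINT w|(sphere_measure :: (real, 'n) vec measure). 0)"
  proof (rule Bochner_Integration.integral_cong[OF refl])
    fix w :: "(real, 'n) vec" assume "w \<in> space sphere_measure"
    hence w: "norm w = 1" by simp
    have "?g w + (\<Sum>j\<in>UNIV. cl_gen j \<star> ((\<i> * complex_of_real (w \<bullet> axis j 1)) *s ?g w)) =
       (cl_one + \<i> *s cl_vec w) \<star> ?g w"
      unfolding cl_vec_eq_sum[of w] cl.add_left sc.sum_right cl.sum_left by (simp add: cl_one_left)
    also have "\<dots> = ((cl_one + \<i> *s cl_vec w) \<star> wave_kernel w) \<star> vderivs 1 G (slice_pt w p)"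
      by (simp only: cl_mult_assoc)
    also have "\<dots> = 0" unfolding wave_kernel_annihilated[OF w] by (rule cl.zero_left)
    finally show "?g w + (\<Sum>j\<in>UNIV. cl_gen j \<star> ((\<i> * complex_of_real (w \<bullet> axis j 1)) *s ?g w)) = 0" .
  qed
  finally show ?thesis by simp
qed

lemma real_analytic_plane_wave:
  "\<exists>r>0. \<exists>c :: 'n paravector list \<Rightarrow> 'n clifford. \<forall>h. norm h < r \<longrightarrow>
     ((\<lambda>xs. prod_list (map (\<lambda>b. h \<bullet> b) xs) *\<^sub>R c xs) has_sum plane_wave G (p + h)) (lists Basis)"
proof (intro exI[of _ "\<delta> / DIM('n paravector)"] conjI exI[of _ "\<lambda>xs. coef (length xs) (\<lambda>w. prod_list (map (slice_pt w) xs))"] allI impI list_expansion)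
  show "\<delta> / DIM('n paravector) > 0" using delta by (intro divide_pos_pos) (auto simp del: DIM_prod)
  fix h :: "'n paravector" assume h: "norm h < \<delta> / DIM('n paravector)"
  have "(\<Sum>b\<in>Basis. \<bar>h \<bullet> b\<bar>) \<le> (\<Sum>b\<in>(Basis :: 'n paravector set). norm h)"
    by (intro sum_mono Basis_le_norm)
  also have "\<dots> = DIM('n paravector) * norm h" by simp
  also have "\<dots> < \<delta>" using h by (simp add: pos_less_divide_eq mult.commute del: DIM_prod)
  finally show "(\<Sum>b\<in>Basis. \<bar>h \<bullet> b\<bar>) < \<delta>" .
qed

end

text \<open>
  On the real axis the derivatives of \<open>G\<close> do not depend on the direction, so the
  expansion at \<open>(t, 0)\<close> only involves the moments of the sphere.
\<close>

lemma plane_wave_has_sum: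
  fixes G :: "complex \<Rightarrow> 'n::{finite,linorder} clifford"
  assumes G: "vholomorphic_on G (ball (of_real t) \<rho>)" and v: "norm v < \<rho>"
  shows "((\<lambda>n. gck_coeff CARD('n) n *\<^sub>R (cl_pow (cl_vec v) n \<star> vderivs n G (of_real t))) has_sum plane_wave G (t, v)) UNIV"
proof -
  define \<delta> where "\<delta> = (norm v + \<rho>) / 2"
  interpret wave_expansion G "ball (of_real t) \<rho>" "(t, 0)" \<delta>
  proof
    show "\<delta> > 0" unfolding \<delta>_def using v norm_ge_zero[of v] by (auto simp del: norm_ge_zero)
    show "cball (Complex (fst (t, 0)) s) \<delta> \<subseteq> ball (of_real t) \<rho>" if "\<bar>s\<bar> \<le> norm (snd (t, 0 :: (real, 'n) vec))" for s
      using that v by (auto simp: \<delta>_def complex_of_real_def)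
  qed (use G in auto)
  have "norm (0, v) < \<delta>" using v by (simp add: \<delta>_def norm_Pair)
  hence "((\<lambda>n. coef n (\<lambda>w. slice_pt w (0, v) ^ n)) has_sum plane_wave G ((t, 0) + (0, v))) UNIV"
    by (rule expansion)
  moreover have "coef n (\<lambda>w. slice_pt w (0, v) ^ n) = gck_coeff CARD('n) n *\<^sub>R (cl_pow (cl_vec v) n \<star> vderivs n G (of_real t))" for n
  proof -
    let ?s = "sphere_area CARD('n)"
    have "?s > 0" by (rule sphere_area_pos) simp
    have sp: "slice_pt w (t, 0) = of_real t" "slice_pt w (0, v) = \<i> * of_real (v \<bullet> w)" for w :: "(real, 'n) vec"
      by (simp_all add: slice_pt_def complex_eq_iff)
    let ?k = "\<lambda>w. (\<i> * complex_of_real (v \<bullet> w)) ^ n *s (wave_kernel w :: 'n clifford)"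
    have "integrable sphere_measure ?k"
      by (intro integrable_sphere_measure sc.continuous_on continuous_intros)
    hence "(LINT w|sphere_measure. ?k w \<star> ((1 / fact n) *s vderivs n G (of_real t))) =
       (LINT w|sphere_measure. ?k w) \<star> ((1 / fact n) *s vderivs n G (of_real t))"
      by (rule integral_bounded_linear[OF cl.bounded_linear_left])
    also have "(LINT w|sphere_measure. ?k w) = complex_of_real (?s * fact n * gck_coeff CARD('n) n) *s cl_pow (cl_vec v) n"
      unfolding wave_kernel_def by (rule plane_wave_moment)
    also have "\<dots> \<star> ((1 / fact n) *s vderivs n G (of_real t)) = ?s *\<^sub>R (gck_coeff CARD('n) n *\<^sub>R (cl_pow (cl_vec v) n \<star> vderivs n G (of_real t)))"
      by (simp add: scaleR_eq_scale)
    finally show ?thesis using \<open>?s > 0\<close> unfolding coef_def sp by simp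
  qed
  ultimately show ?thesis by simp
qed

text \<open>
  On these points \<open>x = x\<^sub>0 + v\<close> the Taylor series at \<open>x\<^sub>0\<close> of
  a holomorphic function on \<open>\<Omega>\<close> converges along the whole segment
  \<open>x\<^sub>0 + i s\<close>, \<open>|s| \<le> |v|\<close>, over which the plane waves
  integrate.
\<close>

definition wave_domain :: "complex set \<Rightarrow> 'n::finite paravector set" where
  "wave_domain \<Omega> = {x. \<exists>\<rho>. norm (snd x) < \<rho> \<and> ball (of_real (fst x)) \<rho> \<subseteq> \<Omega>}"

lemma axial_nbhd_wave_domain:
  assumes "open \<Omega>"
  shows "axial_nbhd (real_trace \<Omega>) (wave_domain \<Omega> :: 'n::finite paravector set)"
  unfolding axial_nbhd_def
proof (intro conjI)
  show "open (wave_domain \<Omega> :: 'n paravector set)"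
    unfolding open_dist
  proof
    fix x :: "'n paravector" assume "x \<in> wave_domain \<Omega>"
    then obtain \<rho> where \<rho>: "norm (snd x) < \<rho>" "ball (of_real (fst x)) \<rho> \<subseteq> \<Omega>" by (auto simp: wave_domain_def)
    define e where "e = (\<rho> - norm (snd x)) / 2"
    have "y \<in> wave_domain \<Omega>" if "dist y x < e" for y
    proof -
      have 1: "dist (fst y) (fst x) < e" and 2: "dist (snd y) (snd x) < e"
        using that dist_fst_le[of y x] dist_snd_le[of y x] by linarith+
      have "norm (snd y) < \<rho> - e" using 2 norm_triangle_ineq2[of "snd y" "snd x"] by (simp add: dist_norm e_def field_simps)
      moreover have "ball (complex_of_real (fst y)) (\<rho> - e) \<subseteq> ball (of_real (fst x)) \<rho>"
      proof
        fix z assume z: "z \<in> ball (complex_of_real (fst y)) (\<rho> - e)"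
        have "dist (complex_of_real (fst x)) (of_real (fst y)) = dist (fst y) (fst x)"
          by (simp only: dist_of_real dist_commute)
        thus "z \<in> ball (of_real (fst x)) \<rho>"
          using z 1 dist_triangle[of "complex_of_real (fst x)" z "of_real (fst y)"] by simp
      qed
      ultimately show ?thesis using \<rho>(2) by (auto simp: wave_domain_def)
    qed
    moreover have "e > 0" using \<rho> by (simp add: e_def)
    ultimately show "\<exists>e>0. \<forall>y. dist y x < e \<longrightarrow> y \<in> wave_domain \<Omega>" by blast
  qed
  show "\<forall>t\<in>real_trace \<Omega>. (t, 0) \<in> (wave_domain \<Omega> :: 'n paravector set)"
    using assms by (force simp: wave_domain_def real_trace_def open_contains_ball)
  show "\<forall>t v w. (t, v) \<in> (wave_domain \<Omega> :: 'n paravector set) \<and> norm w = norm v \<longrightarrow> (t, w) \<in> wave_domain \<Omega>"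
    by (auto simp: wave_domain_def)
qed

lemma wave_domain_fst: "fst ` (wave_domain \<Omega> :: 'n::finite paravector set) \<subseteq> real_trace \<Omega>"
proof safe
  fix t and v :: "(real, 'n) vec" assume "(t, v) \<in> wave_domain \<Omega>"
  then obtain \<rho> where "norm v < \<rho>" "ball (of_real t) \<rho> \<subseteq> \<Omega>" by (auto simp: wave_domain_def)
  moreover from this have "complex_of_real t \<in> ball (of_real t) \<rho>" using norm_ge_zero[of v] by (simp del: norm_ge_zero)
  ultimately show "fst (t, v) \<in> real_trace \<Omega>" by (auto simp: real_trace_def)
qed

lemma wave_domain_expansion:
  assumes "open \<Omega>" "vholomorphic_on G \<Omega>" "p \<in> wave_domain \<Omega>"
  shows "\<exists>\<delta>. wave_expansion G \<Omega> p \<delta>"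
proof -
  obtain \<rho> where \<rho>: "norm (snd p) < \<rho>" "ball (of_real (fst p)) \<rho> \<subseteq> \<Omega>" using assms by (auto simp: wave_domain_def)
  have "wave_expansion G \<Omega> p ((\<rho> - norm (snd p)) / 2)"
  proof
    fix s assume s: "\<bar>s\<bar> \<le> norm (snd p)"
    have "dist (of_real (fst p)) (Complex (fst p) s) = \<bar>s\<bar>"
      by (simp add: dist_norm cmod_def)
    hence "cball (Complex (fst p) s) ((\<rho> - norm (snd p)) / 2) \<subseteq> ball (of_real (fst p)) \<rho>"
    proof (intro subsetI)
      fix z assume "z \<in> cball (Complex (fst p) s) ((\<rho> - norm (snd p)) / 2)"
      hence "2 * dist (Complex (fst p) s) z \<le> \<rho> - norm (snd p)" by simp
      with dist_triangle[of "of_real (fst p)" z "Complex (fst p) s"]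
        \<open>dist (of_real (fst p)) (Complex (fst p) s) = \<bar>s\<bar>\<close> s \<rho>(1)
      have "dist (of_real (fst p)) z < \<rho>" by linarith
      thus "z \<in> ball (of_real (fst p)) \<rho>" by simp
    qed
    thus "cball (Complex (fst p) s) ((\<rho> - norm (snd p)) / 2) \<subseteq> \<Omega>" using \<rho>(2) by blast
  qed (use assms \<rho> in auto)
  thus ?thesis ..
qed

lemma taylor_vec_has_sum:
  fixes G :: "complex \<Rightarrow> complex ^ 'i::finite"
  assumes G: "vholomorphic_on G (ball z \<delta>)" and y: "cmod y < \<delta>"
  shows "((\<lambda>n. (y ^ n / fact n) *s vderivs n G z) has_sum G (z + y)) UNIV"
proof (rule norm_summable_imp_has_sum[OF _ taylor_vec[OF assms]])
  define d where "d = (cmod y + \<delta>) / 2"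
  have d: "cmod y < d" "d < \<delta>" "d > 0" unfolding d_def using y norm_ge_zero[of y] by (auto simp del: norm_ge_zero)
  have "\<exists>C\<ge>0. \<forall>x\<in>{z}. \<forall>n. norm (vderivs n G x) \<le> fact n * C / d ^ n"
    by (rule vderivs_bound[OF G d(3)]) (use d in auto)
  then obtain C where C: "C \<ge> 0" "\<And>n. norm (vderivs n G z) \<le> fact n * C / d ^ n" by auto
  show "summable (\<lambda>n. norm ((y ^ n / fact n) *s vderivs n G z))"
  proof (rule summable_comparison_test'[where N = 0])
    show "summable (\<lambda>n. C * (cmod y / d) ^ n)"
      using d by (intro summable_mult summable_geometric) simp
    fix n
    have "norm ((y ^ n / fact n) *s vderivs n G z) \<le> cmod y ^ n / fact n * (fact n * C / d ^ n)"
      unfolding norm_scale norm_divide norm_power norm_fact by (intro mult_left_mono C) auto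
    thus "norm (norm ((y ^ n / fact n) *s vderivs n G z)) \<le> C * (cmod y / d) ^ n"
      by (simp add: power_divide mult.commute)
  qed
qed

lemma real_analytic_vderivs:
  fixes G :: "complex \<Rightarrow> complex ^ 'i::finite"
  assumes "open \<Omega>" "vholomorphic_on G \<Omega>"
  shows "real_analytic_on (\<lambda>t. vderivs j G (of_real t)) (real_trace \<Omega>)"
proof (rule real_analytic_onI_lists)
  fix t assume "t \<in> real_trace \<Omega>"
  then obtain r where r: "r > 0" "ball (complex_of_real t) r \<subseteq> \<Omega>"
    using assms by (auto simp: real_trace_def open_contains_ball)
  have hol: "vholomorphic_on (vderivs j G) (ball (complex_of_real t) r)"
    using vholomorphic_vderivs[OF assms(2,1)] r(2) unfolding vholomorphic_on_def by (meson holomorphic_on_subset)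
  define c where "c = (\<lambda>xs :: real list. vderivs (length xs + j) G (of_real t) /\<^sub>R fact (length xs))"
  have bij: "bij_betw length (lists {1::real}) UNIV"
    by (rule bij_betwI[of _ _ _ "\<lambda>n. replicate n 1"]) (auto simp: replicate_eqI in_lists_conv_set intro: replicate_eqI[symmetric])
  have "((\<lambda>xs. prod_list (map (\<lambda>b. h \<bullet> b) xs) *\<^sub>R c xs) has_sum vderivs j G (of_real (t + h))) (lists Basis)" if "norm h < r" for h
  proof -
    have "((\<lambda>n. h ^ n *\<^sub>R (vderivs (n + j) G (of_real t) /\<^sub>R fact n)) has_sum vderivs j G (of_real (t + h))) UNIV"
      using taylor_vec_has_sum[OF hol, of "of_real h"] that
      by (simp add: vderivs_vderivs scaleR_eq_scale divide_inverse mult.commute)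
    hence "((\<lambda>xs. h ^ length xs *\<^sub>R c xs) has_sum vderivs j G (of_real (t + h))) (lists {1::real})"
      unfolding c_def by (subst has_sum_reindex_bij_betw[OF bij, of "\<lambda>n. h ^ n *\<^sub>R (vderivs (n + j) G (of_real t) /\<^sub>R fact n)"])
    also have "?this \<longleftrightarrow> ((\<lambda>xs. prod_list (map (\<lambda>b. h \<bullet> b) xs) *\<^sub>R c xs) has_sum vderivs j G (of_real (t + h))) (lists {1::real})"
    proof (rule has_sum_cong)
      fix xs :: "real list" assume "xs \<in> lists {1}"
      hence "prod_list (map (\<lambda>b. h \<bullet> b) xs) = h ^ length xs" by (induction xs) auto
      thus "h ^ length xs *\<^sub>R c xs = prod_list (map (\<lambda>b. h \<bullet> b) xs) *\<^sub>R c xs" by simp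
    qed
    finally show ?thesis by simp
  qed
  thus "\<exists>r>0. \<exists>c :: real list \<Rightarrow> complex ^ 'i. \<forall>h. norm h < r \<longrightarrow>
     ((\<lambda>xs. prod_list (map (\<lambda>b. h \<bullet> b) xs) *\<^sub>R c xs) has_sum vderivs j G (of_real (t + h))) (lists Basis)"
    using r(1) by blast
qed

section \<open>Existence of the Cauchy-Kovalevskaya extension\<close>

lemma has_sum_even_odd:
  fixes f :: "nat \<Rightarrow> 'a::banach"
  assumes "(f has_sum S) UNIV"
  shows "\<exists>a b. ((\<lambda>i. f (2 * i)) has_sum a) UNIV \<and> ((\<lambda>i. f (2 * i + 1)) has_sum b) UNIV \<and> S = a + b"
proof -
  have sm: "f summable_on X" for X
    using assms has_sum_imp_summable summable_on_subset_banach by (metis subset_UNIV)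
  have bij0: "bij_betw (\<lambda>i::nat. 2 * i) UNIV {n. even n}"
    by (rule bij_betwI[of _ _ _ "\<lambda>n. n div 2"]) auto
  have bij1: "bij_betw (\<lambda>i::nat. 2 * i + 1) UNIV {n. odd n}"
    by (rule bij_betwI[of _ _ _ "\<lambda>n. n div 2"]) auto
  have e: "(f has_sum infsum f {n. even n}) {n. even n}" and o: "(f has_sum infsum f {n. odd n}) {n. odd n}"
    by (simp_all add: sm)
  have "(f has_sum (infsum f {n. even n} + infsum f {n. odd n})) ({n. even n} \<union> {n. odd n})"
    using e o by (rule has_sum_Un_disjoint) auto
  moreover have "{n::nat. even n} \<union> {n. odd n} = UNIV" by auto
  ultimately have "S = infsum f {n. even n} + infsum f {n. odd n}"
    using assms has_sum_unique by metis
  moreover have "((\<lambda>i. f (2 * i)) has_sum infsum f {n. even n}) UNIV"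
    using e by (subst has_sum_reindex_bij_betw[OF bij0])
  moreover have "((\<lambda>i. f (2 * i + 1)) has_sum infsum f {n. odd n}) UNIV"
    using o by (subst has_sum_reindex_bij_betw[OF bij1])
  ultimately show ?thesis by blast
qed

text \<open>
  Even powers of \<open>v\<close> are scalars and odd powers are scalar multiples of
  \<open>v\<close>. The sums on the right are even in \<open>|v|\<close> term by term, so that their
  values are even also where they do not converge.
\<close>

lemma axial_form:
  fixes D :: "nat \<Rightarrow> 'n::{finite,linorder} clifford"
  assumes "((\<lambda>n. c n *\<^sub>R (cl_pow (cl_vec v) n \<star> D n)) has_sum S) UNIV"
  shows "S = (\<Sum>\<^sub>\<infinity>i. (c (2 * i) * (- 1) ^ i * norm v ^ (2 * i)) *\<^sub>R D (2 * i)) +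
     cl_vec (sgn v) \<star> (norm v *\<^sub>R (\<Sum>\<^sub>\<infinity>i. (c (2 * i + 1) * (- 1) ^ i * norm v ^ (2 * i)) *\<^sub>R D (2 * i + 1)))"
proof -
  let ?f = "\<lambda>n. c n *\<^sub>R (cl_pow (cl_vec v) n \<star> D n)"
  let ?g = "\<lambda>i. (c (2 * i + 1) * (- 1) ^ i * norm v ^ (2 * i)) *\<^sub>R D (2 * i + 1)"
  obtain a b where ab: "((\<lambda>i. ?f (2 * i)) has_sum a) UNIV" "((\<lambda>i. ?f (2 * i + 1)) has_sum b) UNIV" "S = a + b"
    using has_sum_even_odd[OF assms] by blast
  have "?f (2 * i) = (c (2 * i) * (- 1) ^ i * norm v ^ (2 * i)) *\<^sub>R D (2 * i)" for i
    unfolding cl_pow_vec_even by (simp add: cl_one_left scaleR_eq_scale mult.assoc)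
  hence a: "a = (\<Sum>\<^sub>\<infinity>i. (c (2 * i) * (- 1) ^ i * norm v ^ (2 * i)) *\<^sub>R D (2 * i))"
    using ab(1) by (simp add: infsumI)
  have f_odd: "?f (2 * i + 1) = cl_vec v \<star> ?g i" for i
    unfolding cl_pow_vec_odd cl.scaleR_right cl.scaleR_left by (simp add: scaleR_eq_scale mult.assoc)
  have b: "b = cl_vec (sgn v) \<star> (norm v *\<^sub>R infsum ?g UNIV)"
  proof (cases "v = 0")
    case True
    hence "((\<lambda>i. 0) has_sum b) (UNIV :: nat set)" using ab(2) unfolding f_odd by (simp add: cl.zero_left)
    moreover have "((\<lambda>i. 0 :: 'n clifford) has_sum 0) (UNIV :: nat set)" by simp
    ultimately have "b = 0" by (rule has_sum_unique)
    thus ?thesis using True by (simp add: cl.zero_right)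
  next
    case False
    have vv: "cl_vec v \<star> (cl_vec v \<star> y) = (- (norm v)\<^sup>2) *\<^sub>R y" for y
      unfolding cl_mult_assoc[symmetric] cl_vec_square by (simp add: cl_one_left scaleR_eq_scale cl.minus_left)
    have "((\<lambda>i. (- 1 / (norm v)\<^sup>2) *\<^sub>R (cl_vec v \<star> ?f (2 * i + 1))) has_sum (- 1 / (norm v)\<^sup>2) *\<^sub>R (cl_vec v \<star> b)) UNIV"
      by (intro has_sum_bounded_linear[OF bounded_linear_scaleR_right] has_sum_bounded_linear[OF cl.bounded_linear_right] ab(2))
    hence "(?g has_sum (- 1 / (norm v)\<^sup>2) *\<^sub>R (cl_vec v \<star> b)) UNIV"
      unfolding f_odd vv using False by simp
    hence "infsum ?g UNIV = (- 1 / (norm v)\<^sup>2) *\<^sub>R (cl_vec v \<star> b)" by (rule infsumI)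
    hence "cl_vec v \<star> infsum ?g UNIV = b" using False by (simp only: cl.scaleR_right vv) simp
    moreover have "cl_vec (sgn v) \<star> (norm v *\<^sub>R infsum ?g UNIV) = cl_vec v \<star> infsum ?g UNIV"
      using False by (simp add: sgn_div_norm cl_vec_scaleR cl.scaleR_left cl.scaleR_right)
    ultimately show ?thesis by simp
  qed
  show ?thesis unfolding ab(3) a b ..
qed

text \<open>
  The coefficients are \<open>c\<^sub>n G\<^sup>(\<^sup>n\<^sup>)\<close>, by the moment series.
\<close>

theorem is_GCK_plane_wave:
  fixes G :: "complex \<Rightarrow> 'n::{finite,linorder} clifford"
  assumes "open \<Omega>" and G: "vholomorphic_on G \<Omega>"
  shows "is_GCK (real_trace \<Omega>) (\<lambda>t. G (of_real t)) (wave_domain \<Omega>) (plane_wave G)"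
  unfolding is_GCK_def
proof (intro conjI)
  let ?m = "CARD('n)"
  show "axial_nbhd (real_trace \<Omega>) (wave_domain \<Omega> :: 'n paravector set)" by (rule axial_nbhd_wave_domain[OF assms(1)])
  show "fst ` (wave_domain \<Omega> :: 'n paravector set) \<subseteq> real_trace \<Omega>" by (rule wave_domain_fst)
  have ser: "((\<lambda>n. gck_coeff ?m n *\<^sub>R (cl_pow (cl_vec (snd x)) n \<star> vderivs n G (of_real (fst x)))) has_sum plane_wave G x) UNIV"
    if x: "x \<in> wave_domain \<Omega>" for x :: "'n paravector"
  proof -
    obtain \<rho> where "norm (snd x) < \<rho>" "ball (of_real (fst x)) \<rho> \<subseteq> \<Omega>" using x by (auto simp: wave_domain_def)
    moreover have "vholomorphic_on G (ball (of_real (fst x)) \<rho>)"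
      using G calculation unfolding vholomorphic_on_def by (meson holomorphic_on_subset)
    ultimately show ?thesis using plane_wave_has_sum[of G "fst x" \<rho> "snd x"] by simp
  qed
  show "axially_monogenic_on (wave_domain \<Omega>) (plane_wave G)"
    unfolding axially_monogenic_on_def
  proof (intro conjI ballI exI)
    show "real_analytic_on (plane_wave G) (wave_domain \<Omega>)"
      using wave_domain_expansion[OF assms] wave_expansion.real_analytic_plane_wave
      by (intro real_analytic_onI_lists) blast
    show "cauchy_riemann (plane_wave G) x = 0" if "x \<in> wave_domain \<Omega>" for x
      using wave_domain_expansion[OF assms that] wave_expansion.cauchy_riemann_plane_wave by blast
    let ?A = "\<lambda>u s. (\<Sum>\<^sub>\<infinity>i. (gck_coeff ?m (2 * i) * (- 1) ^ i * s ^ (2 * i)) *\<^sub>R vderivs (2 * i) G (of_real u))"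
    let ?B = "\<lambda>u s. s *\<^sub>R (\<Sum>\<^sub>\<infinity>i. (gck_coeff ?m (2 * i + 1) * (- 1) ^ i * s ^ (2 * i)) *\<^sub>R vderivs (2 * i + 1) G (of_real u))"
    show "\<forall>u v. ?A u (- v) = ?A u v \<and> ?B u (- v) = - ?B u v" by simp
    show "plane_wave G x = ?A (fst x) (norm (snd x)) + cl_vec (sgn (snd x)) \<star> ?B (fst x) (norm (snd x))"
      if "x \<in> wave_domain \<Omega>" for x
      by (rule axial_form[OF ser[OF that]])
  qed
  show "\<exists>f. (\<forall>j. real_analytic_on (f j) (real_trace \<Omega>)) \<and>
        (\<forall>x\<in>wave_domain \<Omega>. (\<lambda>j. cl_pow (cl_vec (snd x)) j \<star> f j (fst x)) sums plane_wave G x)"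
  proof (intro exI[of _ "\<lambda>j t. gck_coeff ?m j *\<^sub>R vderivs j G (of_real t)"] conjI allI ballI)
    fix j
    have "vholomorphic_on (\<lambda>z. gck_coeff ?m j *\<^sub>R vderivs j G z) \<Omega>"
      using vholomorphic_vderivs[OF G assms(1), of j]
      by (auto simp: vholomorphic_on_def scaleR_conv_of_real intro!: holomorphic_intros)
    from real_analytic_vderivs[OF assms(1) this, of 0]
    show "real_analytic_on (\<lambda>t. gck_coeff ?m j *\<^sub>R vderivs j G (of_real t)) (real_trace \<Omega>)" by simp
  next
    fix x :: "'n paravector" assume "x \<in> wave_domain \<Omega>"
    from has_sum_imp_sums[OF ser[OF this]]
    show "(\<lambda>j. cl_pow (cl_vec (snd x)) j \<star> (gck_coeff ?m j *\<^sub>R vderivs j G (of_real (fst x)))) sums plane_wave G x"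
      by (simp only: cl.scaleR_right)
  qed
  show "\<forall>t\<in>real_trace \<Omega>. plane_wave G (pv_real t :: 'n paravector) = G (of_real t)"
  proof
    fix t assume "t \<in> real_trace \<Omega>"
    hence "(t, 0) \<in> (wave_domain \<Omega> :: 'n paravector set)"
      using axial_nbhd_wave_domain[OF assms(1), where 'n = 'n] by (auto simp: axial_nbhd_def)
    from has_sum_imp_sums[OF ser[OF this]]
    have "(\<lambda>n. gck_coeff ?m n *\<^sub>R (cl_pow (0 :: 'n clifford) n \<star> vderivs n G (of_real t))) sums plane_wave G (t, 0)" by simp
    moreover have "(\<lambda>n. gck_coeff ?m n *\<^sub>R (cl_pow (0 :: 'n clifford) n \<star> vderivs n G (of_real t))) sums G (of_real t)"
    proof -
      have "gck_coeff ?m n *\<^sub>R (cl_pow (0 :: 'n clifford) n \<star> vderivs n G (of_real t)) = (if n = 0 then G (of_real t) else 0)" for n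
        by (cases n) (auto simp: cl_one_left cl.zero_left)
      thus ?thesis using sums_single[of 0 "\<lambda>_. G (of_real t)"] by simp
    qed
    ultimately show "plane_wave G (pv_real t :: 'n paravector) = G (of_real t)"
      unfolding pv_real_def by (rule sums_unique2)
  qed
qed

section \<open>Uniqueness of the Cauchy-Kovalevskaya extension\<close>

lemma cl_pow_add: "cl_pow x (a + b) = cl_pow x a \<star> cl_pow x b"
  by (induction a) (simp_all add: cl_one_left cl_mult_assoc)

text \<open>A unit vector has order four.\<close>

lemma cl_pow_unit_inverse:
  assumes "norm e = 1"
  shows "cl_pow (cl_vec e) (3 * b) \<star> cl_pow (cl_vec e) b = (cl_one :: 'n::{finite,linorder} clifford)"
proof -
  have "cl_pow (cl_vec e) (3 * b) \<star> cl_pow (cl_vec e) b = (cl_pow (cl_vec e) (2 * (2 * b)) :: 'n clifford)"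
    unfolding cl_pow_add[symmetric] by (simp add: algebra_simps)
  thus ?thesis unfolding cl_pow_vec_even by (simp add: assms)
qed

text \<open>Restriction of the multi-index expansion to a coordinate plane.\<close>

lemma real_analytic_double_series:
  fixes F :: "'a::euclidean_space \<Rightarrow> 'b::banach"
  assumes F: "real_analytic_on F U" and p: "p \<in> U" and b: "b0 \<in> Basis" "b1 \<in> Basis" "b0 \<noteq> b1"
  shows "\<exists>r>0. \<exists>c. \<forall>x y. \<bar>x\<bar> < r \<longrightarrow> \<bar>y\<bar> < r \<longrightarrow>
     ((\<lambda>(i, j). (x ^ i * y ^ j) *\<^sub>R c i j) has_sum F (p + x *\<^sub>R b0 + y *\<^sub>R b1)) (UNIV \<times> UNIV)"
proof -
  let ?A = "{\<alpha> :: 'a \<Rightarrow> nat. \<forall>b. b \<notin> Basis \<longrightarrow> \<alpha> b = 0}"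
  obtain r c where r: "r > 0" and c: "\<And>h. norm h < r \<Longrightarrow>
        ((\<lambda>\<alpha>. (\<Prod>b\<in>Basis. (h \<bullet> b) ^ \<alpha> b) *\<^sub>R c \<alpha>) has_sum F (p + h)) ?A"
    using F p unfolding real_analytic_on_def by meson
  let ?A' = "{\<alpha> :: 'a \<Rightarrow> nat. \<forall>b. b \<notin> {b0, b1} \<longrightarrow> \<alpha> b = 0}"
  define \<alpha> where "\<alpha> = (\<lambda>i j b. if b = b0 then i else if b = b1 then j else (0::nat))"
  have bij: "bij_betw (\<lambda>(i, j). \<alpha> i j) (UNIV \<times> UNIV) ?A'"
    by (rule bij_betwI[of _ _ _ "\<lambda>f. (f b0, f b1)"]) (use b in \<open>auto simp: \<alpha>_def fun_eq_iff\<close>)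
  have "((\<lambda>(i, j). (x ^ i * y ^ j) *\<^sub>R c (\<alpha> i j)) has_sum F (p + x *\<^sub>R b0 + y *\<^sub>R b1)) (UNIV \<times> UNIV)"
    if xy: "\<bar>x\<bar> < r / 2" "\<bar>y\<bar> < r / 2" for x y
  proof -
    define h where "h = x *\<^sub>R b0 + y *\<^sub>R b1"
    have "norm h \<le> \<bar>x\<bar> + \<bar>y\<bar>" unfolding h_def using b norm_triangle_ineq[of "x *\<^sub>R b0" "y *\<^sub>R b1"] by simp
    also have "\<dots> < r" using xy by linarith
    finally have nh: "norm h < r" .
    have hb: "h \<bullet> b0 = x" "h \<bullet> b1 = y" using b by (auto simp: h_def inner_add_left inner_Basis)
    have hb': "h \<bullet> b = 0" if "b \<in> Basis" "b \<noteq> b0" "b \<noteq> b1" for b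
      using that b by (auto simp: h_def inner_add_left inner_Basis)
    have "((\<lambda>\<alpha>. (\<Prod>b\<in>Basis. (h \<bullet> b) ^ \<alpha> b) *\<^sub>R c \<alpha>) has_sum F (p + h)) ?A'"
    proof (rule has_sum_cong_neutral[THEN iffD1, OF _ _ _ c[OF nh]])
      show "(\<Prod>b\<in>Basis. (h \<bullet> b) ^ \<beta> b) *\<^sub>R c \<beta> = 0" if \<beta>: "\<beta> \<in> ?A - ?A'" for \<beta>
      proof -
        obtain b where "b \<noteq> b0" "b \<noteq> b1" "\<beta> b \<noteq> 0" using \<beta> by auto
        moreover have "b \<in> Basis" using \<beta> \<open>\<beta> b \<noteq> 0\<close> by auto
        ultimately have "(\<Prod>b\<in>Basis. (h \<bullet> b) ^ \<beta> b) = 0"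
          using hb' by (auto intro!: prod_zero)
        thus ?thesis by simp
      qed
    qed (use b in auto)
    hence "((\<lambda>q. (\<Prod>b\<in>Basis. (h \<bullet> b) ^ (case q of (i, j) \<Rightarrow> \<alpha> i j) b) *\<^sub>R c (case q of (i, j) \<Rightarrow> \<alpha> i j)) has_sum F (p + h)) (UNIV \<times> UNIV)"
      by (subst has_sum_reindex_bij_betw[OF bij])
    moreover have "(\<Prod>b\<in>Basis. (h \<bullet> b) ^ \<alpha> i j b) = x ^ i * y ^ j" for i j
    proof -
      have "(\<Prod>b\<in>Basis. (h \<bullet> b) ^ \<alpha> i j b) = (\<Prod>b\<in>{b0, b1}. (h \<bullet> b) ^ \<alpha> i j b)"
        using b by (intro prod.mono_neutral_right) (auto simp: \<alpha>_def)
      thus ?thesis using b by (simp add: hb \<alpha>_def)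
    qed
    ultimately show ?thesis by (simp add: case_prod_unfold h_def add.assoc)
  qed
  thus ?thesis using r by (intro exI[of _ "r / 2"] conjI exI[of _ "\<lambda>i j. c (\<alpha> i j)"]) auto
qed

text \<open>Absolute convergence permits summation by rows.\<close>

lemma double_series_iterated:
  fixes c :: "nat \<Rightarrow> nat \<Rightarrow> 'b::banach"
  assumes r: "r > 0" and c: "\<And>x y. \<bar>x\<bar> < r \<Longrightarrow> \<bar>y\<bar> < r \<Longrightarrow>
     ((\<lambda>(i, j). (x ^ i * y ^ j) *\<^sub>R c i j) has_sum H x y) (UNIV \<times> UNIV)"
  shows "\<exists>g. \<forall>y. \<bar>y\<bar> < r \<longrightarrow> (\<forall>i. (\<lambda>j. y ^ j *\<^sub>R c i j) sums g i y) \<and> (\<forall>x. \<bar>x\<bar> < r \<longrightarrow> (\<lambda>i. x ^ i *\<^sub>R g i y) sums H x y)"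
proof (intro exI[of _ "\<lambda>i y. \<Sum>\<^sub>\<infinity>j. y ^ j *\<^sub>R c i j"] allI impI conjI)
  fix y assume y: "\<bar>y\<bar> < r"
  have inner: "((\<lambda>j. y ^ j *\<^sub>R c i j) has_sum (\<Sum>\<^sub>\<infinity>j. y ^ j *\<^sub>R c i j)) UNIV" for i
  proof -
    have bij: "bij_betw (Pair i) (UNIV :: nat set) ({i} \<times> UNIV)"
      by (rule bij_betwI[of _ _ _ snd]) auto
    have "(\<lambda>(i, j). ((r / 2) ^ i * y ^ j) *\<^sub>R c i j) summable_on (UNIV \<times> UNIV)"
      using c[of "r / 2" y] r y by (auto intro: has_sum_imp_summable)
    hence "(\<lambda>(i, j). ((r / 2) ^ i * y ^ j) *\<^sub>R c i j) summable_on ({i} \<times> UNIV)"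
      by (rule summable_on_subset_banach) auto
    hence "(\<lambda>j. ((r / 2) ^ i * y ^ j) *\<^sub>R c i j) summable_on UNIV"
      by (subst (asm) summable_on_reindex_bij_betw[OF bij, symmetric]) simp
    hence "(\<lambda>j. (1 / (r / 2) ^ i) *\<^sub>R (((r / 2) ^ i * y ^ j) *\<^sub>R c i j)) summable_on UNIV"
      by (rule summable_on_scaleR_right)
    hence "(\<lambda>j. y ^ j *\<^sub>R c i j) summable_on UNIV" using r by simp
    thus ?thesis by simp
  qed
  show "(\<lambda>j. y ^ j *\<^sub>R c i j) sums (\<Sum>\<^sub>\<infinity>j. y ^ j *\<^sub>R c i j)" for i
    by (rule has_sum_imp_sums[OF inner])
  fix x assume x: "\<bar>x\<bar> < r"
  show "(\<lambda>i. x ^ i *\<^sub>R (\<Sum>\<^sub>\<infinity>j. y ^ j *\<^sub>R c i j)) sums H x y"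
  proof (rule has_sum_imp_sums, rule has_sum_SigmaD[OF c[OF x y]])
    fix i
    show "((\<lambda>j. case (i, j) of (i, j) \<Rightarrow> (x ^ i * y ^ j) *\<^sub>R c i j) has_sum x ^ i *\<^sub>R (\<Sum>\<^sub>\<infinity>j. y ^ j *\<^sub>R c i j)) UNIV"
      using has_sum_bounded_linear[OF bounded_linear_scaleR_right inner, of "x ^ i"] by simp
  qed
qed

text \<open>
  Compare coefficients in the Cauchy-Riemann equation along the ray \<open>s \<mapsto> (t, s
  e)\<close>. The real analytic expansion in \<open>(x\<^sub>0, s)\<close> shows that the
  coefficients \<open>f\<^sub>j\<close> may be differentiated under the sum. The derivatives across
  the ray are found from the axial form: \<open>F\<close> depends on \<open>|v|\<close> apart from
  one factor \<open>v\<close>, and \<open>|v|\<close> is stationary in these directions.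
\<close>

lemma GCK_recursion:
  fixes F :: "'n::{finite,linorder} paravector \<Rightarrow> 'n clifford"
  assumes U: "open U" "(t, 0) \<in> U" and F: "real_analytic_on F U" and CR: "\<And>x. x \<in> U \<Longrightarrow> cauchy_riemann F x = 0"
    and f: "\<And>x. x \<in> U \<Longrightarrow> (\<lambda>j. cl_pow (cl_vec (snd x)) j \<star> f j (fst x)) sums F x"
  shows "vderiv (f j) t = (if even j then real CARD('n) + real j else real j + 1) *\<^sub>R f (Suc j) t"
proof -
  let ?m = "CARD('n)"
  define k :: 'n where "k = undefined"
  define e :: "(real, 'n) vec" where "e = axis k 1"
  define E where "E = (cl_vec e :: 'n clifford)"
  have e: "norm e = 1" by (simp add: e_def)
  have EE: "E \<star> E = - cl_one" unfolding E_def cl_vec_square e by (simp add: vec_eq_iff)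
  have EEy: "E \<star> (E \<star> y) = - y" for y
    unfolding cl_mult_assoc[symmetric] EE by (simp add: cl.minus_left cl_one_left)
  have pow_e: "cl_pow (cl_vec (s *\<^sub>R e)) b = s ^ b *\<^sub>R cl_pow E b" for s b
    unfolding cl_vec_scaleR scaleR_eq_scale cl_pow_scale E_def by simp
  have b1: "(1 :: real) \<in> Basis" by (simp add: Basis_real_def)
  have b2: "e \<in> Basis" unfolding e_def axis_in_Basis_iff by (rule b1)
  have basis: "(1 :: real, 0 :: (real, 'n) vec) \<in> Basis" "(0 :: real, e) \<in> Basis" "(1, 0) \<noteq> (0 :: real, e)"
    using e b1 b2 by (auto simp: Basis_prod_def image_iff)
  obtain r1 c where r1: "r1 > 0" and c: "\<And>x y. \<bar>x\<bar> < r1 \<Longrightarrow> \<bar>y\<bar> < r1 \<Longrightarrow>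
     ((\<lambda>(i, j). (x ^ i * y ^ j) *\<^sub>R c i j) has_sum F (t + x, y *\<^sub>R e)) (UNIV \<times> UNIV)"
    using real_analytic_double_series[OF F U(2) basis] by auto
  obtain r2 where r2: "r2 > 0" "\<And>x. dist x (t, 0) < r2 \<Longrightarrow> x \<in> U"
    using U unfolding open_dist by blast
  define r where "r = min r1 (r2 / 2)"
  have r: "r > 0" "r \<le> r1" using r1 r2 by (auto simp: r_def)
  have inU: "(t + x, v) \<in> U" if "\<bar>x\<bar> < r" "norm v < r" for x v
  proof -
    have "dist (t + x, v) (t, 0) \<le> \<bar>x\<bar> + norm v"
      unfolding dist_Pair_Pair using sqrt_sum_squares_le_sum_abs[of x "norm v"] by (simp add: dist_norm)
    also have "\<dots> < r2" using that by (simp add: r_def)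
    finally show ?thesis by (rule r2)
  qed
  have inU0: "(t, v) \<in> U" if "norm v < r" for v using inU[of 0 v] that r by simp
  obtain g where g: "\<And>y i. \<bar>y\<bar> < r \<Longrightarrow> (\<lambda>j. y ^ j *\<^sub>R c i j) sums g i y"
     "\<And>x y. \<bar>x\<bar> < r \<Longrightarrow> \<bar>y\<bar> < r \<Longrightarrow> (\<lambda>i. x ^ i *\<^sub>R g i y) sums F (t + x, y *\<^sub>R e)"
  proof -
    have "((\<lambda>(i, j). (x ^ i * y ^ j) *\<^sub>R c i j) has_sum F (t + x, y *\<^sub>R e)) (UNIV \<times> UNIV)"
      if "\<bar>x\<bar> < r" "\<bar>y\<bar> < r" for x y
      using that r by (intro c) auto
    from double_series_iterated[OF r(1), of c "\<lambda>x y. F (t + x, y *\<^sub>R e)", OF this] that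
    show ?thesis by blast
  qed
  obtain g' where g': "\<And>x j. \<bar>x\<bar> < r \<Longrightarrow> (\<lambda>i. x ^ i *\<^sub>R c i j) sums g' j x"
     "\<And>x y. \<bar>x\<bar> < r \<Longrightarrow> \<bar>y\<bar> < r \<Longrightarrow> (\<lambda>j. y ^ j *\<^sub>R g' j x) sums F (t + x, y *\<^sub>R e)"
  proof -
    have "((\<lambda>(j, i). (y ^ j * x ^ i) *\<^sub>R c i j) has_sum F (t + x, y *\<^sub>R e)) (UNIV \<times> UNIV)"
      if "\<bar>y\<bar> < r" "\<bar>x\<bar> < r" for x y
    proof -
      have bij: "bij_betw prod.swap (UNIV \<times> UNIV :: (nat \<times> nat) set) (UNIV \<times> UNIV)"
        by (rule bij_betwI[of _ _ _ prod.swap]) auto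
      have "((\<lambda>q. case prod.swap q of (i, j) \<Rightarrow> (x ^ i * y ^ j) *\<^sub>R c i j) has_sum F (t + x, y *\<^sub>R e)) (UNIV \<times> UNIV)"
        using c that r by (subst has_sum_reindex_bij_betw[OF bij]) auto
      thus ?thesis by (simp add: case_prod_unfold mult.commute)
    qed
    from double_series_iterated[OF r(1), of "\<lambda>j i. c i j" "\<lambda>y x. F (t + x, y *\<^sub>R e)", OF this] that
    show ?thesis by blast
  qed
  \<comment> \<open>Collecting the double series by powers of \<open>s\<close> recovers the \<open>f\<^sub>j\<close>, collecting it by powers of
    the increment of \<open>x\<^sub>0\<close> gives the derivative in \<open>x\<^sub>0\<close>.\<close>
  have g'_eq: "g' j x = cl_pow E j \<star> f j (t + x)" if x: "\<bar>x\<bar> < r" for x j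
  proof (rule powser_unique[of r _ "\<lambda>y. F (t + x, y *\<^sub>R e)", OF g'(2)[OF x] _ r(1)])
    fix y :: real assume y: "\<bar>y\<bar> < r"
    show "(\<lambda>j. y ^ j *\<^sub>R (cl_pow E j \<star> f j (t + x))) sums F (t + x, y *\<^sub>R e)"
      using f[OF inU[OF x, of "y *\<^sub>R e"]] y e by (simp add: pow_e cl.scaleR_left)
  qed
  have deriv_f: "cl_pow E j \<star> vderiv (f j) t = c 1 j" for j
  proof -
    have "\<exists>D. (g' j has_vector_derivative D) (at 0) \<and> (\<lambda>n. 0 ^ n *\<^sub>R (real (Suc n) *\<^sub>R c (Suc n) j)) sums D"
      by (rule powser_has_vector_derivative[of r]) (use g'(1) r in auto)
    moreover have "(\<lambda>n. 0 ^ n *\<^sub>R (real (Suc n) *\<^sub>R c (Suc n) j)) sums c 1 j"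
      using sums_single[of 0 "\<lambda>_. c 1 j"]
      by (rule back_subst[of "\<lambda>f. f sums _"]) (auto simp: fun_eq_iff power_0_left)
    ultimately have "(g' j has_vector_derivative c 1 j) (at 0)" using sums_unique2 by blast
    hence "((\<lambda>x. cl_pow E j \<star> f j (t + x)) has_vector_derivative c 1 j) (at 0)"
    proof (rule has_vector_derivative_transform_within_open[of _ _ _ "{-r<..<r}"])
      show "g' j x = cl_pow E j \<star> f j (t + x)" if "x \<in> {-r<..<r}" for x
        using that by (intro g'_eq) auto
    qed (use r in auto)
    hence "((\<lambda>x. cl_pow E (3 * j) \<star> (cl_pow E j \<star> f j (t + x))) has_vector_derivative cl_pow E (3 * j) \<star> c 1 j) (at 0)"
      by (rule bounded_linear.has_vector_derivative[OF cl.bounded_linear_right])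
    hence "((\<lambda>x. f j (t + x)) has_vector_derivative cl_pow E (3 * j) \<star> c 1 j) (at 0)"
      unfolding cl_mult_assoc[symmetric] E_def cl_pow_unit_inverse[OF e] cl_one_left .
    hence "(f j has_vector_derivative cl_pow E (3 * j) \<star> c 1 j) (at t)" by (rule has_vector_derivative_shift)
    hence *: "vderiv (f j) t = cl_pow E (3 * j) \<star> c 1 j" unfolding vderiv_def by (rule vector_derivative_at)
    have "cl_pow E j \<star> cl_pow E (3 * j) = cl_pow E (3 * j) \<star> cl_pow E j"
      unfolding cl_pow_add[symmetric] by (simp add: add.commute)
    thus ?thesis unfolding * cl_mult_assoc[symmetric] E_def cl_pow_unit_inverse[OF e] by (simp add: cl_one_left cl_pow_unit_inverse[OF e])
  qed
  have partial0: "(\<lambda>j. s ^ j *\<^sub>R (cl_pow E j \<star> vderiv (f j) t)) sums partial0 F (t, s *\<^sub>R e)" if s: "\<bar>s\<bar> < r" for s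
  proof -
    have "\<exists>D. ((\<lambda>x. F (t + x, s *\<^sub>R e)) has_vector_derivative D) (at 0) \<and> (\<lambda>n. 0 ^ n *\<^sub>R (real (Suc n) *\<^sub>R g (Suc n) s)) sums D"
      by (rule powser_has_vector_derivative[of r]) (use g(2) r s in auto)
    moreover have "(\<lambda>n. 0 ^ n *\<^sub>R (real (Suc n) *\<^sub>R g (Suc n) s)) sums g 1 s"
      using sums_single[of 0 "\<lambda>_. g 1 s"]
      by (rule back_subst[of "\<lambda>f. f sums _"]) (auto simp: fun_eq_iff power_0_left)
    ultimately have "((\<lambda>x. F (t + x, s *\<^sub>R e)) has_vector_derivative g 1 s) (at 0)" using sums_unique2 by blast
    hence "((\<lambda>x. F (x, s *\<^sub>R e)) has_vector_derivative g 1 s) (at t)" by (rule has_vector_derivative_shift)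
    hence "partial0 F (t, s *\<^sub>R e) = g 1 s" unfolding partial0_def by (simp add: vector_derivative_at)
    thus ?thesis using g(1)[OF s] by (simp add: deriv_f)
  qed
  \<comment> \<open>The even part \<open>Pe\<close> and the odd part \<open>Po\<close> along the ray determine \<open>F\<close> at all \<open>(t, v)\<close>.\<close>
  define \<phi> where "\<phi> = (\<lambda>s. F (t, s *\<^sub>R e))"
  define b where "b = (\<lambda>j. cl_pow E j \<star> f j t)"
  have \<phi>: "(\<lambda>j. s ^ j *\<^sub>R b j) sums \<phi> s" if "\<bar>s\<bar> < r" for s
    using f[OF inU0, of "s *\<^sub>R e"] that e by (simp add: pow_e cl.scaleR_left b_def \<phi>_def)
  define Pe where "Pe = (\<lambda>s. (\<phi> s + \<phi> (- s)) /\<^sub>R 2)"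
  define Po where "Po = (\<lambda>s. (\<phi> s - \<phi> (- s)) /\<^sub>R 2)"
  have Pe: "(\<lambda>j. if even j then s ^ j *\<^sub>R b j else 0) sums Pe s"
    and Po: "(\<lambda>j. if odd j then s ^ j *\<^sub>R b j else 0) sums Po s" if s: "\<bar>s\<bar> < r" for s
  proof -
    have p: "(\<lambda>j. s ^ j *\<^sub>R b j) sums \<phi> s" "(\<lambda>j. (- s) ^ j *\<^sub>R b j) sums \<phi> (- s)"
      using \<phi>[of s] \<phi>[of "- s"] s by auto
    have "(\<lambda>j. (s ^ j *\<^sub>R b j + (- s) ^ j *\<^sub>R b j) /\<^sub>R 2) sums Pe s"
      unfolding Pe_def by (intro sums_scaleR_right sums_add p)
    moreover have "(s ^ j *\<^sub>R b j + (- s) ^ j *\<^sub>R b j) /\<^sub>R 2 = (if even j then s ^ j *\<^sub>R b j else 0)" for j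
      by (auto simp: scaleR_2[symmetric])
    ultimately show "(\<lambda>j. if even j then s ^ j *\<^sub>R b j else 0) sums Pe s" by simp
    have "(\<lambda>j. (s ^ j *\<^sub>R b j - (- s) ^ j *\<^sub>R b j) /\<^sub>R 2) sums Po s"
      unfolding Po_def by (intro sums_scaleR_right sums_diff p)
    moreover have "(s ^ j *\<^sub>R b j - (- s) ^ j *\<^sub>R b j) /\<^sub>R 2 = (if odd j then s ^ j *\<^sub>R b j else 0)" for j
      by (auto simp: scaleR_2[symmetric])
    ultimately show "(\<lambda>j. if odd j then s ^ j *\<^sub>R b j else 0) sums Po s" by simp
  qed
  have F_axial: "F (t, v) = Pe \<sigma> - (1 / \<sigma>) *\<^sub>R (cl_vec v \<star> (E \<star> Po \<sigma>))"
    if \<sigma>: "\<sigma>\<^sup>2 = (norm v)\<^sup>2" "\<sigma> \<noteq> 0" "\<bar>\<sigma>\<bar> < r" for \<sigma> v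
  proof -
    have nv: "norm v = \<bar>\<sigma>\<bar>" using \<sigma>(1) by (metis abs_norm_cancel real_sqrt_abs)
    have "(\<lambda>j. cl_pow (cl_vec v) j \<star> f j t) sums F (t, v)"
      using f[OF inU0, of v] nv \<sigma> by simp
    moreover have "(\<lambda>j. (if even j then \<sigma> ^ j *\<^sub>R b j else 0) - (1 / \<sigma>) *\<^sub>R (cl_vec v \<star> (E \<star> (if odd j then \<sigma> ^ j *\<^sub>R b j else 0))))
       sums (Pe \<sigma> - (1 / \<sigma>) *\<^sub>R (cl_vec v \<star> (E \<star> Po \<sigma>)))"
      by (intro sums_diff Pe Po sums_scaleR_right bounded_linear.sums[OF cl.bounded_linear_right] \<sigma>)
    moreover have "(if even j then \<sigma> ^ j *\<^sub>R b j else 0) - (1 / \<sigma>) *\<^sub>R (cl_vec v \<star> (E \<star> (if odd j then \<sigma> ^ j *\<^sub>R b j else 0)))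
       = cl_pow (cl_vec v) j \<star> f j t" for j
    proof (cases "even j")
      case True
      then obtain i where j: "j = 2 * i" by blast
      have "cl_pow E j \<star> f j t = (- 1) ^ i *\<^sub>R f j t"
        unfolding E_def j cl_pow_vec_even by (simp add: e scaleR_eq_scale cl_one_left)
      moreover have "cl_pow (cl_vec v) j \<star> f j t = ((- 1) ^ i * \<sigma> ^ (2 * i)) *\<^sub>R f j t"
        unfolding j cl_pow_vec_even by (simp add: nv power_mult scaleR_eq_scale cl_one_left)
      ultimately show ?thesis using True unfolding b_def
        by (simp add: cl.zero_right j)
    next
      case False
      then obtain i where j: "j = 2 * i + 1" by (metis oddE)
      have "E \<star> (cl_pow E j \<star> f j t) = - ((- 1) ^ i *\<^sub>R f j t)"
        unfolding E_def j cl_pow_vec_odd unfolding E_def[symmetric] cl_mult_scale_left cl_mult_scale_right EEy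
        by (simp add: e scaleR_eq_scale)
      moreover have "cl_pow (cl_vec v) j \<star> f j t = ((- 1) ^ i * \<sigma> ^ (2 * i)) *\<^sub>R (cl_vec v \<star> f j t)"
        unfolding j cl_pow_vec_odd by (simp add: nv power_mult scaleR_eq_scale)
      ultimately show ?thesis using False \<sigma>(2) unfolding b_def
        by (simp add: cl.scaleR_right cl.minus_right j)
    qed
    ultimately show ?thesis using sums_unique2 by (simp cong: if_cong)
  qed
  have key: "partial0 F (t, s *\<^sub>R e) + E \<star> vector_derivative \<phi> (at s) + (real (?m - 1) / s) *\<^sub>R (E \<star> Po s) = 0"
    if s: "\<bar>s\<bar> < r" "s \<noteq> 0" for s
  proof -
    obtain D where D: "(\<phi> has_vector_derivative D) (at s)"
      using powser_has_vector_derivative[OF \<phi> s(1)] by blast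
    obtain D' where D': "(\<phi> has_vector_derivative D') (at (- s))"
      using powser_has_vector_derivative[of r b \<phi>, OF \<phi>, of "- s"] s(1) by auto
    have neg: "(uminus has_vector_derivative -1) (at s)"
      by (auto intro!: derivative_eq_intros simp: has_real_derivative_iff_has_vector_derivative[symmetric])
    have Dn: "((\<lambda>s. \<phi> (- s)) has_vector_derivative (- 1) *\<^sub>R D') (at s)"
      using vector_diff_chain_at[OF neg, of \<phi> D'] D' by (simp add: o_def)
    have dPe: "(Pe has_vector_derivative (D + (- 1) *\<^sub>R D') /\<^sub>R 2) (at s)"
      unfolding Pe_def by (rule bounded_linear.has_vector_derivative[OF bounded_linear_scaleR_right has_vector_derivative_add[OF D Dn]])
    have dPo: "(Po has_vector_derivative (D - (- 1) *\<^sub>R D') /\<^sub>R 2) (at s)"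
      unfolding Po_def by (rule bounded_linear.has_vector_derivative[OF bounded_linear_scaleR_right has_vector_derivative_diff[OF D Dn]])
    have dk: "vector_derivative (\<lambda>x. F (t, s *\<^sub>R e + x *\<^sub>R axis k 1)) (at 0) = vector_derivative \<phi> (at s)"
    proof -
      have sh: "((\<lambda>x. s + x) has_vector_derivative 1) (at 0)"
        by (auto intro!: derivative_eq_intros simp: has_real_derivative_iff_has_vector_derivative[symmetric])
      have "((\<lambda>x. \<phi> (s + x)) has_vector_derivative D) (at 0)"
        using vector_diff_chain_at[OF sh, of \<phi> D] D by (simp add: o_def)
      hence "((\<lambda>x. F (t, s *\<^sub>R e + x *\<^sub>R axis k 1)) has_vector_derivative D) (at 0)"
        unfolding \<phi>_def e_def by (simp only: scaleR_left_distrib)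
      thus ?thesis using D by (simp add: vector_derivative_at)
    qed
    have dj: "vector_derivative (\<lambda>x. F (t, s *\<^sub>R e + x *\<^sub>R axis j 1)) (at 0) = - (1 / s) *\<^sub>R (cl_gen j \<star> (E \<star> Po s))"
      if j: "j \<noteq> k" for j
    proof -
      \<comment> \<open>The signed length of \<open>s e + x e\<^sub>j\<close>, which is stationary at \<open>x = 0\<close>.\<close>
      define \<sigma> where "\<sigma> = (\<lambda>x. sgn s * sqrt (s\<^sup>2 + x\<^sup>2))"
      have \<sigma>0: "\<sigma> 0 = s" by (simp add: \<sigma>_def sgn_mult_abs)
      have "(\<sigma> has_real_derivative 0) (at 0)"
        unfolding \<sigma>_def using s by (auto intro!: derivative_eq_intros)
      hence d\<sigma>: "(\<sigma> has_vector_derivative 0) (at 0)" and d\<sigma>i: "((\<lambda>x. - (1 / \<sigma> x)) has_real_derivative 0) (at 0)"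
        using s by (auto intro!: derivative_eq_intros simp: has_real_derivative_iff_has_vector_derivative[symmetric] \<sigma>0)
      have d1: "((\<lambda>x. Pe (\<sigma> x)) has_vector_derivative 0) (at 0)"
        using vector_diff_chain_at[OF d\<sigma>, of Pe] dPe by (simp add: o_def \<sigma>0)
      have "((\<lambda>x. Po (\<sigma> x)) has_vector_derivative 0) (at 0)"
        using vector_diff_chain_at[OF d\<sigma>, of Po] dPo by (simp add: o_def \<sigma>0)
      from bounded_linear.has_vector_derivative[OF cl.bounded_linear_right this, of E]
      have d2: "((\<lambda>x. E \<star> Po (\<sigma> x)) has_vector_derivative 0) (at 0)" by (simp add: cl.zero_right)
      have d3: "((\<lambda>x. cl_vec (s *\<^sub>R e + x *\<^sub>R axis j 1)) has_vector_derivative cl_gen j) (at 0)"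
        unfolding cl_vec_add cl_vec_scaleR cl_vec_axis by (auto intro!: derivative_eq_intros)
      have d4: "((\<lambda>x. cl_vec (s *\<^sub>R e + x *\<^sub>R axis j 1) \<star> (E \<star> Po (\<sigma> x))) has_vector_derivative cl_gen j \<star> (E \<star> Po s)) (at 0)"
        using cl.has_vector_derivative[OF d3 d2] by (simp add: cl.zero_right \<sigma>0)
      have d5: "((\<lambda>x. Pe (\<sigma> x) + (- (1 / \<sigma> x)) *\<^sub>R (cl_vec (s *\<^sub>R e + x *\<^sub>R axis j 1) \<star> (E \<star> Po (\<sigma> x)))) has_vector_derivative
         - (1 / s) *\<^sub>R (cl_gen j \<star> (E \<star> Po s))) (at 0)"
        using has_vector_derivative_add[OF d1 has_vector_derivative_scaleR[OF d\<sigma>i d4]] by (simp add: \<sigma>0)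
      have "((\<lambda>x. F (t, s *\<^sub>R e + x *\<^sub>R axis j 1)) has_vector_derivative - (1 / s) *\<^sub>R (cl_gen j \<star> (E \<star> Po s))) (at 0)"
      proof (rule has_vector_derivative_transform_within_open[OF d5, of "{x. s\<^sup>2 + x\<^sup>2 < r\<^sup>2}"])
        show "open {x. s\<^sup>2 + x\<^sup>2 < r\<^sup>2}" by (intro open_Collect_less continuous_intros)
        show "0 \<in> {x. s\<^sup>2 + x\<^sup>2 < r\<^sup>2}" using s r power_strict_mono[of "\<bar>s\<bar>" r 2] by simp
        fix x assume x: "x \<in> {x. s\<^sup>2 + x\<^sup>2 < r\<^sup>2}"
        have \<sigma>2: "(\<sigma> x)\<^sup>2 = s\<^sup>2 + x\<^sup>2" using s by (simp add: \<sigma>_def power_mult_distrib sgn_if)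
        have "(norm (s *\<^sub>R e + x *\<^sub>R axis j 1))\<^sup>2 = s\<^sup>2 + x\<^sup>2"
          unfolding power2_norm_eq_inner e_def using j
          by (simp add: inner_add_left inner_add_right inner_axis_axis power2_eq_square)
        moreover have "\<sigma> x \<noteq> 0" using \<sigma>2 s by (metis add_pos_nonneg less_irrefl zero_le_power2 zero_less_power2 power_zero_numeral)
        moreover have "\<bar>\<sigma> x\<bar> < r" using \<sigma>2 x r by (intro power2_less_imp_less[of "\<bar>\<sigma> x\<bar>" r]) auto
        ultimately show "Pe (\<sigma> x) + (- (1 / \<sigma> x)) *\<^sub>R (cl_vec (s *\<^sub>R e + x *\<^sub>R axis j 1) \<star> (E \<star> Po (\<sigma> x))) = F (t, s *\<^sub>R e + x *\<^sub>R axis j 1)"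
          using F_axial[of "\<sigma> x" "s *\<^sub>R e + x *\<^sub>R axis j 1"] \<sigma>2 by simp
      qed
      thus ?thesis by (rule vector_derivative_at)
    qed
    have gj: "cl_gen j \<star> (- (1 / s) *\<^sub>R (cl_gen j \<star> y)) = (1 / s) *\<^sub>R y" for j :: 'n and y :: "'n clifford"
    proof -
      have "cl_gen j \<star> (cl_gen j \<star> y) = - y"
        unfolding cl_mult_assoc[symmetric] cl_vec_axis[symmetric] cl_vec_square
        by (simp add: cl_one_left cl.minus_left)
      thus ?thesis by (simp add: cl.scaleR_right cl.minus_right)
    qed
    have "0 = cauchy_riemann F (t, s *\<^sub>R e)"
      using CR[OF inU0, of "s *\<^sub>R e"] s e by simp
    also have "\<dots> = partial0 F (t, s *\<^sub>R e) +
       (\<Sum>j\<in>UNIV. cl_gen j \<star> vector_derivative (\<lambda>x. F (t, s *\<^sub>R e + x *\<^sub>R axis j 1)) (at 0))"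
      unfolding cauchy_riemann_def by simp
    also have "(\<Sum>j\<in>UNIV. cl_gen j \<star> vector_derivative (\<lambda>x. F (t, s *\<^sub>R e + x *\<^sub>R axis j 1)) (at 0)) =
       (\<Sum>j\<in>insert k (UNIV - {k}). cl_gen j \<star> vector_derivative (\<lambda>x. F (t, s *\<^sub>R e + x *\<^sub>R axis j 1)) (at 0))"
      by (simp add: insert_UNIV insert_Diff_if)
    also have "\<dots> = E \<star> vector_derivative \<phi> (at s) + (\<Sum>j\<in>UNIV - {k}. (1 / s) *\<^sub>R (E \<star> Po s))"
    proof -
      have Ek: "cl_gen k = E" by (simp add: E_def e_def cl_vec_axis)
      have "(\<Sum>j\<in>UNIV - {k}. cl_gen j \<star> vector_derivative (\<lambda>x. F (t, s *\<^sub>R e + x *\<^sub>R axis j 1)) (at 0)) =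
         (\<Sum>j\<in>UNIV - {k}. (1 / s) *\<^sub>R (E \<star> Po s))"
      proof (rule sum.cong[OF refl])
        fix j assume "j \<in> UNIV - {k}"
        hence "j \<noteq> k" by simp
        show "cl_gen j \<star> vector_derivative (\<lambda>x. F (t, s *\<^sub>R e + x *\<^sub>R axis j 1)) (at 0) = (1 / s) *\<^sub>R (E \<star> Po s)"
          unfolding dj[OF \<open>j \<noteq> k\<close>] by (rule gj)
      qed
      thus ?thesis by (subst sum.insert) (simp_all only: dk Ek finite_Diff finite Diff_iff insert_iff simp_thms)
    qed
    also have "(\<Sum>j\<in>UNIV - {k}. (1 / s) *\<^sub>R (E \<star> Po s)) = (real (?m - 1) / s) *\<^sub>R (E \<star> Po s)"
      by (simp add: sum_constant_scaleR card_Diff_singleton del: sum_constant)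
    finally show ?thesis by (simp add: add.assoc)
  qed
  define T where "T = (\<lambda>n. cl_pow E n \<star> (vderiv (f n) t - (if even n then real ?m + real n else real n + 1) *\<^sub>R f (Suc n) t))"
  have Eb: "E \<star> b (Suc n) = - (cl_pow E n \<star> f (Suc n) t)" for n
    unfolding b_def by (simp add: cl_mult_assoc EEy)
  have Tser: "(\<lambda>n. s ^ n *\<^sub>R T n) sums 0" if s: "\<bar>s\<bar> < r" "s \<noteq> 0" for s
  proof -
    obtain D where D: "(\<phi> has_vector_derivative D) (at s)" "(\<lambda>n. s ^ n *\<^sub>R (real (Suc n) *\<^sub>R b (Suc n))) sums D"
      using powser_has_vector_derivative[OF \<phi> s(1)] by blast
    from D(1) have vd: "vector_derivative \<phi> (at s) = D" by (rule vector_derivative_at)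
    have "(\<lambda>n. if odd (Suc n) then s ^ Suc n *\<^sub>R b (Suc n) else 0) sums Po s"
      using sums_Suc_iff[of "\<lambda>j. if odd j then s ^ j *\<^sub>R b j else 0" "Po s"] Po[OF s(1)] by simp
    hence p: "(\<lambda>n. (real (?m - 1) / s) *\<^sub>R (E \<star> (if odd (Suc n) then s ^ Suc n *\<^sub>R b (Suc n) else 0))) sums ((real (?m - 1) / s) *\<^sub>R (E \<star> Po s))"
      by (intro sums_scaleR_right bounded_linear.sums[OF cl.bounded_linear_right])
    have "(\<lambda>n. s ^ n *\<^sub>R (cl_pow E n \<star> vderiv (f n) t) + E \<star> (s ^ n *\<^sub>R (real (Suc n) *\<^sub>R b (Suc n))) +
       (real (?m - 1) / s) *\<^sub>R (E \<star> (if odd (Suc n) then s ^ Suc n *\<^sub>R b (Suc n) else 0))) sums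
       (partial0 F (t, s *\<^sub>R e) + E \<star> D + (real (?m - 1) / s) *\<^sub>R (E \<star> Po s))"
      by (intro sums_add partial0 s bounded_linear.sums[OF cl.bounded_linear_right] D p)
    moreover have "s ^ n *\<^sub>R (cl_pow E n \<star> vderiv (f n) t) + E \<star> (s ^ n *\<^sub>R (real (Suc n) *\<^sub>R b (Suc n))) +
       (real (?m - 1) / s) *\<^sub>R (E \<star> (if odd (Suc n) then s ^ Suc n *\<^sub>R b (Suc n) else 0)) = s ^ n *\<^sub>R T n" for n
    proof (cases "even n")
      case True
      have "s ^ n *\<^sub>R (cl_pow E n \<star> vderiv (f n) t) + E \<star> (s ^ n *\<^sub>R (real (Suc n) *\<^sub>R b (Suc n))) +
       (real (?m - 1) / s) *\<^sub>R (E \<star> (if odd (Suc n) then s ^ Suc n *\<^sub>R b (Suc n) else 0)) =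
         s ^ n *\<^sub>R (cl_pow E n \<star> vderiv (f n) t) + (s ^ n * (real (Suc n) + real (?m - 1))) *\<^sub>R (E \<star> b (Suc n))"
      proof -
        have "E \<star> (s ^ n *\<^sub>R (real (Suc n) *\<^sub>R b (Suc n))) = (s ^ n * real (Suc n)) *\<^sub>R (E \<star> b (Suc n))"
          by (simp only: cl.scaleR_right scaleR_scaleR)
        moreover have "(real (?m - 1) / s) *\<^sub>R (E \<star> (if odd (Suc n) then s ^ Suc n *\<^sub>R b (Suc n) else 0)) =
           (s ^ n * real (?m - 1)) *\<^sub>R (E \<star> b (Suc n))"
          using True s(2) by (simp add: cl.scaleR_right del: of_nat_diff)
        ultimately show ?thesis by (simp only: distrib_left scaleR_left_distrib add.assoc)
      qed
      also have "real (Suc n) + real (?m - 1) = real ?m + real n"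
        using zero_less_card_finite[where 'a = 'n] by linarith
      finally show ?thesis using True unfolding Eb T_def
        by (simp add: cl.diff_right cl.scaleR_right scaleR_right_diff_distrib)
    next
      case False
      thus ?thesis unfolding T_def
        by (simp add: cl.diff_right cl.scaleR_right scaleR_right_diff_distrib Eb cl.zero_right)
    qed
    ultimately show ?thesis using key[OF s] unfolding vd by simp
  qed
  \<comment> \<open>The identity is only known for \<open>s \<noteq> 0\<close>; continuity of the sum adds the point \<open>0\<close>.\<close>
  define Z where "Z = (\<lambda>s::real. if s = 0 then T 0 else 0)"
  have Zser: "(\<lambda>n. s ^ n *\<^sub>R T n) sums Z s" if "\<bar>s\<bar> < r" for s
  proof (cases "s = 0")
    case True
    have "(\<lambda>n. 0 ^ n *\<^sub>R T n) sums T 0"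
      using sums_single[of 0 "\<lambda>_. T 0"]
      by (rule back_subst[of "\<lambda>f. f sums _"]) (auto simp: fun_eq_iff power_0_left)
    thus ?thesis using True by (simp add: Z_def)
  qed (use Tser that in \<open>simp add: Z_def\<close>)
  have T0: "T 0 = 0"
  proof -
    obtain D where "(Z has_vector_derivative D) (at 0)"
      using powser_has_vector_derivative[of r T Z 0] Zser r by auto
    hence "isCont Z 0" by (rule has_vector_derivative_continuous)
    hence "(Z \<longlongrightarrow> T 0) (at 0)" by (simp add: isCont_def Z_def)
    moreover have "(Z \<longlongrightarrow> 0) (at 0)"
      by (rule tendsto_eventually) (simp add: Z_def eventually_at_filter)
    ultimately show ?thesis by (intro tendsto_unique[of "at (0::real)" Z]) auto
  qed
  have "T j = 0"
    by (rule powser_unique[of r T Z "\<lambda>_. 0", OF Zser _ r(1)]) (simp_all add: Z_def T0)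
  hence "cl_pow E (3 * j) \<star> T j = 0" by (simp add: cl.zero_right)
  hence "vderiv (f j) t - (if even j then real ?m + real j else real j + 1) *\<^sub>R f (Suc j) t = 0"
    unfolding T_def cl_mult_assoc[symmetric] E_def cl_pow_unit_inverse[OF e] cl_one_left .
  thus ?thesis by simp
qed

lemma axial_nbhd_base_open:
  assumes "axial_nbhd \<Omega>\<^sub>1 U" "fst ` U \<subseteq> \<Omega>\<^sub>1"
  shows "open \<Omega>\<^sub>1"
  unfolding open_dist
proof
  fix t assume "t \<in> \<Omega>\<^sub>1"
  with assms obtain e where e: "e > 0" "\<And>x. dist x (t, 0) < e \<Longrightarrow> x \<in> U"
    unfolding axial_nbhd_def open_dist by blast
  have "y \<in> \<Omega>\<^sub>1" if "dist y t < e" for y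
    using e(2)[of "(y, 0)"] that assms(2) by (force simp: dist_Pair_Pair)
  thus "\<exists>e>0. \<forall>y. dist y t < e \<longrightarrow> y \<in> \<Omega>\<^sub>1" using e(1) by blast
qed

text \<open>
  The recursion determines all coefficients on the base from the first one, and the series
  determines the extension.
\<close>

theorem is_GCK_unique:
  fixes F F' :: "'n::{finite,linorder} paravector \<Rightarrow> 'n clifford"
  assumes F: "is_GCK \<Omega>\<^sub>1 f\<^sub>0 U F" and F': "is_GCK \<Omega>\<^sub>1 f\<^sub>0 U' F'" and x: "x \<in> U" "x \<in> U'"
  shows "F x = F' x"
proof -
  obtain f where f: "\<And>x. x \<in> U \<Longrightarrow> (\<lambda>j. cl_pow (cl_vec (snd x)) j \<star> f j (fst x)) sums F x"
    using F unfolding is_GCK_def by blast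
  obtain f' where f': "\<And>x. x \<in> U' \<Longrightarrow> (\<lambda>j. cl_pow (cl_vec (snd x)) j \<star> f' j (fst x)) sums F' x"
    using F' unfolding is_GCK_def by blast
  have open1: "open \<Omega>\<^sub>1" using F axial_nbhd_base_open unfolding is_GCK_def by blast
  have U: "open U" "open U'" "\<And>t. t \<in> \<Omega>\<^sub>1 \<Longrightarrow> (t, 0) \<in> U" "\<And>t. t \<in> \<Omega>\<^sub>1 \<Longrightarrow> (t, 0) \<in> U'"
    using F F' unfolding is_GCK_def axial_nbhd_def by auto
  have am: "real_analytic_on F U" "\<And>x. x \<in> U \<Longrightarrow> cauchy_riemann F x = 0"
     "real_analytic_on F' U'" "\<And>x. x \<in> U' \<Longrightarrow> cauchy_riemann F' x = 0"
    using F F' unfolding is_GCK_def axially_monogenic_on_def by auto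
  have at0: "g 0 t = H (t, 0)" if "(\<lambda>j. cl_pow (cl_vec 0) j \<star> g j t) sums H (t, 0)"
    for g :: "nat \<Rightarrow> real \<Rightarrow> 'n clifford" and H t
  proof -
    have "cl_pow (cl_vec 0) j \<star> g j t = (if j = 0 then g 0 t else 0)" for j
      by (cases j) (auto simp: cl_one_left cl.zero_left)
    hence "(\<lambda>j. if j = 0 then g 0 t else 0) sums H (t, 0)" using that by simp
    moreover have "(\<lambda>j. if j = 0 then g 0 t else 0) sums g 0 t"
      using sums_single[of 0 "\<lambda>_. g 0 t"] by simp
    ultimately show ?thesis by (rule sums_unique2[symmetric])
  qed
  have "\<forall>t\<in>\<Omega>\<^sub>1. f j t = f' j t" for j
  proof (induction j)
    case 0
    show ?case
    proof
      fix t assume t: "t \<in> \<Omega>\<^sub>1"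
      have "f 0 t = F (t, 0)" using f[OF U(3)[OF t]] by (intro at0) simp
      moreover have "f' 0 t = F' (t, 0)" using f'[OF U(4)[OF t]] by (intro at0) simp
      moreover have "F (t, 0) = f\<^sub>0 t" "F' (t, 0) = f\<^sub>0 t"
        using F F' t unfolding is_GCK_def pv_real_def by auto
      ultimately show "f 0 t = f' 0 t" by simp
    qed
  next
    case (Suc j)
    show ?case
    proof
      fix t assume t: "t \<in> \<Omega>\<^sub>1"
      have "vderiv (f j) t = vderiv (f' j) t"
        by (rule vderiv_cong) (use Suc eventually_nhds_in_open[OF open1 t] in \<open>auto elim: eventually_mono\<close>)
      hence "(if even j then real CARD('n) + real j else real j + 1) *\<^sub>R f (Suc j) t =
             (if even j then real CARD('n) + real j else real j + 1) *\<^sub>R f' (Suc j) t"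
        using GCK_recursion[OF U(1) U(3)[OF t] am(1,2) f, of j] GCK_recursion[OF U(2) U(4)[OF t] am(3,4) f', of j]
        by simp
      moreover have "(if even j then real CARD('n) + real j else real j + 1) \<noteq> 0"
      proof -
        have "real CARD('n) > 0" by simp
        thus ?thesis by (simp del: zero_less_card_finite of_nat_0_less_iff)
      qed
      ultimately show "f (Suc j) t = f' (Suc j) t" by (rule scaleR_left_imp_eq[rotated])
    qed
  qed
  moreover have "fst x \<in> \<Omega>\<^sub>1" using F x unfolding is_GCK_def by blast
  ultimately have "(\<lambda>j. cl_pow (cl_vec (snd x)) j \<star> f j (fst x)) sums F' x"
    using f'[OF x(2)] by simp
  with f[OF x(1)] show ?thesis by (rule sums_unique2)
qed

lemma GCK_eq:
  assumes "is_GCK \<Omega>\<^sub>1 f\<^sub>0 U F" "x \<in> U"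
  shows "GCK \<Omega>\<^sub>1 f\<^sub>0 x = F x"
  unfolding GCK_def using assms is_GCK_unique by (intro the_equality) blast+

lemma real_analytic_on_cong_open:
  assumes F: "real_analytic_on F U" and "open U" and eq: "\<And>x. x \<in> U \<Longrightarrow> F x = F' x"
  shows "real_analytic_on F' U"
  unfolding real_analytic_on_def
proof
  fix p assume p: "p \<in> U"
  obtain r c where r: "r > 0" and c: "\<And>h. norm h < r \<Longrightarrow>
        ((\<lambda>\<alpha>. (\<Prod>b\<in>Basis. (h \<bullet> b) ^ \<alpha> b) *\<^sub>R c \<alpha>) has_sum F (p + h)) {\<alpha>. \<forall>b. b \<notin> Basis \<longrightarrow> \<alpha> b = 0}"
    using F p unfolding real_analytic_on_def by meson
  obtain r' where r': "r' > 0" "\<And>y. dist y p < r' \<Longrightarrow> y \<in> U" using \<open>open U\<close> p unfolding open_dist by blast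
  have "((\<lambda>\<alpha>. (\<Prod>b\<in>Basis. (h \<bullet> b) ^ \<alpha> b) *\<^sub>R c \<alpha>) has_sum F' (p + h)) {\<alpha>. \<forall>b. b \<notin> Basis \<longrightarrow> \<alpha> b = 0}"
    if "norm h < min r r'" for h
    using c[of h] eq[OF r'(2), of "p + h"] that by (simp add: dist_norm)
  thus "\<exists>r>0. \<exists>c. \<forall>h. norm h < r \<longrightarrow>
        ((\<lambda>\<alpha>. (\<Prod>b\<in>Basis. (h \<bullet> b) ^ \<alpha> b) *\<^sub>R c \<alpha>) has_sum F' (p + h)) {\<alpha>. \<forall>b. b \<notin> Basis \<longrightarrow> \<alpha> b = 0}"
    using r r'(1) by (intro exI[of _ "min r r'"] conjI exI[of _ c] allI impI) auto
qed

lemma cauchy_riemann_cong: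
  assumes "open U" "x \<in> U" and eq: "\<And>x. x \<in> U \<Longrightarrow> F x = F' x"
  shows "cauchy_riemann F x = cauchy_riemann F' x"
proof -
  have "\<forall>\<^sub>F y in nhds x. y \<in> U" using assms(1,2) by (rule eventually_nhds_in_open)
  hence ev: "\<forall>\<^sub>F t in nhds t0. F (g t) = F' (g t)" if "isCont g t0" "g t0 = x" for g t0
  proof -
    have "filterlim g (nhds x) (nhds t0)"
      using that unfolding isCont_def tendsto_at_iff_tendsto_nhds by simp
    hence "\<forall>\<^sub>F t in nhds t0. g t \<in> U" using \<open>\<forall>\<^sub>F y in nhds x. y \<in> U\<close> unfolding filterlim_iff by blast
    thus ?thesis by eventually_elim (rule eq)
  qed
  have "partial0 F x = partial0 F' x" unfolding partial0_def
    by (rule vector_derivative_cong_eq) (auto intro!: ev)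
  moreover have "vector_derivative (\<lambda>t. F (fst x, snd x + t *\<^sub>R axis j 1)) (at 0) = vector_derivative (\<lambda>t. F' (fst x, snd x + t *\<^sub>R axis j 1)) (at 0)" for j
    by (rule vector_derivative_cong_eq) (auto intro!: ev)
  ultimately show ?thesis unfolding cauchy_riemann_def by simp
qed

lemma is_GCK_cong:
  assumes F: "is_GCK \<Omega>\<^sub>1 f\<^sub>0 U F" and eq: "\<And>x. x \<in> U \<Longrightarrow> F x = F' x"
    and f: "\<And>t. t \<in> \<Omega>\<^sub>1 \<Longrightarrow> f\<^sub>0 t = f\<^sub>0' t"
  shows "is_GCK \<Omega>\<^sub>1 f\<^sub>0' U F'"
proof -
  have U: "open U" "\<And>t. t \<in> \<Omega>\<^sub>1 \<Longrightarrow> (t, 0) \<in> U" using F unfolding is_GCK_def axial_nbhd_def by auto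
  have "axially_monogenic_on U F'"
    using F real_analytic_on_cong_open[OF _ U(1) eq] cauchy_riemann_cong[OF U(1) _ eq] eq
    unfolding is_GCK_def axially_monogenic_on_def by simp
  thus ?thesis using F eq f U(2) unfolding is_GCK_def pv_real_def by simp
qed

section \<open>Derivatives of powers\<close>

lemma fact_gbinomial_Suc:
  fixes a :: "'a::field_char_0"
  shows "fact (Suc n) * (a gchoose Suc n) = (fact n * (a gchoose n)) * (a - of_nat n)"
  unfolding gbinomial_mult_fact by simp

lemma of_real_gbinomial: "of_real (a gchoose n) = (of_real a gchoose n :: 'a::{real_field,field_char_0})"
proof (induction n)
  case (Suc n)
  have "fact (Suc n) * of_real (a gchoose Suc n) = (of_real (fact (Suc n) * (a gchoose Suc n)) :: 'a)"
    by (simp only: of_real_mult of_real_fact)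
  also have "\<dots> = fact (Suc n) * (of_real a gchoose Suc n)"
    unfolding fact_gbinomial_Suc by (simp add: Suc del: fact_Suc)
  finally show ?case by (simp del: fact_Suc)
qed simp

lemma has_field_derivative_powi:
  fixes z :: complex
  assumes "k \<ge> 0 \<or> z \<noteq> 0"
  shows "((\<lambda>z. z powi k) has_field_derivative of_int k * z powi (k - 1)) (at z)"
proof (cases "z = 0")
  case False
  thus ?thesis by (auto intro!: derivative_eq_intros)
next
  case True
  with assms obtain n where k: "k = int n" using nonneg_int_cases by auto
  have "((\<lambda>z. z ^ n) has_field_derivative of_nat n * z ^ (n - 1)) (at z)"
    by (auto intro!: derivative_eq_intros)
  also have "of_nat n * z ^ (n - 1) = of_int k * z powi (k - 1)"
    by (cases n) (simp_all add: k)
  finally show ?thesis by (simp add: k)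
qed

text \<open>
  In the form with generalized binomial coefficients this covers all integer exponents; for \<open>0
  \<le> k < n\<close> the coefficient vanishes, which accounts for the point \<open>0\<close>.
\<close>

lemma higher_deriv_powi:
  fixes z :: complex
  assumes "k \<ge> 0 \<or> z \<noteq> 0"
  shows "(deriv ^^ n) (\<lambda>z. z powi k) z = fact n * (of_int k gchoose n) * z powi (k - int n)"
  using assms
proof (induction n arbitrary: z)
  case (Suc n)
  define S where "S = (if k \<ge> 0 then UNIV else - {0 :: complex})"
  have S: "open S" "z \<in> S" using Suc.prems by (auto simp: S_def)
  have "eventually (\<lambda>x. x \<in> S) (nhds z)" by (rule eventually_nhds_in_open[OF S])
  hence "eventually (\<lambda>x. (deriv ^^ n) (\<lambda>z. z powi k) x = fact n * (of_int k gchoose n) * x powi (k - int n)) (nhds z)"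
    by eventually_elim (rule Suc.IH, auto simp: S_def split: if_splits)
  hence "deriv ((deriv ^^ n) (\<lambda>z. z powi k)) z = deriv (\<lambda>x. fact n * (of_int k gchoose n) * x powi (k - int n)) z"
    by (rule deriv_cong_ev) simp
  also have "\<dots> = fact n * (of_int k gchoose n) * of_int (k - int n) * z powi (k - int n - 1)"
  proof (cases "k - int n \<ge> 0 \<or> z \<noteq> 0")
    case True
    from DERIV_cmult[OF has_field_derivative_powi[OF True], of "fact n * (of_int k gchoose n)"]
    show ?thesis by (intro DERIV_imp_deriv) (simp only: mult.assoc)
  next
    case False
    with Suc.prems have "k \<ge> 0" "k < int n" by auto
    then obtain k' where "k = int k'" "k' < n" using nonneg_int_cases by auto
    hence "(of_int k gchoose n) = (0 :: complex)" by (simp add: binomial_gbinomial[symmetric])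
    thus ?thesis by simp
  qed
  also have "fact n * (of_int k gchoose n) * of_int (k - int n) = fact (Suc n) * (of_int k gchoose Suc n :: complex)"
    unfolding fact_gbinomial_Suc by simp
  finally show ?case by (simp add: algebra_simps)
qed simp

lemma vholomorphic_scale:
  assumes "g holomorphic_on S"
  shows "vholomorphic_on (\<lambda>z. g z *s c) S"
  using assms by (auto simp: vholomorphic_on_def intro!: holomorphic_intros)

lemma vderivs_scale:
  assumes "g holomorphic_on S" "open S" "z \<in> S"
  shows "vderivs n (\<lambda>z. g z *s c) z = (deriv ^^ n) g z *s c"
proof -
  have "(deriv ^^ n) (\<lambda>z. (g z *s c) $ A) z = ((deriv ^^ n) g z *s c) $ A" for A
  proof -
    have "(\<lambda>z. (g z *s c) $ A) = (\<lambda>z. c $ A * g z)" by (simp add: fun_eq_iff mult.commute)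
    thus ?thesis using higher_deriv_cmult[OF assms(1,3,2), of n "c $ A"] by (simp add: mult.commute)
  qed
  thus ?thesis by (simp add: vderivs_def vec_eq_iff)
qed

definition power_wave :: "int \<Rightarrow> 'n paravector \<Rightarrow> 'n::{finite,linorder} clifford" where
  "power_wave k = plane_wave (\<lambda>z. z powi k *s cl_one)"

lemma powi_holomorphic:
  assumes "k \<ge> 0 \<or> 0 \<notin> S"
  shows "(\<lambda>z. z powi k) holomorphic_on S"
  using assms by (intro holomorphic_intros) auto

lemma vderivs_powi:
  assumes "k \<ge> 0 \<or> z \<noteq> 0"
  shows "vderivs n (\<lambda>z. z powi k *s c) z = (fact n * (of_int k gchoose n)) *s (z powi (k - int n) *s c)"
proof -
  define S where "S = (if k \<ge> 0 then UNIV else - {0 :: complex})"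
  have S: "open S" "z \<in> S" "(\<lambda>z. z powi k) holomorphic_on S"
    using assms by (auto simp: S_def intro!: powi_holomorphic)
  show ?thesis unfolding vderivs_scale[OF S(3,1,2)] higher_deriv_powi[OF assms] by simp
qed

lemma plane_wave_cong:
  assumes "\<And>w. norm w = 1 \<Longrightarrow> G (slice_pt w x) = G' (slice_pt w x)"
  shows "plane_wave G x = plane_wave G' x"
  unfolding plane_wave_def
  by (intro arg_cong[of _ _ "\<lambda>y. y /\<^sub>R _"] Bochner_Integration.integral_cong) (auto simp: assms)

lemma plane_wave_scale:
  assumes "continuous_on ((\<lambda>w. slice_pt w x) ` sphere 0 1) G"
  shows "plane_wave (\<lambda>z. c *s G z) x = c *s (plane_wave G x)"
proof -
  have "continuous_on (sphere 0 1) (\<lambda>w. G (slice_pt w x))"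
    by (rule continuous_on_compose2[OF assms]) (auto intro!: continuous_intros)
  hence "integrable sphere_measure (\<lambda>w. wave_kernel w \<star> G (slice_pt w x))"
    by (intro integrable_sphere_measure cl.continuous_on continuous_intros)
  thus ?thesis by (simp add: plane_wave_def integral_scale sc.scaleR_right)
qed

lemma slice_pt_nonzero: "fst x \<noteq> 0 \<Longrightarrow> slice_pt w x \<noteq> 0"
  by (simp add: slice_pt_def complex_eq_iff)

lemma continuous_powi_slice:
  assumes "k \<ge> 0 \<or> fst x \<noteq> 0"
  shows "continuous_on ((\<lambda>w. slice_pt w x) ` A) (\<lambda>z. z powi k *s c :: complex ^ 'i::finite)"
  using assms by (intro sc.continuous_on continuous_intros holomorphic_on_imp_continuous_on powi_holomorphic)
    (auto simp: slice_pt_nonzero dest: sym[of 0])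

lemma plane_wave_scale_powi:
  assumes "k \<ge> 0 \<or> fst x \<noteq> 0"
  shows "plane_wave (\<lambda>z. c *s (z powi k *s cl_one)) x = c *s power_wave k x"
  unfolding power_wave_def by (rule plane_wave_scale[OF continuous_powi_slice[OF assms]])

section \<open>Plane wave decomposition of the Cauchy kernel\<close>

text \<open>
  The identity theorem, in the form in which real information is transported to complex points.
\<close>

lemma holomorphic_zero_on_real_interval:
  assumes "f holomorphic_on S" "open S" "connected S" and pq: "p < q"
    and sub: "\<And>u. p < u \<Longrightarrow> u < q \<Longrightarrow> complex_of_real u \<in> S"
    and zero: "\<And>u. p < u \<Longrightarrow> u < q \<Longrightarrow> f (of_real u) = 0" and "w \<in> S"
  shows "f w = 0"
proof -
  define x where "x = (p + q) / 2"
  have x: "p < x" "x < q" using pq by (simp_all add: x_def)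
  have "of_real x islimpt complex_of_real ` {p<..<q}"
    unfolding islimpt_approachable
  proof (intro allI impI)
    fix e :: real assume "e > 0"
    then obtain y where y: "x < y" "y < min q (x + e)" using dense[of x "min q (x + e)"] x by auto
    have "of_real y \<in> complex_of_real ` {p<..<q}" using x y by auto
    moreover have "complex_of_real y \<noteq> of_real x" using y by simp
    moreover have "dist (complex_of_real y) (of_real x) < e" unfolding dist_of_real using y by (simp add: dist_real_def)
    ultimately show "\<exists>z\<in>complex_of_real ` {p<..<q}. z \<noteq> of_real x \<and> dist z (of_real x) < e" by blast
  qed
  moreover have "complex_of_real ` {p<..<q} \<subseteq> S" using sub by auto
  ultimately show ?thesis
    by (intro analytic_continuation[OF assms(1-3) _ sub[OF x] _ _ \<open>w \<in> S\<close>]) (use zero in auto)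
qed

text \<open>
  Both sequences satisfy two term recursions. This identifies the extension of
  \<open>t\<^bsup>-m\<^esup>\<close> with a binomial series of exponent \<open>- (m + 1)/2\<close>.
\<close>

lemma gck_gbinomial_even:
  assumes "m > 0"
  shows "gck_coeff m (2 * i) * (fact (2 * i) * (- real m gchoose (2 * i))) = (- 1) ^ i * (- (real m + 1) / 2 gchoose i)"
  and "gck_coeff m (2 * i + 1) * (fact (2 * i + 1) * (- real m gchoose (2 * i + 1))) = - ((- 1) ^ i * (- (real m + 1) / 2 gchoose i))"
proof -
  define q where "q = (\<lambda>n. gck_coeff m n * (fact n * (- real m gchoose n)))"
  have q_Suc: "q (Suc n) = - (q n * (real m + real n) / (if even n then real m + real n else real n + 1))" for n
  proof -
    have "q (Suc n) = q n * (- (real m + real n)) / (if even n then real m + real n else real n + 1)"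
      unfolding q_def fact_gbinomial_Suc by simp
    thus ?thesis by (simp only: mult_minus_right minus_divide_left)
  qed
  have odd: "q (2 * i + 1) = - q (2 * i)" for i
    using q_Suc[of "2 * i"] assms by simp
  have "q (2 * i) = (- 1) ^ i * (- (real m + 1) / 2 gchoose i)" for i
  proof (induction i)
    case (Suc i)
    define c where "c = (- (real m + 1) / 2 gchoose i)"
    have "q (2 * Suc i) = q (2 * i) * (real m + real (2 * i + 1)) / (real (2 * i + 1) + 1)"
      using q_Suc[of "2 * i + 1"] odd[of i] by simp
    also have "\<dots> = (- 1) ^ Suc i * (c * ((- (real m + 1) / 2 - real i) / real (Suc i)))"
      unfolding Suc c_def[symmetric] by (simp add: divide_simps) (simp add: algebra_simps)
    also have "c * ((- (real m + 1) / 2 - real i) / real (Suc i)) = (- (real m + 1) / 2 gchoose Suc i)"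
    proof -
      have "fact (Suc i) * (- (real m + 1) / 2 gchoose Suc i) = fact (Suc i) * (c * ((- (real m + 1) / 2 - real i) / real (Suc i)))"
        unfolding fact_gbinomial_Suc c_def by simp
      thus ?thesis by (metis fact_nonzero mult_left_cancel)
    qed
    finally show ?case .
  qed (simp add: q_def)
  with odd show "gck_coeff m (2 * i) * (fact (2 * i) * (- real m gchoose (2 * i))) = (- 1) ^ i * (- (real m + 1) / 2 gchoose i)"
    "gck_coeff m (2 * i + 1) * (fact (2 * i + 1) * (- real m gchoose (2 * i + 1))) = - ((- 1) ^ i * (- (real m + 1) / 2 gchoose i))"
    unfolding q_def by auto
qed

lemma norm_paravector: "(norm x)\<^sup>2 = (fst x)\<^sup>2 + (norm (snd x))\<^sup>2"
  by (simp add: norm_prod_def)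

lemma cauchy_kernel_eq: "cauchy_kernel x =
   (complex_of_real (fst x) *s cl_one - cl_vec (snd x)) /\<^sub>R norm x ^ (CARD('n) + 1)"
  for x :: "'n::{finite,linorder} paravector"
  by (simp add: cauchy_kernel_def cl_pv_def pv_cnj_def cl_vec_minus)

text \<open>
  Even and odd terms of the series of the plane wave combine to \<open>t\<^bsup>-m\<^esup> (1 -
  v/t)\<close> times the binomial series of \<open>(1 +
  |v|\<^sup>2/t\<^sup>2)\<^bsup>-(m+1)/2\<^esup>\<close>.
\<close>

lemma cauchy_kernel_near_axis:
  fixes v :: "real ^ 'n::{finite,linorder}"
  assumes t: "t > 0" and v: "norm v < t"
  shows "cauchy_kernel (t, v) = power_wave (- int CARD('n)) (t, v)"
proof -
  let ?m = "CARD('n)"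
  let ?G = "\<lambda>z :: complex. z powi (- int ?m) *s (cl_one :: 'n clifford)"
  define a where "a = - (real ?m + 1) / 2"
  define \<rho> where "\<rho> = (norm v / t)\<^sup>2"
  have hol: "vholomorphic_on ?G (ball (of_real t) t)"
    by (intro vholomorphic_scale powi_holomorphic) (use t in auto)
  define T where "T = (\<lambda>n. gck_coeff ?m n *\<^sub>R (cl_pow (cl_vec v) n \<star> vderivs n ?G (of_real t)))"
  have T: "T n = (gck_coeff ?m n * (fact n * (- real ?m gchoose n)) * t powi (- int ?m - int n)) *\<^sub>R cl_pow (cl_vec v) n" for n
  proof -
    have "vderivs n ?G (of_real t) = complex_of_real (fact n * (- real ?m gchoose n) * t powi (- int ?m - int n)) *s cl_one"
      using t by (subst vderivs_powi) (auto simp: of_real_gbinomial)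
    thus ?thesis unfolding T_def
      by (simp add: cl_one_right scaleR_eq_scale mult.assoc)
  qed
  have "T sums power_wave (- int ?m) (t, v)"
    unfolding T_def power_wave_def by (rule has_sum_imp_sums[OF plane_wave_has_sum[OF hol v]])
  from sums_group[OF this, of 2]
  have "(\<lambda>i. T (2 * i) + T (2 * i + 1)) sums power_wave (- int ?m) (t, v)"
    by (simp add: numeral_2_eq_2 mult.commute)
  moreover have "T (2 * i) + T (2 * i + 1) = ((a gchoose i) * \<rho> ^ i) *\<^sub>R (t powi (- int ?m) *\<^sub>R (cl_one - (1 / t) *\<^sub>R cl_vec v))" for i
  proof -
    have p: "t powi (- int ?m - int (2 * i)) = t powi (- int ?m) / t ^ (2 * i)"
       "t powi (- int ?m - int (2 * i + 1)) = t powi (- int ?m) / t ^ (2 * i) / t"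
    proof -
      have *: "t powi (- int ?m - int k) = t powi (- int ?m) / t ^ k" for k
        using t by (subst power_int_diff) auto
      show "t powi (- int ?m - int (2 * i)) = t powi (- int ?m) / t ^ (2 * i)" by (rule *)
      show "t powi (- int ?m - int (2 * i + 1)) = t powi (- int ?m) / t ^ (2 * i) / t" unfolding * by simp
    qed
    have r: "\<rho> ^ i = norm v ^ (2 * i) / t ^ (2 * i)" by (simp add: \<rho>_def power_divide power_mult)
    have "T (2 * i) = ((a gchoose i) * \<rho> ^ i * t powi (- int ?m)) *\<^sub>R cl_one"
      unfolding T p gck_gbinomial_even(1)[OF zero_less_card_finite] cl_pow_vec_even a_def r
      by (simp add: scaleR_eq_scale)
    moreover have "T (2 * i + 1) = - ((a gchoose i) * \<rho> ^ i * t powi (- int ?m) * (1 / t)) *\<^sub>R cl_vec v"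
      unfolding T p gck_gbinomial_even(2)[OF zero_less_card_finite] cl_pow_vec_odd a_def r
      by (simp add: scaleR_eq_scale)
    ultimately show ?thesis by (simp add: scaleR_right_diff_distrib)
  qed
  ultimately have "(\<lambda>i. ((a gchoose i) * \<rho> ^ i) *\<^sub>R (t powi (- int ?m) *\<^sub>R (cl_one - (1 / t) *\<^sub>R cl_vec v))) sums power_wave (- int ?m) (t, v)"
    by simp
  moreover have "\<bar>\<rho>\<bar> < 1" unfolding \<rho>_def using t v by (simp add: power_less_one_iff abs_square_less_1)
  hence "(\<lambda>i. ((a gchoose i) * \<rho> ^ i) *\<^sub>R (t powi (- int ?m) *\<^sub>R (cl_one - (1 / t) *\<^sub>R cl_vec v))) sums
     ((1 + \<rho>) powr a *\<^sub>R (t powi (- int ?m) *\<^sub>R (cl_one - (1 / t) *\<^sub>R cl_vec v)))"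
    by (intro bounded_linear.sums[OF bounded_linear_scaleR_left] gen_binomial_real)
  ultimately have "power_wave (- int ?m) (t, v) = (1 + \<rho>) powr a *\<^sub>R (t powi (- int ?m) *\<^sub>R (cl_one - (1 / t) *\<^sub>R (cl_vec v :: 'n clifford)))"
    by (rule sums_unique2)
  also have "\<dots> = cauchy_kernel (t, v)"
  proof -
    have n2: "(norm (t, v))\<^sup>2 = t\<^sup>2 * (1 + \<rho>)" using t by (simp add: norm_paravector \<rho>_def field_simps)
    have pos: "1 + \<rho> > 0" by (simp add: \<rho>_def add_pos_nonneg)
    have "norm (t, v) = t * sqrt (1 + \<rho>)"
    proof (rule power2_eq_imp_eq)
      show "(norm (t, v))\<^sup>2 = (t * sqrt (1 + \<rho>))\<^sup>2"
        unfolding n2 power_mult_distrib using pos by simp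
      show "0 \<le> t * sqrt (1 + \<rho>)" using t pos by simp
    qed simp
    hence "norm (t, v) ^ (?m + 1) = t ^ (?m + 1) * sqrt (1 + \<rho>) ^ (?m + 1)" by (simp only: power_mult_distrib)
    also have "sqrt (1 + \<rho>) ^ (?m + 1) = (1 + \<rho>) powr (- a)"
    proof -
      have "sqrt (1 + \<rho>) ^ (?m + 1) = ((1 + \<rho>) powr (1 / 2)) powr real (?m + 1)"
        using pos by (simp only: powr_half_sqrt less_imp_le powr_realpow real_sqrt_gt_zero)
      moreover have "1 / 2 * real (?m + 1) = - a" by (simp add: a_def field_simps)
      ultimately show ?thesis unfolding powr_powr by simp
    qed
    finally have "inverse (norm (t, v) ^ (?m + 1)) = (1 + \<rho>) powr a * (t powi (- int ?m) / t)"
      using t by (simp add: powr_minus power_int_minus field_simps)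
    moreover have "complex_of_real t *s cl_one - (cl_vec v :: 'n clifford) = t *\<^sub>R (cl_one - (1 / t) *\<^sub>R cl_vec v)"
      using t by (simp add: scaleR_right_diff_distrib scaleR_eq_scale[symmetric])
    ultimately show ?thesis using t unfolding cauchy_kernel_eq by simp
  qed
  finally show ?thesis by simp
qed

text \<open>
  At the real point \<open>1\<close> the derivatives of \<open>z\<^bsup>-m\<^esup>\<close> are constants, so the expansion in \<open>s\<close> generates the
  plane waves of the nonnegative powers.
\<close>

lemma power_wave_expansion_at_one:
  fixes x :: "'n::{finite,linorder} paravector"
  assumes "\<bar>s\<bar> * norm x < 1"
  shows "(\<lambda>n. s ^ n *\<^sub>R (((- 1) ^ n * (- real m gchoose n)) *\<^sub>R power_wave (int n) x)) sums power_wave (- int m) ((1, 0) - s *\<^sub>R x)"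
proof -
  define \<delta> where "\<delta> = (\<bar>s\<bar> * norm x + 1) / 2"
  have \<delta>: "\<bar>s\<bar> * norm x < \<delta>" "\<delta> < 1" "\<delta> > 0"
    using assms by (auto simp: \<delta>_def add_nonneg_pos)
  let ?G = "\<lambda>z :: complex. z powi (- int m) *s (cl_one :: 'n clifford)"
  interpret wave_expansion ?G "ball 1 1" "(1, 0) :: 'n paravector" \<delta>
  proof
    show "vholomorphic_on ?G (ball 1 1)"
      by (intro vholomorphic_scale powi_holomorphic) auto
    fix t assume "\<bar>t\<bar> \<le> norm (snd (1 :: real, 0 :: (real, 'n) vec))"
    hence "Complex (fst (1 :: real, 0 :: (real, 'n) vec)) t = 1" by (simp add: complex_eq_iff)
    thus "cball (Complex (fst (1 :: real, 0 :: (real, 'n) vec)) t) \<delta> \<subseteq> ball 1 1" using \<delta> by auto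
  qed (use \<delta> in auto)
  have sp1: "slice_pt w (1, 0 :: (real, 'n) vec) = 1" for w by (simp add: slice_pt_def complex_eq_iff)
  have "(\<lambda>n. coef n (\<lambda>w. slice_pt w ((- s) *\<^sub>R x) ^ n)) sums plane_wave ?G ((1, 0) + (- s) *\<^sub>R x)"
    using \<delta> by (intro has_sum_imp_sums expansion) simp
  moreover have "coef n (\<lambda>w. slice_pt w ((- s) *\<^sub>R x) ^ n) = s ^ n *\<^sub>R (((- 1) ^ n * (- real m gchoose n)) *\<^sub>R power_wave (int n) x)" for n
  proof -
    have "coef n (\<lambda>w. slice_pt w x ^ n) = (LINT w|sphere_measure. (- real m gchoose n) *\<^sub>R (wave_kernel w \<star> (slice_pt w x ^ n *s cl_one))) /\<^sub>R sphere_area CARD('n)"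
      unfolding coef_def sp1
      by (intro arg_cong[of _ _ "\<lambda>y. y /\<^sub>R _"] Bochner_Integration.integral_cong refl)
         (simp add: vderivs_powi scaleR_eq_scale of_real_gbinomial mult.commute)
    also have "\<dots> = (- real m gchoose n) *\<^sub>R power_wave (int n) x"
      by (simp add: power_wave_def plane_wave_def)
    finally show ?thesis
      unfolding slice_pt_scaleR power_mult_distrib of_real_power[symmetric]
      by (subst coef_cmult) (auto intro!: continuous_intros simp: power_minus[of s])
  qed
  ultimately show ?thesis unfolding power_wave_def by simp
qed

lemma powr_mult_cnj:
  assumes "Re z > 0"
  shows "z powr of_real a * cnj z powr of_real a = of_real (cmod z powr (2 * a))"
proof -
  have "cnj z powr of_real a = cnj (z powr of_real a)"
    using assms by (subst cnj_powr) auto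
  hence "z powr of_real a * cnj z powr of_real a = of_real ((cmod (z powr of_real a))\<^sup>2)"
    by (simp add: complex_norm_square[symmetric])
  also have "(cmod (z powr of_real a))\<^sup>2 = cmod z powr (2 * a)"
  proof -
    have "cmod (z powr of_real a) = cmod z powr a" by (subst norm_powr_real_powr') auto
    thus ?thesis by (simp only: power2_eq_square powr_add[symmetric] mult_2)
  qed
  finally show ?thesis .
qed

text \<open>
  Near \<open>t = 0\<close> both sides are known to agree at \<open>1 - t x\<close>. They extend
  holomorphically to complex \<open>t\<close> with \<open>|t| |x| < 1\<close>: the plane wave by its
  power series, and the kernel because \<open>|1 - t x|\<^sup>2 = (1 - t \<zeta>)(1 - t
  \<zeta>\<^sup>-)\<close> for \<open>x = x\<^sub>0 + v\<close> and \<open>\<zeta> = x\<^sub>0 + i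
  |v|\<close>, where both factors have positive real part.
\<close>

lemma cauchy_kernel_at_one:
  fixes x :: "'n::{finite,linorder} paravector"
  assumes x: "norm x < 1"
  shows "cauchy_kernel ((1, 0) - x) = power_wave (- int CARD('n)) ((1, 0) - x)"
proof (cases "x = 0")
  case True
  thus ?thesis using cauchy_kernel_near_axis[of 1 "0 :: (real, 'n) vec"] by simp
next
  case False
  let ?m = "CARD('n)"
  let ?R = "1 / norm x"
  have R: "?R > 0" using False by simp
  define x0 where "x0 = fst x"
  define v where "v = snd x"
  define \<zeta> where "\<zeta> = Complex x0 (norm v)"
  have n\<zeta>: "cmod \<zeta> = norm x"
    by (simp add: \<zeta>_def cmod_def norm_prod_def x0_def v_def)
  define a where "a = - (real ?m + 1) / 2"
  define c where "c = (\<lambda>n. ((- 1) ^ n * (- real ?m gchoose n)) *\<^sub>R (power_wave (int n) x :: 'n clifford))"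
  have ser: "(\<lambda>n. s ^ n *\<^sub>R c n) sums power_wave (- int ?m) ((1, 0) - s *\<^sub>R x)" if "\<bar>s\<bar> < ?R" for s
    unfolding c_def by (rule power_wave_expansion_at_one) (use that False in \<open>simp add: field_simps\<close>)
  define \<psi> where "\<psi> = (\<lambda>s :: complex. ((1 - s * \<zeta>) powr of_real a * (1 - s * cnj \<zeta>) powr of_real a) *s
     ((1 - s * of_real x0) *s cl_one + s *s cl_vec v :: 'n clifford))"
  have Re_pos: "Re (1 - s * y) > 0" if "cmod s < ?R" "cmod y = norm x" for s y
  proof -
    have "cmod (s * y) < 1" using that False by (simp add: norm_mult field_simps)
    hence "Re (s * y) < 1" using complex_Re_le_cmod[of "s * y"] by linarith
    thus ?thesis by simp
  qed
  have \<psi>_real: "\<psi> (of_real s) = cauchy_kernel ((1, 0) - s *\<^sub>R x)" if s: "\<bar>s\<bar> < ?R" for s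
  proof -
    have cn: "1 - complex_of_real s * cnj \<zeta> = cnj (1 - of_real s * \<zeta>)" by simp
    have nrm: "norm ((1, 0) - s *\<^sub>R x) = cmod (1 - of_real s * \<zeta>)"
      by (simp add: norm_prod_def cmod_def \<zeta>_def x0_def v_def power_mult_distrib)
    have pos: "norm ((1, 0) - s *\<^sub>R x) > 0"
      unfolding nrm using Re_pos[of "of_real s" \<zeta>] s n\<zeta> by (metis norm_of_real norm_eq_zero order_less_irrefl zero_complex.simps(1) zero_less_norm_iff)
    have "(1 - complex_of_real s * \<zeta>) powr of_real a * (1 - of_real s * cnj \<zeta>) powr of_real a = of_real (norm ((1, 0) - s *\<^sub>R x) powr (2 * a))"
      unfolding cn nrm by (rule powr_mult_cnj) (use Re_pos[of "of_real s" \<zeta>] s n\<zeta> in auto)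
    also have "norm ((1, 0) - s *\<^sub>R x) powr (2 * a) = inverse (norm ((1, 0) - s *\<^sub>R x) ^ (?m + 1))"
    proof -
      have "2 * a = - real (?m + 1)" by (simp add: a_def)
      thus ?thesis using pos by (simp only: powr_minus powr_realpow)
    qed
    finally have "\<psi> (of_real s) = inverse (norm ((1, 0) - s *\<^sub>R x) ^ (?m + 1)) *\<^sub>R ((1 - of_real s * of_real x0) *s cl_one + of_real s *s cl_vec v)"
      unfolding \<psi>_def scaleR_eq_scale by (simp only:)
    also have "\<dots> = cauchy_kernel ((1, 0) - s *\<^sub>R x)"
      unfolding cauchy_kernel_eq by (simp add: x0_def v_def cl_vec_minus cl_vec_scaleR scaleR_eq_scale[symmetric])
    finally show ?thesis .
  qed
  have "\<psi> 1 $ A = power_wave (- int ?m) ((1, 0) - x) $ A" for A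
  proof -
    define \<phi> where "\<phi> = (\<lambda>s :: complex. \<Sum>n. c n $ A * s ^ n)"
    have serA: "(\<lambda>n. c n $ A * of_real s ^ n) sums (power_wave (- int ?m) ((1, 0) - s *\<^sub>R x) $ A)" if "\<bar>s\<bar> < ?R" for s
      using bounded_linear.sums[OF bounded_linear_vec_nth ser[OF that], of A] by (simp add: scaleR_conv_of_real[where 'a = complex] mult.commute)
    have \<phi>_real: "\<phi> (of_real s) = power_wave (- int ?m) ((1, 0) - s *\<^sub>R x) $ A" if "\<bar>s\<bar> < ?R" for s
      unfolding \<phi>_def by (rule sums_unique[OF serA[OF that], symmetric])
    have "\<phi> holomorphic_on ball 0 ?R"
    proof (rule power_series_holomorphic)
      fix s :: complex assume "s \<in> ball 0 ?R"
      then obtain s' where s': "cmod s < s'" "s' < ?R" using dense by auto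
      have "summable (\<lambda>n. c n $ A * of_real s' ^ n)"
        using serA[of s'] s' norm_ge_zero[of s] by (auto simp: sums_iff simp del: norm_ge_zero)
      hence "summable (\<lambda>n. c n $ A * s ^ n)"
        by (rule powser_inside[of _ "of_real s'"]) (use s' in auto)
      thus "(\<lambda>n. c n $ A * (s - 0) ^ n) sums \<phi> s" by (simp add: \<phi>_def summable_sums)
    qed
    moreover have "(\<lambda>s. \<psi> s $ A) holomorphic_on ball 0 ?R"
    proof -
      have "1 - z * y \<notin> \<real>\<^sub>\<le>\<^sub>0" if "cmod z < ?R" "cmod y = norm x" for z y
        using Re_pos[OF that] by (auto simp: complex_nonpos_Reals_iff)
      thus ?thesis unfolding \<psi>_def
        by (auto intro!: holomorphic_intros simp: n\<zeta> simp del: one_complex.simps)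
    qed
    ultimately have hol: "(\<lambda>s. \<psi> s $ A - \<phi> s) holomorphic_on ball 0 ?R" by (intro holomorphic_intros)
    have "\<psi> 1 $ A - \<phi> 1 = 0"
    proof (rule holomorphic_zero_on_real_interval[OF hol open_ball connected_ball])
      show "0 < ?R / 2" using R by simp
      show "1 \<in> ball (0 :: complex) ?R" using x False by (simp add: field_simps)
      fix r assume r: "0 < r" "r < ?R / 2"
      define y where "y = (1, 0) - r *\<^sub>R x"
      have rx: "2 * (r * norm x) < 1" using r False by (simp add: field_simps)
      have "\<bar>fst x\<bar> \<le> norm x" "norm (snd x) \<le> norm x"
        using norm_fst_le[of "fst x" "snd x"] norm_snd_le[of "snd x" "fst x"] by simp_all
      hence "r * fst x \<le> r * norm x" "r * norm (snd x) \<le> r * norm x" using r(1) by (auto intro!: mult_left_mono)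
      moreover have "fst y = 1 - r * fst x" "norm (snd y) = r * norm (snd x)" using r(1) by (simp_all add: y_def)
      ultimately have "fst y > 0" "norm (snd y) < fst y" using rx by linarith+
      from cauchy_kernel_near_axis[OF this] have "cauchy_kernel y = power_wave (- int ?m) y" by simp
      moreover have "\<bar>r\<bar> < ?R" using r R by (simp add: field_simps)
      ultimately show "\<psi> (of_real r) $ A - \<phi> (of_real r) = 0" "complex_of_real r \<in> ball 0 ?R"
        using \<psi>_real[of r] \<phi>_real[of r] by (simp_all add: y_def)
    qed
    thus ?thesis using \<phi>_real[of 1] x False by simp
  qed
  hence "\<psi> 1 = power_wave (- int ?m) ((1, 0) - x)" by (simp add: vec_eq_iff)
  thus ?thesis using \<psi>_real[of 1] x False by simp
qed

text \<open>
  Both sides are homogeneous of degree \<open>- m\<close>, and every point of the half space lies in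
  a ball around a point \<open>T > 0\<close> of the real axis with radius \<open>T\<close>: take
  \<open>T = |u|\<^sup>2 / u\<^sub>0\<close>.
\<close>

lemma cauchy_kernel_plane_wave_pos:
  fixes u :: "'n::{finite,linorder} paravector"
  assumes u: "fst u > 0"
  shows "cauchy_kernel u = power_wave (- int CARD('n)) u"
proof -
  let ?m = "CARD('n)"
  define T where "T = (norm u)\<^sup>2 / fst u"
  have "u \<noteq> 0" using u by auto
  have T: "T > 0" using u \<open>u \<noteq> 0\<close> by (simp add: T_def)
  define x where "x = (1, 0) - (1 / T) *\<^sub>R u"
  have "(norm x)\<^sup>2 = 1 - 2 * fst u / T + (norm u)\<^sup>2 / T\<^sup>2"
  proof -
    have "fst x = 1 - fst u / T" "norm (snd x) = norm (snd u) / T" using T by (simp_all add: x_def)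
    thus ?thesis
      by (simp add: norm_paravector power2_diff power_divide add_divide_distrib)
  qed
  also have "(norm u)\<^sup>2 / T\<^sup>2 = fst u / T" using u \<open>u \<noteq> 0\<close> by (simp add: T_def power2_eq_square)
  also have "1 - 2 * fst u / T + fst u / T < 1" using u T by simp
  finally have "norm x < 1" by (simp add: abs_square_less_1)
  from cauchy_kernel_at_one[OF this]
  have 1: "cauchy_kernel ((1 / T) *\<^sub>R u) = power_wave (- int ?m) ((1 / T) *\<^sub>R u)"
    by (simp add: x_def)
  have "cauchy_kernel ((1 / T) *\<^sub>R u) = T ^ ?m *\<^sub>R cauchy_kernel u"
  proof -
    define Y where "Y = (complex_of_real (fst u) *s cl_one - cl_vec (snd u) :: 'n clifford)"
    have "complex_of_real (fst ((1 / T) *\<^sub>R u)) *s cl_one - cl_vec (snd ((1 / T) *\<^sub>R u)) = (1 / T) *\<^sub>R Y"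
      unfolding Y_def scaleR_eq_scale[symmetric] by (simp add: cl_vec_scaleR scaleR_right_diff_distrib)
    moreover have "norm ((1 / T) *\<^sub>R u) = norm u / T" using T by simp
    ultimately show ?thesis unfolding cauchy_kernel_eq Y_def[symmetric] using T by (simp add: power_divide) (simp add: divide_inverse)
  qed
  moreover have "power_wave (- int ?m) ((1 / T) *\<^sub>R u) = T ^ ?m *\<^sub>R power_wave (- int ?m) u"
  proof -
    have "power_wave (- int ?m) ((1 / T) *\<^sub>R u) = plane_wave (\<lambda>z. complex_of_real (T ^ ?m) *s (z powi (- int ?m) *s cl_one)) u"
      unfolding power_wave_def plane_wave_def slice_pt_scaleR using T
      by (simp add: power_int_mult_distrib power_int_minus power_divide) (simp add: divide_inverse)
    also have "\<dots> = complex_of_real (T ^ ?m) *s power_wave (- int ?m) u"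
      by (rule plane_wave_scale_powi) (use u in simp)
    finally show ?thesis by (simp only: scaleR_eq_scale)
  qed
  ultimately show ?thesis using 1 T by simp
qed

lemma cauchy_kernel_plane_wave:
  fixes u :: "'n::{finite,linorder} paravector"
  assumes u: "fst u \<noteq> 0"
  shows "cauchy_kernel u = sgn (fst u) ^ (CARD('n) - 1) *\<^sub>R power_wave (- int CARD('n)) u"
proof (cases "fst u > 0")
  case True
  thus ?thesis by (simp add: cauchy_kernel_plane_wave_pos)
next
  case False
  let ?m = "CARD('n)"
  have "cauchy_kernel u = - cauchy_kernel (- u)"
    unfolding cauchy_kernel_eq by (simp add: cl_vec_minus scaleR_right_diff_distrib)
  also have "cauchy_kernel (- u) = power_wave (- int ?m) (- u)"
    using False u by (intro cauchy_kernel_plane_wave_pos) simp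
  also have "power_wave (- int ?m) (- u) = plane_wave (\<lambda>z. (- 1) ^ ?m *s (z powi (- int ?m) *s cl_one)) u"
  proof -
    have "slice_pt w (- u) = - slice_pt w u" for w by (simp add: slice_pt_def complex_eq_iff)
    moreover have "(- z) powi (- int ?m) = (- 1) ^ ?m * z powi (- int ?m)" for z :: complex
      by (simp add: power_int_minus power_minus[of z] flip: power_inverse)
    ultimately show ?thesis by (simp add: power_wave_def plane_wave_def)
  qed
  also have "\<dots> = (- 1) ^ ?m *s power_wave (- int ?m) u"
    using u by (intro plane_wave_scale_powi) simp
  also have "- \<dots> = sgn (fst u) ^ (?m - 1) *\<^sub>R power_wave (- int ?m) u"
  proof -
    obtain k where "?m = Suc k" using zero_less_card_finite[where 'a = 'n] gr0_conv_Suc by blast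
    thus ?thesis using False u by (simp add: scaleR_eq_scale vec_eq_iff)
  qed
  finally show ?thesis .
qed

section \<open>The Fueter-Sce-Qian mapping on powers\<close>

lemma partial0_iterate: "(partial0 ^^ n) F x = (vderiv ^^ n) (\<lambda>t. F (t, snd x)) (fst x)"
proof (induction n arbitrary: x)
  case (Suc n)
  have "(partial0 ^^ Suc n) F x = vderiv (\<lambda>t. (partial0 ^^ n) F (t, snd x)) (fst x)"
    by (simp add: partial0_def vderiv_def)
  thus ?case by (simp add: Suc)
qed simp

lemma higher_vderiv_shift: "(vderiv ^^ n) (\<lambda>s. f (a + s)) s = (vderiv ^^ n) f (a + s)"
proof (induction n arbitrary: s)
  case (Suc n)
  have iff: "((\<lambda>s. g (a + s)) has_vector_derivative D) (at s) \<longleftrightarrow> (g has_vector_derivative D) (at (a + s))" for g :: "real \<Rightarrow> 'a" and D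
  proof
    have sh: "((\<lambda>x. c + x) has_vector_derivative 1) (at y)" for c y :: real
      by (auto intro!: derivative_eq_intros simp: has_real_derivative_iff_has_vector_derivative[symmetric])
    show "((\<lambda>s. g (a + s)) has_vector_derivative D) (at s)" if "(g has_vector_derivative D) (at (a + s))"
      using vector_diff_chain_at[OF sh[of a s], of g D] that by (simp add: o_def)
    show "(g has_vector_derivative D) (at (a + s))" if "((\<lambda>s. g (a + s)) has_vector_derivative D) (at s)"
      using vector_diff_chain_at[OF sh[of "- a" "a + s"], of "\<lambda>s. g (a + s)" D] that by (simp add: o_def)
  qed
  have "(vderiv ^^ n) (\<lambda>s. f (a + s)) = (\<lambda>s. (vderiv ^^ n) f (a + s))"
    using Suc by (rule ext)
  hence "(vderiv ^^ Suc n) (\<lambda>s. f (a + s)) s = vderiv (\<lambda>s. (vderiv ^^ n) f (a + s)) s"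
    by simp
  also have "\<dots> = (vderiv ^^ Suc n) f (a + s)"
    by (simp add: vderiv_def vector_derivative_def iff)
  finally show ?case .
qed simp

text \<open>
  Derivatives of the kernel along the real axis are derivatives of
  \<open>z\<^bsup>-m\<^esup>\<close> inside the plane wave.
\<close>

lemma fueter_P_neg_eq:
  fixes u :: "'n::{finite,linorder} paravector"
  assumes u: "fst u \<noteq> 0"
  shows "fueter_P_neg (Suc n) u = (fueter_lambda CARD('n) * sgn (fst u) ^ (CARD('n) - 1) * ((- 1) ^ n * (- real CARD('n) gchoose n))) *\<^sub>R
     power_wave (- int CARD('n) - int n) u"
proof -
  let ?m = "CARD('n)"
  let ?G = "\<lambda>z :: complex. z powi (- int ?m) *s (cl_one :: 'n clifford)"
  define \<delta> where "\<delta> = \<bar>fst u\<bar> / 2"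
  have \<delta>: "\<delta> > 0" "\<delta> < \<bar>fst u\<bar>" using u by (auto simp: \<delta>_def)
  interpret wave_expansion ?G "- {0}" u \<delta>
  proof
    show "vholomorphic_on ?G (- {0})" by (intro vholomorphic_scale powi_holomorphic) auto
    fix s
    have "\<bar>fst u\<bar> \<le> cmod (Complex (fst u) s)" using abs_Re_le_cmod[of "Complex (fst u) s"] by simp
    hence "0 \<notin> cball (Complex (fst u) s) \<delta>" using \<delta> by (simp add: dist_norm)
    thus "cball (Complex (fst u) s) \<delta> \<subseteq> - {0}" by auto
  qed (use \<delta> in auto)
  let ?c = "sgn (fst u) ^ (?m - 1)"
  have "(\<lambda>n. s ^ n *\<^sub>R (?c *\<^sub>R (plane_wave (vderivs n ?G) u /\<^sub>R fact n))) sums cauchy_kernel (fst u + s, snd u)" if s: "\<bar>s\<bar> < \<delta>" for s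
  proof -
    have "fst u + s \<noteq> 0" "sgn (fst u + s) = sgn (fst u)" using s \<delta> by (auto simp: sgn_if)
    hence "cauchy_kernel (fst u + s, snd u) = ?c *\<^sub>R plane_wave ?G (fst u + s, snd u)"
      using cauchy_kernel_plane_wave[of "(fst u + s, snd u)"] by (simp add: power_wave_def)
    moreover have "(\<lambda>n. ?c *\<^sub>R (s ^ n *\<^sub>R (plane_wave (vderivs n ?G) u /\<^sub>R fact n))) sums (?c *\<^sub>R plane_wave ?G (fst u + s, snd u))"
      by (intro sums_scaleR_right axis_expansion s)
    ultimately show ?thesis by (simp add: mult_ac)
  qed
  from higher_vderiv_powser[OF this \<delta>(1), of n]
  have "(partial0 ^^ n) cauchy_kernel u = ?c *\<^sub>R plane_wave (vderivs n ?G) u"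
    unfolding partial0_iterate using higher_vderiv_shift[of n "\<lambda>t. cauchy_kernel (t, snd u)" "fst u" 0] by simp
  also have "plane_wave (vderivs n ?G) u = plane_wave (\<lambda>z. (fact n * (- of_nat ?m gchoose n)) *s (z powi (- int ?m - int n) *s cl_one)) u"
    by (rule plane_wave_cong) (simp add: vderivs_powi slice_pt_nonzero[OF u])
  also have "\<dots> = (fact n * (- of_nat ?m gchoose n)) *s power_wave (- int ?m - int n) u"
    using u by (intro plane_wave_scale_powi) simp
  also have "(fact n * (- of_nat ?m gchoose n) :: complex) = complex_of_real (fact n * (- real ?m gchoose n))"
    by (simp add: of_real_gbinomial)
  finally show ?thesis
    unfolding fueter_P_neg_def scaleR_eq_scale[symmetric] by (simp add: mult_ac)
qed

text \<open>
  All factors lie in the commutative plane spanned by \<open>1\<close> and the vector part of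
  \<open>u\<close>, and \<open>1/u - s = (1/u)(1 - s u)\<close>. So \<open>E(1/u - s)\<close> is
  \<open>E(u)\<^sup>-\<^sup>1 E(1 - s u)\<close>, where \<open>E(u)\<^sup>-\<^sup>1 =
  |u|\<^bsup>m-1\<^esup> u\<close>.
\<close>

lemma cauchy_kernel_kelvin:
  fixes u :: "'n::{finite,linorder} paravector"
  assumes u: "u \<noteq> 0" and s: "\<bar>s\<bar> * norm u < 1"
  shows "cauchy_kernel (fst (pv_inverse u) + (- s), snd (pv_inverse u)) = norm u ^ (CARD('n) - 1) *\<^sub>R (cl_pv u \<star> cauchy_kernel ((1, 0) - s *\<^sub>R u))"
  and "cauchy_kernel u \<star> (norm u ^ (CARD('n) - 1) *\<^sub>R (cl_pv u \<star> y)) = y"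
proof -
  let ?m = "CARD('n)"
  define N where "N = norm u"
  have N: "N > 0" using u by (simp add: N_def)
  obtain k where k: "?m = Suc k" using zero_less_card_finite[where 'a = 'n] gr0_conv_Suc by blast
  define V where "V = (cl_vec (snd u) :: 'n clifford)"
  have n2: "N\<^sup>2 = (fst u)\<^sup>2 + (norm (snd u))\<^sup>2" unfolding N_def by (rule norm_paravector)
  have VV: "V \<star> V = (- (norm (snd u))\<^sup>2) *\<^sub>R cl_one" unfolding V_def cl_vec_square scaleR_eq_scale ..
  have pvu: "cl_pv u = fst u *\<^sub>R cl_one + V" by (simp add: cl_pv_def V_def scaleR_eq_scale)
  have ker: "cauchy_kernel z = (fst z *\<^sub>R cl_one - cl_vec (snd z)) /\<^sub>R norm z ^ (?m + 1)" for z :: "'n paravector"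
    unfolding cauchy_kernel_eq scaleR_eq_scale[symmetric] ..
  have cu: "(fst u *\<^sub>R cl_one - V) \<star> (fst u *\<^sub>R cl_one + V) = N\<^sup>2 *\<^sub>R cl_one"
    unfolding n2
    by (simp add: cl.add_left cl.add_right cl.diff_left cl.diff_right cl.scaleR_left cl.scaleR_right cl_one_left cl_one_right VV
      algebra_simps power2_eq_square)
  have uc: "(fst u *\<^sub>R cl_one + V) \<star> (fst u *\<^sub>R cl_one - V) = N\<^sup>2 *\<^sub>R cl_one"
    unfolding n2
    by (simp add: cl.add_left cl.add_right cl.diff_left cl.diff_right cl.scaleR_left cl.scaleR_right cl_one_left cl_one_right VV
      algebra_simps power2_eq_square)
  show "cauchy_kernel u \<star> (norm u ^ (?m - 1) *\<^sub>R (cl_pv u \<star> y)) = y"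
  proof -
    have "cauchy_kernel u \<star> (norm u ^ (?m - 1) *\<^sub>R (cl_pv u \<star> y)) =
       (N ^ k / N ^ (k + 2)) *\<^sub>R (((fst u *\<^sub>R cl_one - V) \<star> (fst u *\<^sub>R cl_one + V)) \<star> y)"
      unfolding ker pvu V_def[symmetric] N_def[symmetric] k cl_mult_assoc
      by (simp add: cl.scaleR_left cl.scaleR_right divide_inverse mult_ac)
    also have "\<dots> = y" unfolding cu using N by (simp add: cl.scaleR_left cl_one_left power2_eq_square)
    finally show ?thesis .
  qed
  define W where "W = norm ((1, 0) - s *\<^sub>R u)"
  define y where "y = (fst (pv_inverse u) + (- s), snd (pv_inverse u))"
  have y: "fst y = fst u / N\<^sup>2 - s" "snd y = - (1 / N\<^sup>2) *\<^sub>R snd u"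
    by (simp_all add: y_def pv_inverse_def pv_cnj_def N_def divide_inverse)
  have W2: "W\<^sup>2 = 1 - 2 * s * fst u + s\<^sup>2 * N\<^sup>2"
    unfolding W_def norm_paravector n2 by (simp add: power2_diff power_mult_distrib algebra_simps)
  have "(norm y)\<^sup>2 = (W / N)\<^sup>2"
  proof -
    have "(norm y)\<^sup>2 = (fst u / N\<^sup>2 - s)\<^sup>2 + (norm (snd u))\<^sup>2 / (N\<^sup>2)\<^sup>2"
      unfolding norm_paravector y by (simp add: power_divide)
    also have "\<dots> = ((fst u)\<^sup>2 + (norm (snd u))\<^sup>2) / (N\<^sup>2)\<^sup>2 - 2 * s * fst u / N\<^sup>2 + s\<^sup>2"
      by (simp add: power2_diff power_divide add_divide_distrib)
    also have "\<dots> = (W / N)\<^sup>2"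
      unfolding n2[symmetric] power_divide W2 using N by (simp add: power2_eq_square field_simps)
    finally show ?thesis .
  qed
  hence ny: "norm y = W / N"
    by (rule power2_eq_imp_eq) (use N in \<open>simp_all add: W_def\<close>)
  have "norm (s *\<^sub>R u) < 1" using s by simp
  moreover have "norm (1 :: real, 0 :: (real, 'n) vec) = 1" by (simp add: norm_Pair)
  ultimately have "s *\<^sub>R u \<noteq> (1, 0)" by (intro notI) (simp only: less_irrefl)
  hence W: "W > 0" unfolding W_def zero_less_norm_iff right_minus_eq by (rule not_sym)
  have "cauchy_kernel y = (N / W) ^ (?m + 1) *\<^sub>R ((fst u / N\<^sup>2 - s) *\<^sub>R cl_one + (1 / N\<^sup>2) *\<^sub>R V)"
    unfolding ker ny y cl_vec_scaleR V_def[symmetric] using N W by (simp add: power_divide)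
  also have "(fst u / N\<^sup>2 - s) *\<^sub>R cl_one + (1 / N\<^sup>2) *\<^sub>R V = (1 / N\<^sup>2) *\<^sub>R ((fst u *\<^sub>R cl_one + V) - s *\<^sub>R (N\<^sup>2 *\<^sub>R cl_one))"
    using N by (simp add: scaleR_right_distrib scaleR_right_diff_distrib algebra_simps)
  also have "(fst u *\<^sub>R cl_one + V) - s *\<^sub>R (N\<^sup>2 *\<^sub>R cl_one) = (fst u *\<^sub>R cl_one + V) \<star> (cl_one - s *\<^sub>R (fst u *\<^sub>R cl_one - V))"
    unfolding uc[symmetric] cl.diff_right cl.scaleR_right[of _ s] cl_one_right ..
  also have "(N / W) ^ (?m + 1) *\<^sub>R ((1 / N\<^sup>2) *\<^sub>R ((fst u *\<^sub>R cl_one + V) \<star> (cl_one - s *\<^sub>R (fst u *\<^sub>R cl_one - V)))) =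
     N ^ (?m - 1) *\<^sub>R (cl_pv u \<star> ((cl_one - s *\<^sub>R (fst u *\<^sub>R cl_one - V)) /\<^sub>R W ^ (?m + 1)))"
  proof -
    define Q where "Q = (fst u *\<^sub>R cl_one + V) \<star> (cl_one - s *\<^sub>R (fst u *\<^sub>R cl_one - V))"
    have "(N / W) ^ (Suc k + 1) * (1 / N\<^sup>2) = N ^ k * inverse (W ^ (Suc k + 1))"
      using N W by (simp add: power_divide power2_eq_square field_simps)
    hence "(N / W) ^ (Suc k + 1) *\<^sub>R ((1 / N\<^sup>2) *\<^sub>R Q) = N ^ (Suc k - 1) *\<^sub>R (Q /\<^sub>R W ^ (Suc k + 1))"
      by (simp only: scaleR_scaleR diff_Suc_1)
    thus ?thesis unfolding pvu k cl.scaleR_right Q_def .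
  qed
  also have "(cl_one - s *\<^sub>R (fst u *\<^sub>R cl_one - V)) /\<^sub>R W ^ (?m + 1) = cauchy_kernel ((1, 0) - s *\<^sub>R u)"
    unfolding ker W_def by (simp add: V_def cl_vec_minus cl_vec_scaleR scaleR_left_diff_distrib scaleR_right_diff_distrib scaleR_right_distrib)
  finally show "cauchy_kernel (fst (pv_inverse u) + (- s), snd (pv_inverse u)) = norm u ^ (?m - 1) *\<^sub>R (cl_pv u \<star> cauchy_kernel ((1, 0) - s *\<^sub>R u))"
    unfolding y_def N_def .
qed

text \<open>
  The Kelvin factor cancels \<open>E(u)\<^sup>-\<^sup>1\<close> in the previous formula, leaving the
  Taylor coefficients of \<open>s \<mapsto> E(1 - s u)\<close>.
\<close>

lemma kelvin_fueter_P_neg: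
  fixes u :: "'n::{finite,linorder} paravector"
  assumes u: "u \<noteq> 0"
  shows "kelvin (fueter_P_neg (Suc n)) u = (fueter_lambda CARD('n) * ((- 1) ^ n * (- real CARD('n) gchoose n))) *\<^sub>R power_wave (int n) u"
proof -
  let ?m = "CARD('n)"
  define K where "K = (\<lambda>y. norm u ^ (?m - 1) *\<^sub>R (cl_pv u \<star> y))"
  have blK: "bounded_linear K" unfolding K_def
    by (intro bounded_linear_compose[OF bounded_linear_scaleR_right] cl.bounded_linear_right)
  let ?b = "\<lambda>n. ((- 1) ^ n * (- real ?m gchoose n)) *\<^sub>R (power_wave (int n) u :: 'n clifford)"
  let ?y = "pv_inverse u"
  have ser: "(\<lambda>n. s ^ n *\<^sub>R ((- 1) ^ n *\<^sub>R K (?b n))) sums cauchy_kernel (fst ?y + s, snd ?y)" if s: "\<bar>s\<bar> < 1 / norm u" for s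
  proof -
    have su: "\<bar>- s\<bar> * norm u < 1" using s u by (simp add: field_simps)
    have "norm ((- s) *\<^sub>R u) < 1" using su by simp
    hence "cauchy_kernel ((1, 0) - (- s) *\<^sub>R u) = power_wave (- int ?m) ((1, 0) - (- s) *\<^sub>R u)"
      by (rule cauchy_kernel_at_one)
    hence "cauchy_kernel (fst ?y + s, snd ?y) = K (power_wave (- int ?m) ((1, 0) - (- s) *\<^sub>R u))"
      using cauchy_kernel_kelvin(1)[OF u su] by (simp add: K_def)
    moreover have "(\<lambda>n. K ((- s) ^ n *\<^sub>R ?b n)) sums K (power_wave (- int ?m) ((1, 0) - (- s) *\<^sub>R u))"
      by (intro bounded_linear.sums[OF blK] power_wave_expansion_at_one su)
    moreover have "K ((- s) ^ n *\<^sub>R ?b n) = s ^ n *\<^sub>R ((- 1) ^ n *\<^sub>R K (?b n))" for n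
      unfolding linear_scale[OF bounded_linear.linear[OF blK]] by (simp add: power_minus[of s] mult_ac)
    ultimately show ?thesis by simp
  qed
  have "1 / norm u > 0" using u by simp
  from higher_vderiv_powser[OF ser this, of n]
  have "(partial0 ^^ n) cauchy_kernel ?y = fact n *\<^sub>R ((- 1) ^ n *\<^sub>R K (?b n))"
    unfolding partial0_iterate using higher_vderiv_shift[of n "\<lambda>t. cauchy_kernel (t, snd ?y)" "fst ?y" 0] by simp
  hence "fueter_P_neg (Suc n) ?y = fueter_lambda ?m *\<^sub>R K (?b n)"
    unfolding fueter_P_neg_def by (simp add: power_mult_distrib[symmetric])
  hence "kelvin (fueter_P_neg (Suc n)) u = fueter_lambda ?m *\<^sub>R (cauchy_kernel u \<star> K (?b n))"
    unfolding kelvin_def by (simp add: cl.scaleR_right)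
  also have "cauchy_kernel u \<star> K (?b n) = ?b n"
    unfolding K_def by (rule cauchy_kernel_kelvin(2)[OF u, of 0]) simp
  finally show ?thesis by simp
qed

lemma power_wave_polynomial:
  fixes x :: "'n::{finite,linorder} paravector"
  shows "power_wave (int n) x = (\<Sum>j\<le>n. (gck_coeff CARD('n) j * (fact j * (real n gchoose j)) * fst x ^ (n - j)) *\<^sub>R cl_pow (cl_vec (snd x)) j)"
proof -
  let ?m = "CARD('n)"
  let ?G = "\<lambda>z :: complex. z powi (int n) *s (cl_one :: 'n clifford)"
  let ?T = "\<lambda>j. (gck_coeff ?m j * (fact j * (real n gchoose j)) * fst x ^ (n - j)) *\<^sub>R (cl_pow (cl_vec (snd x)) j :: 'n clifford)"
  have "(\<lambda>j. gck_coeff ?m j *\<^sub>R (cl_pow (cl_vec (snd x)) j \<star> vderivs j ?G (of_real (fst x)))) sums power_wave (int n) (fst x, snd x)"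
    unfolding power_wave_def
    by (rule has_sum_imp_sums[OF plane_wave_has_sum[of _ _ "norm (snd x) + 1"]]) (auto intro!: vholomorphic_scale holomorphic_intros)
  moreover have "gck_coeff ?m j *\<^sub>R (cl_pow (cl_vec (snd x)) j \<star> vderivs j ?G (of_real (fst x))) = ?T j" for j
  proof (cases "j \<le> n")
    case True
    have "vderivs j ?G (of_real (fst x)) = complex_of_real (fact j * (real n gchoose j) * fst x ^ (n - j)) *s cl_one"
      using True by (subst vderivs_powi) (auto simp: of_real_gbinomial of_nat_diff[symmetric] simp del: of_nat_diff)
    thus ?thesis by (simp add: cl_one_right scaleR_eq_scale mult.assoc)
  next
    case False
    hence "(real n gchoose j) = 0" "(of_nat n gchoose j) = (0 :: complex)" by (simp_all add: binomial_gbinomial[symmetric])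
    thus ?thesis by (subst vderivs_powi) (auto simp: cl.zero_right)
  qed
  ultimately have "?T sums power_wave (int n) x" by simp
  moreover have "?T sums (\<Sum>j\<le>n. ?T j)"
    by (rule sums_finite) (auto simp: binomial_gbinomial[symmetric])
  ultimately show ?thesis by (rule sums_unique2)
qed

lemma continuous_on_cl_pow:
  fixes f :: "'a::topological_space \<Rightarrow> 'n::{finite,linorder} clifford"
  assumes "continuous_on A f"
  shows "continuous_on A (\<lambda>x. cl_pow (f x) n)"
  using assms by (induction n) (auto intro!: cl.continuous_on continuous_intros)

lemma continuous_on_power_wave: "continuous_on A (\<lambda>x :: 'n::{finite,linorder} paravector. power_wave (int n) x)"
proof -
  have "continuous_on A (\<lambda>x :: 'n paravector. cl_vec (snd x) :: 'n clifford)"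
    by (rule continuous_on_compose2[OF linear_continuous_on[OF bounded_linear_cl_vec]]) (auto intro!: continuous_intros)
  thus ?thesis unfolding power_wave_polynomial by (intro continuous_intros continuous_on_cl_pow)
qed

text \<open>
  The right-hand side is a polynomial, which identifies the limit that defines the value at the
  origin.
\<close>

lemma fueter_P_nonneg_eq:
  fixes u :: "'n::{finite,linorder} paravector"
  shows "fueter_P (int n) u = (fueter_lambda CARD('n) * ((- 1) ^ n * (- real CARD('n) gchoose n))) *\<^sub>R power_wave (int n) u"
proof (cases "u = 0")
  case False
  thus ?thesis by (simp add: fueter_P_def kelvin_fueter_P_neg)
next
  case True
  let ?f = "\<lambda>u :: 'n paravector. (fueter_lambda CARD('n) * ((- 1) ^ n * (- real CARD('n) gchoose n))) *\<^sub>R (power_wave (int n) u :: 'n clifford)"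
  have "continuous_on UNIV ?f" by (intro continuous_intros continuous_on_power_wave)
  hence "(?f \<longlongrightarrow> ?f 0) (at 0)" unfolding continuous_on_def by blast
  hence "(kelvin (fueter_P_neg (Suc n)) \<longlongrightarrow> ?f 0) (at 0)"
    by (rule tendsto_cong[THEN iffD2, rotated]) (auto simp: eventually_at_filter kelvin_fueter_P_neg)
  hence "Lim (at 0) (kelvin (fueter_P_neg (Suc n))) = ?f 0"
    by (intro tendsto_Lim) auto
  thus ?thesis using True by (simp add: fueter_P_def)
qed

text \<open>
  The three cases of the definition have one formula, since the binomial coefficient vanishes for
  \<open>0 \<le> j \<le> m - 2\<close>. For negative \<open>j\<close> the two sign factors combine
  to \<open>(-1)\<^bsup>m-1\<^esup>\<close>.
\<close>

theorem tau_power_eq: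
  fixes u :: "'n::{finite,linorder} paravector"
  assumes "j \<ge> 0 \<or> fst u \<noteq> 0"
  shows "tau_power j u = (fueter_unit CARD('n) * complex_of_real (fueter_lambda CARD('n) * (of_int j gchoose (CARD('n) - 1)))) *s
     power_wave (j - int (CARD('n) - 1)) u"
proof -
  obtain k where m: "CARD('n) = Suc k" using zero_less_card_finite[where 'a = 'n] gr0_conv_Suc by blast
  have sym: "(- 1) ^ n * (- real (Suc k) gchoose n) = (real (n + k) gchoose k)" for n
  proof -
    have "(- 1) ^ n * (- real (Suc k) gchoose n) = (real (n + k) gchoose n)"
      unfolding gbinomial_minus by (simp add: add_ac mult.assoc[symmetric] power_mult_distrib[symmetric])
    also have "(real (n + k) gchoose n) = (real (n + k) gchoose k)"
      unfolding binomial_gbinomial[symmetric] using binomial_symmetric[of n "n + k"] by simp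
    finally show ?thesis .
  qed
  consider n where "j = - int (Suc n)" | "0 \<le> j" "j < int k" | n where "j = int (n + k)"
  proof -
    assume 1: "\<And>n. j = - int (Suc n) \<Longrightarrow> thesis" and 2: "0 \<le> j \<Longrightarrow> j < int k \<Longrightarrow> thesis" and 3: "\<And>n. j = int (n + k) \<Longrightarrow> thesis"
    show thesis using 1[of "nat (- j - 1)"] 2 3[of "nat (j - int k)"] by linarith
  qed
  thus ?thesis
  proof cases
    case 1
    with assms have u: "fst u \<noteq> 0" by auto
    have gb: "(real_of_int j gchoose k) = (- 1) ^ k * (real (n + k) gchoose k)"
      using gbinomial_minus[of "real (Suc n)" k] by (simp add: 1 add_ac)
    have sg: "sgn (- fst u) ^ k * sgn (fst u) ^ k = (- 1) ^ k"
      using u by (simp add: power_mult_distrib[symmetric] sgn_if)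
    have ex: "j - int k = - int (Suc k) - int n" by (simp add: 1)
    have "tau_power j u = (fueter_unit (Suc k) * complex_of_real (sgn (- fst u) ^ k)) *s fueter_P_neg (Suc n) u"
      unfolding tau_power_def fueter_P_def m by (simp add: 1 nat_add_distrib)
    also have "\<dots> = (fueter_unit (Suc k) * complex_of_real (sgn (- fst u) ^ k * (fueter_lambda (Suc k) * sgn (fst u) ^ k * (real (n + k) gchoose k)))) *s power_wave (- int (Suc k) - int n) u"
      unfolding fueter_P_neg_eq[OF u] m sym scaleR_eq_scale by (simp add: mult.assoc)
    also have "sgn (- fst u) ^ k * (fueter_lambda (Suc k) * sgn (fst u) ^ k * (real (n + k) gchoose k)) =
       fueter_lambda (Suc k) * ((sgn (- fst u) ^ k * sgn (fst u) ^ k) * (real (n + k) gchoose k))"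
      by (simp only: mult_ac)
    finally show ?thesis unfolding sg gb[symmetric] ex[symmetric] m by simp
  next
    case 2
    then obtain j' where "j = int j'" "j' < k" using nonneg_int_cases by auto
    hence "(real_of_int j gchoose k) = 0" by (simp add: binomial_gbinomial[symmetric])
    thus ?thesis using 2 unfolding tau_power_def m by simp
  next
    case 3
    have "tau_power j u = fueter_unit (Suc k) *s fueter_P (int n) u"
      unfolding tau_power_def m by (simp add: 3)
    also have "\<dots> = (fueter_unit (Suc k) * complex_of_real (fueter_lambda (Suc k) * (real (n + k) gchoose k))) *s power_wave (int n) u"
      unfolding fueter_P_nonneg_eq m sym scaleR_eq_scale by simp
    finally show ?thesis by (simp add: 3 m)
  qed
qed

section \<open>Laurent expansions\<close>

lemma higher_deriv_sum:
  assumes "finite X" "\<And>j. j \<in> X \<Longrightarrow> f j holomorphic_on W" "open W" "z \<in> W"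
  shows "(deriv ^^ k) (\<lambda>z. \<Sum>j\<in>X. f j z) z = (\<Sum>j\<in>X. (deriv ^^ k) (f j) z)"
  using assms(1,2)
proof (induction X rule: finite_induct)
  case (insert j X)
  have "(deriv ^^ k) (\<lambda>z. f j z + (\<Sum>j\<in>X. f j z)) z = (deriv ^^ k) (f j) z + (deriv ^^ k) (\<lambda>z. \<Sum>j\<in>X. f j z) z"
    using insert.prems assms(3,4) by (intro higher_deriv_add[of _ W]) (auto intro!: holomorphic_intros)
  thus ?case using insert by simp
qed simp

text \<open>Weierstrass, for a series over an arbitrary index set.\<close>

lemma series_higher_deriv:
  assumes W: "open W" and f: "\<And>j. j \<in> I \<Longrightarrow> f j holomorphic_on W"
    and M: "\<And>j z. j \<in> I \<Longrightarrow> z \<in> W \<Longrightarrow> cmod (f j z) \<le> M j" "M summable_on I"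
    and g: "\<And>z. z \<in> W \<Longrightarrow> ((\<lambda>j. f j z) has_sum g z) I"
  shows "g holomorphic_on W" and "z \<in> W \<Longrightarrow> ((\<lambda>j. (deriv ^^ k) (f j) z) has_sum (deriv ^^ k) g z) I"
proof -
  let ?F = "finite_subsets_at_top I"
  have ul: "uniform_limit W (\<lambda>X z. \<Sum>j\<in>X. f j z) g ?F"
    by (rule Weierstrass_m_test_general'[OF M(1) g M(2)])
  have ev: "\<forall>\<^sub>F X in ?F. finite X \<and> X \<subseteq> I"
    by (simp add: eventually_finite_subsets_at_top_weakI)
  have hol: "\<forall>\<^sub>F X in ?F. (\<lambda>z. \<Sum>j\<in>X. f j z) holomorphic_on W"
    using ev by eventually_elim (auto intro!: holomorphic_intros f)
  show "g holomorphic_on W"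
    unfolding holomorphic_on_open[OF W]
  proof
    fix z assume "z \<in> W"
    then obtain r where r: "r > 0" "cball z r \<subseteq> W" using W open_contains_cball by blast
    have "\<forall>\<^sub>F X in ?F. continuous_on (cball z r) (\<lambda>z. \<Sum>j\<in>X. f j z) \<and> (\<lambda>z. \<Sum>j\<in>X. f j z) holomorphic_on ball z r"
      using hol
    proof eventually_elim
      case (elim X)
      have "(\<lambda>z. \<Sum>j\<in>X. f j z) holomorphic_on cball z r" using elim r(2) by (rule holomorphic_on_subset)
      thus ?case using ball_subset_cball holomorphic_on_imp_continuous_on holomorphic_on_subset by blast
    qed
    then obtain "g holomorphic_on ball z r"
      by (rule holomorphic_uniform_limit[OF _ uniform_limit_on_subset[OF ul r(2)]]) auto
    thus "\<exists>f'. (g has_field_derivative f') (at z)"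
      using r(1) by (auto simp: holomorphic_on_open)
  qed
  assume z: "z \<in> W"
  have "((\<lambda>X. (deriv ^^ k) (\<lambda>z. \<Sum>j\<in>X. f j z) z) \<longlongrightarrow> (deriv ^^ k) g z) ?F"
    by (rule higher_deriv_complex_uniform_limit[OF ul hol _ W z]) simp
  moreover have "\<forall>\<^sub>F X in ?F. (deriv ^^ k) (\<lambda>z. \<Sum>j\<in>X. f j z) z = (\<Sum>j\<in>X. (deriv ^^ k) (f j) z)"
    using ev by eventually_elim (intro higher_deriv_sum[OF _ _ W z], auto intro: f)
  ultimately show "((\<lambda>j. (deriv ^^ k) (f j) z) has_sum (deriv ^^ k) g z) I"
    unfolding has_sum_def by (rule Lim_transform_eventually)
qed

lemma has_sum_finite_sum:
  fixes f :: "'b \<Rightarrow> 'a \<Rightarrow> 'c::topological_comm_monoid_add"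
  assumes "finite X" "\<And>A. A \<in> X \<Longrightarrow> (f A has_sum S A) I"
  shows "((\<lambda>x. \<Sum>A\<in>X. f A x) has_sum (\<Sum>A\<in>X. S A)) I"
  using assms by (induction X rule: finite_induct) (auto intro: has_sum_add)

lemma vec_summable_norm:
  fixes f :: "'a \<Rightarrow> complex ^ 'i::finite"
  assumes "f summable_on I"
  shows "(\<lambda>x. norm (f x)) summable_on I"
proof (rule Infinite_Sum.abs_summable_on_comparison_test')
  have "(\<lambda>x. cmod (f x $ A)) summable_on I" for A
    using summable_on_bounded_linear[OF bounded_linear_vec_nth assms, of A]
    by (simp add: summable_on_iff_abs_summable_on_complex)
  hence "((\<lambda>x. cmod (f x $ A)) has_sum infsum (\<lambda>x. cmod (f x $ A)) I) I" for A
    by simp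
  hence "((\<lambda>x. \<Sum>A\<in>UNIV. cmod (f x $ A)) has_sum (\<Sum>A\<in>UNIV. infsum (\<lambda>x. cmod (f x $ A)) I)) I"
    by (intro has_sum_finite_sum) auto
  thus "(\<lambda>x. \<Sum>A\<in>UNIV. cmod (f x $ A)) summable_on I" by (rule has_sum_imp_summable)
  show "norm (f x) \<le> (\<Sum>A\<in>UNIV. cmod (f x $ A))" for x
    unfolding norm_vec_def by (rule L2_set_le_sum) simp
qed

lemma norm_powi_le:
  fixes z :: complex
  assumes "0 < r1" "r1 \<le> cmod z" "cmod z \<le> R1"
  shows "cmod (z powi j) \<le> r1 powi j + R1 powi j"
proof (cases "j \<ge> 0")
  case True
  then obtain n where "j = int n" using nonneg_int_cases by auto
  moreover have "cmod z ^ n \<le> R1 ^ n" using assms by (intro power_mono) auto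
  ultimately show ?thesis using assms by (simp add: norm_power add_increasing)
next
  case False
  then obtain n where "j = - int n" by (metis int_cases2 linorder_linear neg_le_0_iff_le of_nat_0_le_iff)
  moreover have "inverse (cmod z ^ n) \<le> inverse (r1 ^ n)" using assms by (intro le_imp_inverse_le power_mono) auto
  ultimately show ?thesis using assms by (simp add: norm_power norm_inverse power_int_minus add_increasing2)
qed

text \<open>
  Convergence at the two real points \<open>r\<^sub>1\<close> and \<open>R\<^sub>1\<close> is
  absolute and majorizes the series on the closed annulus between them. Its sum is holomorphic and
  agrees with \<open>G\<close> on a real interval.
\<close>

lemma laurent_annulus:
  fixes c :: "int \<Rightarrow> complex ^ 'i::finite"
  assumes r: "0 < r1" "r1 < R1"
    and G: "vholomorphic_on G ((+) a ` {z. r1 < cmod z \<and> cmod z < R1})"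
    and ser: "\<And>u. r1 \<le> u \<Longrightarrow> u \<le> R1 \<Longrightarrow> ((\<lambda>j. (of_real u) powi j *s c j) has_sum G (a + of_real u)) UNIV"
  shows "\<exists>M. M summable_on UNIV \<and> (\<forall>z j. r1 < cmod z \<and> cmod z < R1 \<longrightarrow> norm (z powi j *s c j) \<le> M j)"
  and "r1 < cmod z \<Longrightarrow> cmod z < R1 \<Longrightarrow> ((\<lambda>j. z powi j *s c j) has_sum G (a + z)) UNIV"
proof -
  define W where "W = {z :: complex. r1 < cmod z \<and> cmod z < R1}"
  have W: "open W" "connected W"
  proof -
    show "open W" unfolding W_def by (intro open_Collect_conj open_Collect_less continuous_intros)
    show "connected W" unfolding W_def using connected_annulus(1)[of r1 "0 :: complex" R1] by simp
  qed
  define M where "M = (\<lambda>j. (r1 powi j + R1 powi j) * norm (c j))"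
  have "(\<lambda>j. norm (of_real u powi j *s c j)) summable_on UNIV" if "r1 \<le> u" "u \<le> R1" for u
    using ser[OF that] by (intro vec_summable_norm has_sum_imp_summable)
  hence "(\<lambda>j. norm (of_real r1 powi j *s c j) + norm (of_real R1 powi j *s c j)) summable_on UNIV"
    using r by (intro summable_on_add) auto
  also have "(\<lambda>j. norm (of_real r1 powi j *s c j) + norm (of_real R1 powi j *s c j)) = M"
    using r by (simp add: fun_eq_iff M_def norm_scale norm_power_int distrib_right)
  finally have M: "M summable_on UNIV" .
  have Mb: "norm (z powi j *s c j) \<le> M j" if "z \<in> W" for z j
    unfolding M_def norm_scale using that r by (intro mult_right_mono norm_powi_le) (auto simp: W_def)
  show "\<exists>M. M summable_on UNIV \<and> (\<forall>z j. r1 < cmod z \<and> cmod z < R1 \<longrightarrow> norm (z powi j *s c j) \<le> M j)"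
    using M Mb unfolding W_def by blast
  have sm: "((\<lambda>j. z powi j *s c j) has_sum (\<Sum>\<^sub>\<infinity>j. z powi j *s c j)) UNIV" if "z \<in> W" for z
  proof -
    have "(\<lambda>j. norm (z powi j *s c j)) summable_on UNIV"
      by (rule Infinite_Sum.abs_summable_on_comparison_test'[OF M]) (use Mb[OF that] in auto)
    thus ?thesis by (intro has_sum_infsum) (rule abs_summable_summable)
  qed
  have "(\<Sum>\<^sub>\<infinity>j. z powi j *s c j) $ A = G (a + z) $ A" if z: "z \<in> W" for z A
  proof -
    define L where "L = (\<lambda>z. (\<Sum>\<^sub>\<infinity>j. z powi j *s c j) $ A)"
    have smA: "((\<lambda>j. z powi j * c j $ A) has_sum L z) UNIV" if "z \<in> W" for z
      using has_sum_bounded_linear[OF bounded_linear_vec_nth sm[OF that], of A] by (simp add: L_def)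
    have "L holomorphic_on W"
    proof (rule series_higher_deriv(1)[OF W(1) _ _ M smA])
      show "(\<lambda>z. z powi j * c j $ A) holomorphic_on W" for j
        using r by (intro holomorphic_intros powi_holomorphic) (auto simp: W_def)
      show "cmod (z powi j * c j $ A) \<le> M j" if "z \<in> W" for j z
        using Mb[OF that, of j] Finite_Cartesian_Product.norm_nth_le[of "z powi j *s c j" A] by simp
    qed
    moreover have "(\<lambda>z. G (a + z) $ A) holomorphic_on W"
    proof -
      have "(\<lambda>z. G z $ A) \<circ> (+) a holomorphic_on W"
        using G unfolding vholomorphic_on_def W_def[symmetric]
        by (intro holomorphic_on_compose holomorphic_intros) auto
      thus ?thesis by (simp add: o_def)
    qed
    ultimately have hol: "(\<lambda>z. L z - G (a + z) $ A) holomorphic_on W" by (intro holomorphic_intros)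
    have "L z - G (a + z) $ A = 0"
    proof (rule holomorphic_zero_on_real_interval[OF hol W r(2) _ _ z])
      fix u assume u: "r1 < u" "u < R1"
      show "complex_of_real u \<in> W" using u r by (simp add: W_def)
      have "((\<lambda>j. (of_real u) powi j *s c j) has_sum G (a + of_real u)) UNIV" using ser[of u] u by simp
      hence "(\<Sum>\<^sub>\<infinity>j. (of_real u) powi j *s c j) = G (a + of_real u)" by (rule infsumI)
      thus "L (of_real u) - G (a + of_real u) $ A = 0" by (simp add: L_def)
    qed
    thus ?thesis by (simp add: L_def)
  qed
  hence "(\<Sum>\<^sub>\<infinity>j. z powi j *s c j) = G (a + z)" if "z \<in> W" for z
    using that by (simp add: vec_eq_iff)
  thus "r1 < cmod z \<Longrightarrow> cmod z < R1 \<Longrightarrow> ((\<lambda>j. z powi j *s c j) has_sum G (a + z)) UNIV"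
    using sm[of z] by (simp add: W_def)
qed

lemma has_sum_int_split:
  fixes f :: "int \<Rightarrow> 'a::banach"
  assumes "(f has_sum S) UNIV"
  shows "\<exists>P H. ((\<lambda>n. f (int n)) has_sum P) UNIV \<and> ((\<lambda>n. f (- int (Suc n))) has_sum H) UNIV \<and> S = P + H"
proof -
  have sm: "f summable_on X" for X
    using assms has_sum_imp_summable summable_on_subset_banach by (metis subset_UNIV)
  have bij0: "bij_betw int UNIV {0..}"
    by (rule bij_betwI[of _ _ _ nat]) auto
  have bij1: "bij_betw (\<lambda>n. - int (Suc n)) UNIV {..<0}"
    by (rule bij_betwI[of _ _ _ "\<lambda>j. nat (- j - 1)"]) auto
  have e: "(f has_sum infsum f {0..}) {0..}" and o: "(f has_sum infsum f {..<0}) {..<0}"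
    by (simp_all add: sm)
  have "(f has_sum (infsum f {0..} + infsum f {..<0})) ({0..} \<union> {..<0})"
    using e o by (rule has_sum_Un_disjoint) auto
  moreover have "{0..} \<union> {..<0} = (UNIV :: int set)" by auto
  ultimately have "S = infsum f {0..} + infsum f {..<0}"
    using assms has_sum_unique by metis
  moreover have "((\<lambda>n. f (int n)) has_sum infsum f {0..}) UNIV"
    using e by (subst has_sum_reindex_bij_betw[OF bij0])
  moreover have "((\<lambda>n. f (- int (Suc n))) has_sum infsum f {..<0}) UNIV"
    using o by (subst has_sum_reindex_bij_betw[OF bij1])
  ultimately show ?thesis by blast
qed

lemma has_sum_nat_imp_int:
  assumes "((\<lambda>n. f (int n)) has_sum S) UNIV" "\<And>j. j < 0 \<Longrightarrow> f j = 0"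
  shows "(f has_sum S) (UNIV :: int set)"
proof -
  have bij0: "bij_betw int UNIV {0..}"
    by (rule bij_betwI[of _ _ _ nat]) auto
  have "(f has_sum S) {0..}" using assms(1) by (subst (asm) has_sum_reindex_bij_betw[OF bij0])
  moreover have "(f has_sum S) {0..} \<longleftrightarrow> (f has_sum S) UNIV"
    by (rule has_sum_cong_neutral) (use assms(2) in auto)
  ultimately show ?thesis by simp
qed

text \<open>
  The part with negative exponents is an entire function \<open>h\<close> of \<open>1/u\<close>, and
  the identity theorem gives \<open>h(w) = - p(1/w)\<close> with \<open>p\<close> holomorphic at
  \<open>0\<close>. So \<open>h\<close> has a limit at infinity and is constant by Liouville; it
  vanishes at \<open>0\<close>.
\<close>

lemma laurent_zero:
  fixes e :: "int \<Rightarrow> complex"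
  assumes R: "R > 0" and e0: "e 0 = 0"
    and ser: "\<And>u. 0 < \<bar>u\<bar> \<Longrightarrow> \<bar>u\<bar> < R \<Longrightarrow> ((\<lambda>j. of_real u powi j * e j) has_sum 0) UNIV"
  shows "e j = 0"
proof -
  define b where "b = (\<lambda>n. if n = 0 then 0 else e (- int n))"
  define h where "h = (\<lambda>w. \<Sum>n. b n * w ^ n)"
  define p where "p = (\<lambda>z. \<Sum>n. e (int n) * z ^ n)"
  have real: "summable (\<lambda>n. e (int n) * of_real u ^ n) \<and> summable (\<lambda>n. b n * of_real (1 / u) ^ n) \<and> p (of_real u) + h (of_real (1 / u)) = 0"
    if u: "0 < \<bar>u\<bar>" "\<bar>u\<bar> < R" for u
  proof -
    obtain P H where PH: "((\<lambda>n. of_real u powi int n * e (int n)) has_sum P) UNIV"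
      "((\<lambda>n. of_real u powi (- int (Suc n)) * e (- int (Suc n))) has_sum H) UNIV" "0 = P + H"
      using has_sum_int_split[OF ser[OF u]] by blast
    have P: "(\<lambda>n. e (int n) * of_real u ^ n) sums P"
      using has_sum_imp_sums[OF PH(1)] by (simp add: mult.commute)
    have "(\<lambda>n. b (Suc n) * of_real (1 / u) ^ Suc n) sums H"
      using has_sum_imp_sums[OF PH(2)] unfolding power_int_minus power_int_of_nat
      by (simp add: b_def divide_inverse mult_ac power_inverse del: of_nat_Suc)
    hence H: "(\<lambda>n. b n * of_real (1 / u) ^ n) sums H"
      by (subst (asm) sums_Suc_iff) (simp add: b_def)
    show ?thesis using P H PH(3) by (auto simp: sums_iff p_def h_def)
  qed
  have sum_b: "summable (\<lambda>n. b n * w ^ n)" for w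
  proof -
    define s where "s = max (cmod w + 1) (2 / R)"
    have s: "s > cmod w" by (simp add: s_def max_def)
    hence "s > 0" by (rule le_less_trans[OF norm_ge_zero])
    have "2 / R \<le> s" by (simp add: s_def)
    hence "1 / s \<le> 1 / (2 / R)" by (rule divide_left_mono) (use R \<open>s > 0\<close> in auto)
    also have "\<dots> < R" using R by simp
    finally have s': "1 / s < R" .
    have "summable (\<lambda>n. b n * of_real (1 / (1 / s)) ^ n)" using real[of "1 / s"] s' \<open>s > 0\<close> by simp
    thus ?thesis by (rule powser_inside) (use s \<open>s > 0\<close> in simp)
  qed
  have sum_e: "summable (\<lambda>n. e (int n) * z ^ n)" if z: "cmod z < R" for z
  proof -
    obtain s where s: "cmod z < s" "s < R" using dense z by blast
    have "s > 0" using s(1) norm_ge_zero[of z] by linarith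
    hence "summable (\<lambda>n. e (int n) * of_real s ^ n)" using real[of s] s by simp
    thus ?thesis by (rule powser_inside) (use s \<open>s > 0\<close> in simp)
  qed
  have hol_h: "h holomorphic_on UNIV"
  proof -
    have "h holomorphic_on ball 0 s" for s
      by (rule power_series_holomorphic[of 0 s b]) (use sum_b in \<open>simp add: h_def summable_sums\<close>)
    thus ?thesis unfolding holomorphic_on_open[OF open_ball] holomorphic_on_open[OF open_UNIV]
      by (metis dist_0_norm gt_ex mem_ball)
  qed
  have hol_p: "p holomorphic_on ball 0 R"
    by (rule power_series_holomorphic[of 0 R "\<lambda>n. e (int n)"]) (use sum_e in \<open>simp add: p_def summable_sums\<close>)
  have ph: "p z + h (1 / z) = 0" if z: "0 < cmod z" "cmod z < R" for z
  proof -
    define W where "W = {z :: complex. 0 < cmod z \<and> cmod z < R}"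
    have W: "open W" "connected W"
  proof -
    show "open W" unfolding W_def by (intro open_Collect_conj open_Collect_less continuous_intros)
    show "connected W" unfolding W_def using connected_annulus(1)[of 0 "0 :: complex" R] by simp
  qed
    have "(h \<circ> (\<lambda>z. 1 / z)) holomorphic_on W"
      using hol_h by (intro holomorphic_on_compose holomorphic_intros) (auto simp: W_def intro: holomorphic_on_subset)
    moreover have "p holomorphic_on W" using hol_p by (rule holomorphic_on_subset) (auto simp: W_def)
    ultimately have hol: "(\<lambda>z. p z + h (1 / z)) holomorphic_on W" unfolding o_def by (intro holomorphic_intros)
    show ?thesis
    proof (rule holomorphic_zero_on_real_interval[OF hol W R])
      fix u assume u: "0 < u" "u < R"
      show "complex_of_real u \<in> W" using u by (simp add: W_def)
      show "p (of_real u) + h (1 / of_real u) = 0" using real[of u] u by simp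
    qed (use z in \<open>simp add: W_def\<close>)
  qed
  have "(h \<longlongrightarrow> - p 0) at_infinity"
  proof -
    have "isCont p 0" using hol_p R by (intro continuous_on_interior[OF holomorphic_on_imp_continuous_on]) auto
    hence "((\<lambda>w. p (1 / w)) \<longlongrightarrow> p 0) at_infinity"
      by (rule isCont_tendsto_compose) (use tendsto_inverse_0 in \<open>simp add: divide_inverse\<close>)
    hence "((\<lambda>w. - p (1 / w)) \<longlongrightarrow> - p 0) at_infinity" by (rule tendsto_minus)
    moreover have "\<forall>\<^sub>F w in at_infinity. - p (1 / w) = h w"
    proof -
      have "- p (1 / w) = h w" if "cmod w \<ge> 2 / R" for w
      proof -
        have "w \<noteq> 0" using that R by auto
        have "cmod w > 0" using \<open>w \<noteq> 0\<close> by simp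
        have "cmod (1 / w) < R" using that R \<open>cmod w > 0\<close> by (simp add: norm_divide field_simps)
        thus ?thesis using ph[of "1 / w"] \<open>w \<noteq> 0\<close> by (simp add: add_eq_0_iff norm_divide)
      qed
      thus ?thesis unfolding eventually_at_infinity by blast
    qed
    ultimately show ?thesis by (rule Lim_transform_eventually)
  qed
  hence "h w = - p 0" for w by (rule Liouville_weak[OF hol_h])
  moreover have "p 0 = 0"
    unfolding p_def by (subst powser_zero) (simp add: e0)
  ultimately have h0: "h w = 0" for w by simp
  have "b n = 0" for n
  proof (rule powser_unique[of 1 b "\<lambda>_. 0" "\<lambda>_. 0"])
    show "(\<lambda>n. s ^ n *\<^sub>R b n) sums 0" for s
      using summable_sums[OF sum_b, of "of_real s"] h0[of "of_real s"]
      by (simp add: h_def scaleR_conv_of_real mult.commute)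
  qed auto
  moreover have "e (int n) = 0" for n
  proof (rule powser_unique[of R "\<lambda>n. e (int n)" "\<lambda>_. 0" "\<lambda>_. 0"])
    fix s :: real assume s: "\<bar>s\<bar> < R"
    have "p (of_real s) = 0"
      using ph[of "of_real s"] s h0 \<open>p 0 = 0\<close> by (cases "s = 0") auto
    thus "(\<lambda>n. s ^ n *\<^sub>R e (int n)) sums 0"
      using summable_sums[OF sum_e, of "of_real s"] s
      by (simp add: p_def scaleR_conv_of_real mult.commute)
  qed (use R in auto)
  ultimately show ?thesis
    by (cases j) (auto simp: b_def split: if_splits simp del: of_nat_Suc, metis nat.distinct(1))
qed

section \<open>Slice functions and their stems\<close>

text \<open>
  The slice function whose stem \<open>G\<close> has Clifford-valued coefficients, standing on the
  right.
\<close>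

definition slice_vec :: "(complex \<Rightarrow> 'n clifford) \<Rightarrow> 'n paravector \<Rightarrow> 'n::{finite,linorder} clifford" where
  "slice_vec G x = (\<Sum>A\<in>UNIV. slice_ext (\<lambda>z. G z $ A) x \<star> cl_basis A)"

text \<open>
  With \<open>v\<close> in the role of the imaginary unit, this is \<open>(1 - i v)/2\<close> times
  \<open>G(z)\<close> plus \<open>(1 + i v)/2\<close> times \<open>G\<close> at the conjugate of
  \<open>z\<close>: the representation of a slice function by idempotents. It is complex linear and
  multiplicative in \<open>G\<close>.
\<close>

definition stem_lift :: "(real, 'n) vec \<Rightarrow> (complex \<Rightarrow> 'n clifford) \<Rightarrow> complex \<Rightarrow> 'n::{finite,linorder} clifford" where
  "stem_lift v G z = (wave_kernel v \<star> G z + wave_kernel (- v) \<star> G (cnj z)) /\<^sub>R 2"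

text \<open>The point of the upper half plane that represents \<open>x\<close> in its own slice.\<close>

definition polar :: "'n::finite paravector \<Rightarrow> complex" where
  "polar x = Complex (fst x) (norm (snd x))"

lemma wave_kernel_minus: "wave_kernel (- v) = cl_one + \<i> *s cl_vec v"
  by (simp add: wave_kernel_def cl_vec_minus vec_eq_iff)

lemma wave_kernel_add: "wave_kernel v + wave_kernel (- v) = 2 *\<^sub>R cl_one"
  unfolding wave_kernel_minus by (simp add: wave_kernel_def scaleR_2)

lemma clifford_expansion: "(\<Sum>A\<in>UNIV. x $ A *s cl_basis A) = (x :: 'n::{finite,linorder} clifford)"
  unfolding cl_basis_def by (rule basis_expansion)

lemma slice_vec_eq_stem_lift:
  fixes G :: "complex \<Rightarrow> 'n::{finite,linorder} clifford"
  assumes "\<And>A. G (cnj (polar x)) $ A = cnj (G (polar x) $ A)"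
  shows "slice_vec G x = stem_lift (sgn (snd x)) G (polar x)"
proof -
  let ?v = "sgn (snd x)"
  let ?z = "polar x"
  have "slice_ext (\<lambda>z. G z $ A) x \<star> cl_basis A =
     (wave_kernel ?v \<star> (G ?z $ A *s cl_basis A) + wave_kernel (- ?v) \<star> (G (cnj ?z) $ A *s cl_basis A)) /\<^sub>R 2" for A
  proof -
    define w where "w = G ?z $ A"
    have 1: "slice_ext (\<lambda>z. G z $ A) x = complex_of_real (Re w) *s cl_one + complex_of_real (Im w) *s cl_vec ?v"
      by (simp add: slice_ext_def polar_def w_def Let_def)
    have "complex_of_real (Re w) *s cl_one + complex_of_real (Im w) *s cl_vec ?v =
      (w *s wave_kernel ?v + cnj w *s wave_kernel (- ?v)) /\<^sub>R 2"
      unfolding wave_kernel_minus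
      by (simp add: wave_kernel_def vec_eq_iff complex_eq_iff algebra_simps)
    thus ?thesis unfolding 1 assms w_def[symmetric] by (simp add: cl.add_left cl.scaleR_left)
  qed
  hence "slice_vec G x = (\<Sum>A\<in>UNIV. (wave_kernel ?v \<star> (G ?z $ A *s cl_basis A) + wave_kernel (- ?v) \<star> (G (cnj ?z) $ A *s cl_basis A)) /\<^sub>R 2)"
    by (simp add: slice_vec_def)
  also have "\<dots> = stem_lift ?v G ?z"
    unfolding scaleR_sum_right[symmetric] sum.distrib cl.sum_right[symmetric] clifford_expansion stem_lift_def ..
  finally show ?thesis .
qed

lemma wave_kernel_idempotent:
  assumes "norm v = 1"
  shows "wave_kernel v \<star> wave_kernel v = 2 *\<^sub>R wave_kernel v" "wave_kernel v \<star> wave_kernel (- v) = 0"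
proof -
  have "wave_kernel (- (- v)) \<star> wave_kernel (- v) = 0"
    using wave_kernel_annihilated[of "- v"] assms unfolding wave_kernel_minus by (simp add: cl_vec_minus)
  thus 0: "wave_kernel v \<star> wave_kernel (- v) = 0" by simp
  have "wave_kernel v \<star> (wave_kernel v + wave_kernel (- v)) = 2 *\<^sub>R wave_kernel v"
    unfolding wave_kernel_add by (simp add: cl.scaleR_right cl_one_right)
  thus "wave_kernel v \<star> wave_kernel v = 2 *\<^sub>R wave_kernel v" by (simp add: cl.add_right 0)
qed

text \<open>The two kernels are orthogonal idempotents up to the factor \<open>2\<close>.\<close>

lemma cl_pow_stem:
  fixes v :: "(real, 'n::{finite,linorder}) vec"
  assumes "norm v = 1"
  shows "cl_pow ((a *s wave_kernel v + b *s wave_kernel (- v)) /\<^sub>R 2) n = (a ^ n *s wave_kernel v + b ^ n *s wave_kernel (- v)) /\<^sub>R 2"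
proof (induction n)
  case 0
  show ?case by (simp add: wave_kernel_add)
next
  case (Suc n)
  have m: "norm (- v) = 1" using assms by simp
  note w = wave_kernel_idempotent[OF assms] wave_kernel_idempotent[OF m, unfolded minus_minus]
  show ?case unfolding cl_pow.simps Suc
    by (simp add: cl.add_left cl.add_right cl.scaleR_left cl.scaleR_right w scaleR_right_distrib sc.scaleR_right mult.commute)
qed

lemma cl_pv_stem: "cl_pv x = (polar x *s wave_kernel (sgn (snd x)) + cnj (polar x) *s wave_kernel (- sgn (snd x))) /\<^sub>R 2"
proof -
  have v: "cl_vec (snd x) = complex_of_real (norm (snd x)) *s cl_vec (sgn (snd x))"
    unfolding scaleR_eq_scale[symmetric] cl_vec_scaleR[symmetric] by (cases "snd x = 0") (simp_all add: sgn_div_norm)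
  show ?thesis unfolding cl_pv_def v wave_kernel_minus
    by (simp add: wave_kernel_def polar_def vec_eq_iff complex_eq_iff algebra_simps)
qed

lemma cl_pow_pv: "cl_pow (cl_pv x) n = (polar x ^ n *s wave_kernel (sgn (snd x)) + cnj (polar x) ^ n *s wave_kernel (- sgn (snd x))) /\<^sub>R 2"
  for x :: "'n::{finite,linorder} paravector"
proof (cases "snd x = 0")
  case False
  thus ?thesis unfolding cl_pv_stem by (intro cl_pow_stem) (simp add: norm_sgn)
next
  case True
  have p: "polar x = of_real (fst x)" using True by (simp add: polar_def complex_of_real_def)
  have w: "wave_kernel 0 = (cl_one :: 'n clifford)" by (simp add: wave_kernel_def sc.zero_right)
  have "cl_pow (of_real (fst x) *s cl_one :: 'n clifford) n = of_real (fst x) ^ n *s cl_one"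
  proof -
    have "cl_pow cl_one n = (cl_one :: 'n clifford)" by (induction n) (simp_all add: cl_one_left)
    thus ?thesis unfolding cl_pow_scale by simp
  qed
  thus ?thesis using True by (simp add: cl_pv_def p w scaleR_2[symmetric])
qed

text \<open>
  Powers of paravectors are slice functions, so a series of powers may be summed in the complex
  plane.
\<close>

lemma pv_powi_stem:
  fixes x :: "'n::{finite,linorder} paravector"
  shows "pv_powi x j \<star> c = stem_lift (sgn (snd x)) (\<lambda>z. z powi j *s c) (polar x)"
proof -
  have "pv_powi x j = (polar x powi j *s wave_kernel (sgn (snd x)) + cnj (polar x) powi j *s wave_kernel (- sgn (snd x))) /\<^sub>R 2"
  proof (cases "j \<ge> 0")
    case True
    thus ?thesis by (simp add: pv_powi_def cl_pow_pv power_int_def)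
  next
    case False
    define N where "N = norm x"
    have N2: "(polar x) * cnj (polar x) = of_real (N\<^sup>2)"
      unfolding N_def norm_paravector polar_def by (simp add: complex_eq_iff power2_eq_square)
    have pi: "polar (pv_inverse x) = inverse (cnj (polar x))"
    proof (cases "x = 0")
      case True
      thus ?thesis by (simp add: pv_inverse_def pv_cnj_def polar_def complex_eq_iff)
    next
      case False
      hence "N > 0" by (simp add: N_def)
      hence "polar x \<noteq> 0" using N2 by auto
      have "polar (pv_inverse x) = polar x / of_real (N\<^sup>2)"
      proof -
        have "fst (pv_inverse x) = fst x / N\<^sup>2" "norm (snd (pv_inverse x)) = norm (snd x) / N\<^sup>2"
          by (simp_all add: pv_inverse_def pv_cnj_def N_def divide_inverse mult.commute)
        thus ?thesis unfolding polar_def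
          by (simp add: complex_eq_iff Re_divide_of_real Im_divide_of_real del: of_real_power)
      qed
      also have "\<dots> = inverse (cnj (polar x))" unfolding N2[symmetric] using \<open>polar x \<noteq> 0\<close> by (simp add: field_simps)
      finally show ?thesis .
    qed
    have sg: "sgn (snd (pv_inverse x)) = - sgn (snd x)"
    proof (cases "x = 0")
      case False
      have "snd (pv_inverse x) = (1 / (norm x)\<^sup>2) *\<^sub>R (- snd x)" by (simp add: pv_inverse_def pv_cnj_def divide_inverse)
      thus ?thesis using False by (simp add: sgn_scaleR sgn_minus)
    qed (simp add: pv_inverse_def pv_cnj_def)
    show ?thesis using False unfolding pv_powi_def cl_pow_pv pi sg
      by (simp add: power_int_def add.commute)
  qed
  thus ?thesis unfolding stem_lift_def by (simp add: cl.add_left cl.scaleR_left)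
qed

lemma stem_lift_has_sum:
  assumes "((\<lambda>j. f j z) has_sum g z) I" "((\<lambda>j. f j (cnj z)) has_sum g (cnj z)) I"
  shows "((\<lambda>j. stem_lift v (f j) z) has_sum stem_lift v g z) I"
  unfolding stem_lift_def
  by (intro has_sum_bounded_linear[OF bounded_linear_scaleR_right] has_sum_add has_sum_bounded_linear[OF cl.bounded_linear_right] assms)

section \<open>Intrinsic functions\<close>

lemma intrinsic_on_cnj: "intrinsic_on \<Omega> f \<Longrightarrow> z \<in> \<Omega> \<Longrightarrow> f (cnj z) = cnj (f z)"
  by (simp add: intrinsic_on_def complex_eq_iff)

lemma intrinsic_on_deriv:
  assumes "intrinsic_on \<Omega> f" "open \<Omega>" "\<And>z. z \<in> \<Omega> \<Longrightarrow> cnj z \<in> \<Omega>"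
  shows "intrinsic_on \<Omega> (deriv f)"
proof -
  have hol: "f holomorphic_on \<Omega>" using assms(1) by (simp add: intrinsic_on_def)
  have "deriv f (cnj z) = cnj (deriv f z)" if z: "z \<in> \<Omega>" for z
  proof -
    have "(f has_field_derivative deriv f z) (at (cnj (cnj z)))"
      using holomorphic_derivI[OF hol assms(2) z] by simp
    hence "((cnj \<circ> f \<circ> cnj) has_field_derivative cnj (deriv f z)) (at (cnj z))"
      by (rule has_field_derivative_cnj_cnj)
    hence "(f has_field_derivative cnj (deriv f z)) (at (cnj z))"
      by (rule has_field_derivative_transform_within_open[OF _ assms(2) assms(3)[OF z]])
         (use assms intrinsic_on_cnj in auto)
    thus ?thesis by (rule DERIV_imp_deriv)
  qed
  thus ?thesis using hol assms(2) by (simp add: intrinsic_on_def holomorphic_deriv)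
qed

definition vintrinsic_on :: "complex set \<Rightarrow> (complex \<Rightarrow> complex ^ 'i) \<Rightarrow> bool" where
  "vintrinsic_on \<Omega> G \<longleftrightarrow> (\<forall>A. intrinsic_on \<Omega> (\<lambda>z. G z $ A))"

lemma vintrinsic_vholomorphic: "vintrinsic_on \<Omega> G \<Longrightarrow> vholomorphic_on G \<Omega>"
  by (simp add: vintrinsic_on_def vholomorphic_on_def intrinsic_on_def)

lemma vintrinsic_vderivs:
  assumes "intrinsic_domain \<Omega>" "vintrinsic_on \<Omega> G"
  shows "vintrinsic_on \<Omega> (vderivs n G)"
proof -
  have "intrinsic_on \<Omega> ((deriv ^^ n) f)" if "intrinsic_on \<Omega> f" for f
    using that assms(1) by (induction n) (auto intro!: intrinsic_on_deriv simp: intrinsic_domain_def)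
  thus ?thesis using assms(2) by (simp add: vintrinsic_on_def vderivs_def)
qed

lemma slice_vec_stem_lift:
  fixes G :: "complex \<Rightarrow> 'n::{finite,linorder} clifford"
  assumes "vintrinsic_on \<Omega> G" "polar x \<in> \<Omega>"
  shows "slice_vec G x = stem_lift (sgn (snd x)) G (polar x)"
  using assms by (intro slice_vec_eq_stem_lift) (simp add: vintrinsic_on_def intrinsic_on_cnj[of \<Omega> "\<lambda>z. G z $ _"])

section \<open>The Fueter-Sce-Qian mapping on intrinsic functions\<close>

lemma norm_polar: "cmod (polar x) = norm x"
  by (simp add: polar_def cmod_def norm_prod_def)

lemma polar_translate: "of_real a + polar (y - pv_real a) = polar y"
  by (simp add: polar_def pv_real_def complex_eq_iff)

lemma pv_real_simps [simp]: "fst (pv_real a) = a" "snd (pv_real a) = 0"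
  by (simp_all add: pv_real_def)

lemma slice_pt_translate: "of_real a + slice_pt w (y - pv_real a) = slice_pt w y"
  by (simp add: slice_pt_def complex_eq_iff)

lemma norm_translate: "norm (y - pv_real a) = cmod (polar y - of_real a)"
  unfolding polar_translate[of a y, symmetric] by (simp add: norm_polar)

text \<open>The Taylor expansion at the real part of \<open>x\<close>.\<close>

lemma tau_expansion_exists:
  fixes G :: "complex \<Rightarrow> 'n::{finite,linorder} clifford"
  assumes \<Omega>: "intrinsic_domain \<Omega>" and G: "vintrinsic_on \<Omega> G" and x: "x \<in> wave_domain \<Omega>"
  shows "\<exists>a c. tau_expansion \<Omega> (slice_vec G) x a c"
proof -
  define a where "a = fst x"
  obtain \<rho> where \<rho>: "norm (snd x) < \<rho>" "ball (of_real a) \<rho> \<subseteq> \<Omega>" using x by (auto simp: wave_domain_def a_def)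
  have hol: "vholomorphic_on G (ball (of_real a) \<rho>)"
    using vintrinsic_vholomorphic[OF G] \<rho>(2) unfolding vholomorphic_on_def by (meson holomorphic_on_subset)
  define c where "c = (\<lambda>j. if j \<ge> 0 then vderivs (nat j) G (of_real a) /\<^sub>R fact (nat j) else 0)"
  have ser: "((\<lambda>j. z powi j *s c j) has_sum G (of_real a + z)) UNIV" if "cmod z < \<rho>" for z
  proof (rule has_sum_nat_imp_int)
    show "((\<lambda>n. z powi int n *s c (int n)) has_sum G (of_real a + z)) UNIV"
      using taylor_vec_has_sum[OF hol that] by (simp add: c_def scaleR_eq_scale divide_inverse)
  qed (simp add: c_def sc.zero_right)
  have "((\<lambda>j. pv_powi (y - pv_real a) j \<star> c j) has_sum slice_vec G y) UNIV" if y: "norm (y - pv_real a) < \<rho>" for y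
  proof -
    have z: "cmod (polar (y - pv_real a)) < \<rho>" using y by (simp add: norm_polar)
    have "polar y \<in> ball (of_real a) \<rho>" using y by (simp add: norm_translate dist_norm norm_minus_commute)
    hence sl: "slice_vec G y = stem_lift (sgn (snd y)) G (polar y)"
      using \<rho>(2) by (intro slice_vec_stem_lift[OF G]) auto
    have "((\<lambda>j. stem_lift (sgn (snd y)) (\<lambda>z. z powi j *s c j) (polar (y - pv_real a))) has_sum
       stem_lift (sgn (snd y)) (\<lambda>z. G (of_real a + z)) (polar (y - pv_real a))) UNIV"
      by (rule stem_lift_has_sum) (use z ser in auto)
    also have "stem_lift (sgn (snd y)) (\<lambda>z. G (of_real a + z)) (polar (y - pv_real a)) = slice_vec G y"
      unfolding sl stem_lift_def polar_translate[of a y, symmetric] by simp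
    finally show ?thesis unfolding pv_powi_stem by simp
  qed
  moreover have "{z. - 1 < cmod (z - of_real a) \<and> cmod (z - of_real a) < \<rho>} \<subseteq> \<Omega>"
    using \<rho>(2) by (auto simp: dist_norm norm_minus_commute)
  moreover have "norm (x - pv_real a) < \<rho>"
    using \<rho>(1) by (simp add: a_def pv_real_def norm_prod_def)
  ultimately have "tau_expansion \<Omega> (slice_vec G) x a c"
    unfolding tau_expansion_def by (intro exI[of _ "- 1"] exI[of _ \<rho>]) (auto simp: a_def)
  thus ?thesis by blast
qed

lemma pv_powi_pv_real: "pv_powi (pv_real u) j = (of_real u powi j *s cl_one :: 'n::{finite,linorder} clifford)"
proof -
  have "pv_powi (pv_real u :: 'n paravector) j \<star> cl_one = (wave_kernel 0 \<star> (of_real u powi j *s cl_one) + wave_kernel 0 \<star> (of_real u powi j *s cl_one)) /\<^sub>R 2"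
    unfolding pv_powi_stem stem_lift_def by (simp add: pv_real_def polar_def complex_of_real_def[symmetric])
  thus ?thesis by (simp add: wave_kernel_def sc.zero_right cl_one_left cl_one_right scaleR_2[symmetric])
qed

text \<open>On the real axis an expansion of the slice function is an expansion of its stem.\<close>

lemma tau_expansion_real:
  fixes G :: "complex \<Rightarrow> 'n::{finite,linorder} clifford"
  assumes G: "vintrinsic_on \<Omega> G"
    and sub: "{z. r < cmod (z - of_real a) \<and> cmod (z - of_real a) < R} \<subseteq> \<Omega>"
    and ser: "\<And>y. r < norm (y - pv_real a) \<Longrightarrow> norm (y - pv_real a) < R \<Longrightarrow>
           ((\<lambda>j. pv_powi (y - pv_real a) j \<star> c j) has_sum slice_vec G y) UNIV"
    and u: "r < \<bar>u\<bar>" "\<bar>u\<bar> < R"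
  shows "((\<lambda>j. of_real u powi j *s c j) has_sum G (of_real a + of_real u)) UNIV"
proof -
  let ?y = "pv_real (a + u) :: 'n paravector"
  have y: "?y - pv_real a = pv_real u" by (simp add: pv_real_def)
  have n: "norm (pv_real u :: 'n paravector) = \<bar>u\<bar>" by (simp add: pv_real_def norm_Pair)
  have p: "polar ?y = of_real a + of_real u" by (simp add: polar_def pv_real_def complex_eq_iff)
  have in\<Omega>: "polar ?y \<in> \<Omega>" unfolding p by (rule subsetD[OF sub]) (use u in simp)
  have "slice_vec G ?y = stem_lift (sgn (snd ?y)) G (polar ?y)" by (rule slice_vec_stem_lift[OF G in\<Omega>])
  also have "\<dots> = G (of_real a + of_real u)"
    unfolding p by (simp add: stem_lift_def pv_real_def wave_kernel_def sc.zero_right cl_one_left scaleR_2[symmetric])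
  finally have sl: "slice_vec G ?y = G (of_real a + of_real u)" .
  show ?thesis using ser[of ?y] u unfolding y n sl pv_powi_pv_real by (simp add: cl_one_left)
qed

text \<open>
  On a disc no negative exponents can occur, even though they enter the hypothesis only at real
  points.
\<close>

lemma taylor_coefficients_unique:
  fixes c :: "int \<Rightarrow> complex ^ 'i::finite"
  assumes R: "R > 0" and G: "vholomorphic_on G (ball a R)" and c0: "c 0 = G a"
    and ser: "\<And>u. 0 < \<bar>u\<bar> \<Longrightarrow> \<bar>u\<bar> < R \<Longrightarrow> ((\<lambda>j. of_real u powi j *s c j) has_sum G (a + of_real u)) UNIV"
  shows "c j = (if j \<ge> 0 then vderivs (nat j) G a /\<^sub>R fact (nat j) else 0)"
proof -
  define d where "d = (\<lambda>j :: int. if j \<ge> 0 then vderivs (nat j) G a /\<^sub>R fact (nat j) else 0)"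
  have d: "((\<lambda>j. of_real u powi j *s d j) has_sum G (a + of_real u)) UNIV" if "\<bar>u\<bar> < R" for u
  proof (rule has_sum_nat_imp_int)
    show "((\<lambda>n. of_real u powi int n *s d (int n)) has_sum G (a + of_real u)) UNIV"
      using taylor_vec_has_sum[OF G, of "of_real u"] that by (simp add: d_def scaleR_eq_scale divide_inverse)
  qed (simp add: d_def sc.zero_right)
  have "c j $ A - d j $ A = 0" for A
  proof (rule laurent_zero[OF R, of "\<lambda>j. c j $ A - d j $ A"])
    show "c 0 $ A - d 0 $ A = 0" by (simp add: c0 d_def)
    fix u :: real assume u: "0 < \<bar>u\<bar>" "\<bar>u\<bar> < R"
    have "((\<lambda>j. of_real u powi j *s c j - of_real u powi j *s d j) has_sum (G (a + of_real u) - G (a + of_real u))) UNIV"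
      using has_sum_add[OF ser[OF u] has_sum_bounded_linear[OF bounded_linear_minus[OF bounded_linear_ident] d[OF u(2)]]]
      by simp
    from has_sum_bounded_linear[OF bounded_linear_vec_nth this, of A]
    show "((\<lambda>j. of_real u powi j * (c j $ A - d j $ A)) has_sum 0) UNIV"
      by (simp add: right_diff_distrib)
  qed
  hence "c j = d j" by (simp add: vec_eq_iff)
  thus ?thesis by (simp add: d_def)
qed

lemma fueter_gamma_eq: "fueter_gamma m = fueter_unit m * of_real (fueter_lambda m) / fact (m - 1)"
  by (simp add: fueter_gamma_def fueter_lambda_def)

text \<open>
  The open set \<open>W\<close> contains the compact segment over which the plane waves at
  \<open>u\<close> integrate. Cauchy estimates turn the majorant on \<open>W\<close> into one for
  the differentiated series, uniformly in the direction, so that the sum can be taken under the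
  integral.
\<close>

lemma tau_sum:
  fixes G :: "complex \<Rightarrow> 'n::{finite,linorder} clifford" and c :: "int \<Rightarrow> 'n clifford" and u :: "'n paravector"
  assumes W: "open W" and seg: "\<And>w. norm w = 1 \<Longrightarrow> slice_pt w u \<in> W"
    and pos: "\<And>j. j \<in> I \<Longrightarrow> j \<ge> 0 \<or> 0 \<notin> W \<and> fst u \<noteq> 0"
    and M: "\<And>j z. j \<in> I \<Longrightarrow> z \<in> W \<Longrightarrow> norm (z powi j *s c j) \<le> M j" "M summable_on I"
    and ser: "\<And>z. z \<in> W \<Longrightarrow> ((\<lambda>j. z powi j *s c j) has_sum G z) I"
  shows "((\<lambda>j. tau_power j u \<star> c j) has_sum fueter_gamma CARD('n) *s plane_wave (vderivs (CARD('n) - 1) G) u) I"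
proof -
  define k where "k = CARD('n) - 1"
  define K where "K = (\<lambda>w. slice_pt w u) ` sphere 0 1"
  have K: "compact K" unfolding K_def by (intro compact_continuous_image continuous_intros) auto
  have KW: "K \<subseteq> W" using seg by (auto simp: K_def)
  obtain \<delta> where \<delta>: "\<delta> > 0" "\<And>z. z \<in> K \<Longrightarrow> cball z \<delta> \<subseteq> W"
    by (rule compact_subset_open_imp_cball_epsilon_subset[OF K W KW]) (use that in blast)
  let ?f = "\<lambda>j z. z powi j *s c j"
  have hol: "(\<lambda>z. z powi j) holomorphic_on W" if "j \<in> I" for j
    using pos[OF that] by (intro powi_holomorphic) auto
  have holv: "vholomorphic_on (?f j) W" if "j \<in> I" for j
    by (rule vholomorphic_scale[OF hol[OF that]])
  have MA: "cmod (?f j z $ A) \<le> M j" if "j \<in> I" "z \<in> W" for j z A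
    using M(1)[OF that] Finite_Cartesian_Product.norm_nth_le[of "?f j z" A] by linarith
  have gA: "((\<lambda>j. ?f j z $ A) has_sum G z $ A) I" if "z \<in> W" for z A
    using has_sum_bounded_linear[OF bounded_linear_vec_nth ser[OF that], of A] .
  have "vderivs k (?f j) z = (fact k * (of_int j gchoose k)) *s (z powi (j - int k) *s c j)" if "j \<in> I" "z \<in> W" for j z
    using pos[OF that(1)] that(2) by (intro vderivs_powi) auto
  note dk = this
  have GW: "vholomorphic_on G W"
    unfolding vholomorphic_on_def
  proof
    fix A
    show "(\<lambda>z. G z $ A) holomorphic_on W"
      by (rule series_higher_deriv(1)[OF W _ MA M(2) gA]) (use holv in \<open>auto simp: vholomorphic_on_def\<close>)
  qed
  have dser: "((\<lambda>j. vderivs k (?f j) z) has_sum vderivs k G z) I" if z: "z \<in> W" for z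
  proof -
    have "((\<lambda>j. vderivs k (?f j) z $ A) has_sum vderivs k G z $ A) I" for A
      unfolding vderivs_def vec_lambda_beta
      by (rule series_higher_deriv(2)[OF W _ MA M(2) gA z]) (use holv in \<open>auto simp: vholomorphic_on_def\<close>)
    thus ?thesis unfolding has_sum_def by (intro vec_tendstoI) (simp add: sum_component)
  qed
  obtain Kc where Kc: "Kc \<ge> 0" "\<And>w y. w \<in> sphere 0 1 \<Longrightarrow> norm (wave_kernel w \<star> y :: 'n clifford) \<le> Kc * norm y"
    using wave_kernel_bound by blast
  define C where "C = Kc * (real CARD('n set) * (fact k / \<delta> ^ k))"
  have bound: "norm (wave_kernel w \<star> vderivs k (?f j) (slice_pt w u)) \<le> C * M j" if j: "j \<in> I" and w: "w \<in> sphere 0 1" for j w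
  proof -
    let ?z = "slice_pt w u"
    have z: "cball ?z \<delta> \<subseteq> W" using \<delta>(2) w by (simp add: K_def)
    have "norm (vderivs k (?f j) ?z) \<le> (\<Sum>A\<in>UNIV. cmod (vderivs k (?f j) ?z $ A))"
      unfolding norm_vec_def by (rule L2_set_le_sum) simp
    also have "\<dots> \<le> (\<Sum>A\<in>(UNIV :: 'n set set). fact k * M j / \<delta> ^ k)"
    proof (rule sum_mono)
      fix A :: "'n set"
      have "(\<lambda>z. ?f j z $ A) holomorphic_on cball ?z \<delta>"
        using holv[OF j] z unfolding vholomorphic_on_def by (meson holomorphic_on_subset)
      hence h: "(\<lambda>z. ?f j z $ A) holomorphic_on ball ?z \<delta>" "continuous_on (cball ?z \<delta>) (\<lambda>z. ?f j z $ A)"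
        using ball_subset_cball holomorphic_on_imp_continuous_on holomorphic_on_subset by blast+
      show "cmod (vderivs k (?f j) ?z $ A) \<le> fact k * M j / \<delta> ^ k"
        unfolding vderivs_def vec_lambda_beta
      proof (rule Cauchy_inequality[OF h \<delta>(1)])
        fix y assume "cmod (?z - y) = \<delta>"
        hence "y \<in> W" using z by (auto simp: dist_norm)
        thus "cmod (?f j y $ A) \<le> M j" by (rule MA[OF j])
      qed
    qed
    also have "\<dots> = real CARD('n set) * (fact k / \<delta> ^ k) * M j" by simp
    finally have "Kc * norm (vderivs k (?f j) ?z) \<le> Kc * (real CARD('n set) * (fact k / \<delta> ^ k) * M j)"
      using Kc(1) by (intro mult_left_mono) auto
    with Kc(2)[OF w] show ?thesis unfolding C_def by (rule order_trans[OF _ order_trans]) (simp add: mult_ac)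
  qed
  have "((\<lambda>j. LINT w|sphere_measure. wave_kernel w \<star> vderivs k (?f j) (slice_pt w u)) has_sum
     (LINT w|sphere_measure. wave_kernel w \<star> vderivs k G (slice_pt w u))) I"
  proof (rule has_sum_sphere_integral(1)[OF _ _ bound summable_on_cmult_right[OF M(2)]])
    fix w :: "(real, 'n) vec" assume "w \<in> sphere 0 1"
    hence "slice_pt w u \<in> W" by (intro seg) simp
    from has_sum_bounded_linear[OF cl.bounded_linear_right dser[OF this]]
    show "((\<lambda>j. wave_kernel w \<star> vderivs k (?f j) (slice_pt w u)) has_sum wave_kernel w \<star> vderivs k G (slice_pt w u)) I" .
  next
    fix j assume j: "j \<in> I"
    have "continuous_on W (vderivs k (?f j))"
      by (rule vholomorphic_continuous_on[OF vholomorphic_vderivs[OF holv[OF j] W]])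
    hence "continuous_on (sphere 0 1) (\<lambda>w. vderivs k (?f j) (slice_pt w u))"
      by (rule continuous_on_compose2) (use seg in \<open>auto intro!: continuous_intros\<close>)
    thus "continuous_on (sphere 0 1) (\<lambda>w. wave_kernel w \<star> vderivs k (?f j) (slice_pt w u))"
      by (intro cl.continuous_on continuous_intros)
  qed
  from has_sum_bounded_linear[OF bounded_linear_scaleR_right this, of "inverse (sphere_area CARD('n))"]
  have "((\<lambda>j. plane_wave (vderivs k (?f j)) u) has_sum plane_wave (vderivs k G) u) I"
    by (simp only: plane_wave_def)
  from has_sum_bounded_linear[OF sc.bounded_linear_right this, of "fueter_gamma CARD('n)"]
  have "((\<lambda>j. fueter_gamma CARD('n) *s plane_wave (vderivs k (?f j)) u) has_sum fueter_gamma CARD('n) *s plane_wave (vderivs k G) u) I" .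
  also have "?this \<longleftrightarrow> ((\<lambda>j. tau_power j u \<star> c j) has_sum fueter_gamma CARD('n) *s plane_wave (vderivs k G) u) I"
  proof (rule has_sum_cong)
    fix j assume j: "j \<in> I"
    let ?q = "complex_of_real (fact k * (real_of_int j gchoose k))"
    have pj: "j - int k \<ge> 0 \<or> fst u \<noteq> 0 \<or> (real_of_int j gchoose k) = 0"
    proof (cases "fst u = 0 \<and> j < int k")
      case True
      with pos[OF j] obtain j' where "j = int j'" "j' < k" using nonneg_int_cases by auto
      thus ?thesis by (simp add: binomial_gbinomial[symmetric])
    qed auto
    have "plane_wave (vderivs k (?f j)) u = plane_wave (\<lambda>z. ?q *s (z powi (j - int k) *s c j)) u"
      by (rule plane_wave_cong) (use dk[OF j] seg in \<open>simp add: of_real_gbinomial\<close>)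
    also have "\<dots> = ?q *s (power_wave (j - int k) u \<star> c j)"
    proof (cases "(real_of_int j gchoose k) = 0")
      case True
      thus ?thesis by (simp add: plane_wave_def cl.zero_right)
    next
      case False
      hence nz: "j - int k \<ge> 0 \<or> fst u \<noteq> 0" using pj by blast
      have "continuous_on (sphere 0 1) (\<lambda>w. slice_pt w u powi (j - int k) *s (cl_one :: 'n clifford))"
        by (rule continuous_on_compose2[OF continuous_powi_slice[OF nz, of "sphere 0 1"]]) (auto intro!: continuous_intros)
      hence int: "integrable sphere_measure (\<lambda>w. wave_kernel w \<star> (slice_pt w u powi (j - int k) *s cl_one))"
        by (intro integrable_sphere_measure cl.continuous_on continuous_intros)
      have "plane_wave (\<lambda>z. ?q *s (z powi (j - int k) *s c j)) u =
         (LINT w|sphere_measure. ?q *s ((wave_kernel w \<star> (slice_pt w u powi (j - int k) *s cl_one)) \<star> c j)) /\<^sub>R sphere_area CARD('n)"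
        unfolding plane_wave_def by (simp add: cl_one_right)
      also have "\<dots> = ?q *s (power_wave (j - int k) u \<star> c j)"
        unfolding power_wave_def plane_wave_def cl.scaleR_left sc.scaleR_right
        by (simp only: integral_scale[OF integrable_bounded_linear[OF cl.bounded_linear_left int]] integral_bounded_linear[OF cl.bounded_linear_left int])
      finally show ?thesis .
    qed
    also have "fueter_gamma CARD('n) *s \<dots> = tau_power j u \<star> c j"
    proof (cases "(real_of_int j gchoose k) = 0")
      case False
      hence nz: "j \<ge> 0 \<or> fst u \<noteq> 0" using pj by linarith
      show ?thesis unfolding tau_power_eq[OF nz] fueter_gamma_eq k_def[symmetric] by simp
    next
      case True
      have nz: "j \<ge> 0 \<or> fst u \<noteq> 0" using pos[OF j] by blast
      show ?thesis unfolding tau_power_eq[OF nz] fueter_gamma_eq k_def[symmetric] by (simp add: True cl.zero_left)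
    qed
    finally show "fueter_gamma CARD('n) *s plane_wave (vderivs k (?f j)) u = tau_power j u \<star> c j" .
  qed
  finally show ?thesis by (simp add: k_def)
qed

lemma higher_deriv_translate: "(deriv ^^ k) (\<lambda>z. f (a + z)) z = (deriv ^^ k) f (a + z)" for a :: complex
proof (induction k arbitrary: z)
  case (Suc k)
  have "(deriv ^^ k) (\<lambda>z. f (a + z)) = (\<lambda>z. (deriv ^^ k) f (a + z))" using Suc by (rule ext)
  hence "(deriv ^^ Suc k) (\<lambda>z. f (a + z)) z = deriv (\<lambda>z. (deriv ^^ k) f (a + z)) z" by simp
  also have "\<dots> = (deriv ^^ Suc k) f (a + z)"
  proof -
    define F where "F = (deriv ^^ k) f"
    have "((\<lambda>z. F (a + z)) has_field_derivative D) (at z) \<longleftrightarrow> (F has_field_derivative D) (at (a + z))" for D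
      using DERIV_shift[of F D z a] by (simp add: add.commute)
    thus ?thesis unfolding F_def[symmetric] by (simp add: deriv_def[of F] deriv_def[of "\<lambda>z. F (a + z)"] flip: F_def)
  qed
  finally show ?case .
qed simp

text \<open>
  A negative inner radius means a disc, where the coefficients are Taylor coefficients. Otherwise
  \<open>x\<^sub>0 \<noteq> a\<close>, and the annulus can be shrunk to a compact one that still
  contains the segment through \<open>x\<close>.
\<close>

theorem tau_expansion_value:
  fixes G :: "complex \<Rightarrow> 'n::{finite,linorder} clifford"
  assumes G: "vintrinsic_on \<Omega> G" and exp: "tau_expansion \<Omega> (slice_vec G) x a c"
  shows "((\<lambda>j. tau_power j (x - pv_real a) \<star> c j) has_sum fueter_gamma CARD('n) *s plane_wave (vderivs (CARD('n) - 1) G) x) UNIV"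
proof -
  obtain r R where sub: "{z. r < cmod (z - of_real a) \<and> cmod (z - of_real a) < R} \<subseteq> \<Omega>"
    and ser: "\<And>y. r < norm (y - pv_real a) \<Longrightarrow> norm (y - pv_real a) < R \<Longrightarrow>
           ((\<lambda>j. pv_powi (y - pv_real a) j \<star> c j) has_sum slice_vec G y) UNIV"
    and rx: "r < \<bar>fst x - a\<bar>" and xR: "norm (x - pv_real a) < R"
    using exp unfolding tau_expansion_def by blast
  define u where "u = x - pv_real a"
  define k where "k = CARD('n) - 1"
  define Ga where "Ga = (\<lambda>z. G (of_real a + z))"
  have hol: "vholomorphic_on G \<Omega>" by (rule vintrinsic_vholomorphic[OF G])
  have real: "((\<lambda>j. of_real s powi j *s c j) has_sum Ga (of_real s)) UNIV" if "r < \<bar>s\<bar>" "\<bar>s\<bar> < R" for s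
    unfolding Ga_def by (rule tau_expansion_real[OF G sub ser that])
  have u: "fst u = fst x - a" "\<bar>fst u\<bar> \<le> norm u" "norm u < R"
  proof -
    show "fst u = fst x - a" by (simp add: u_def)
    show "\<bar>fst u\<bar> \<le> norm u" using norm_fst_le[of "fst u" "snd u"] by simp
    show "norm u < R" using xR by (simp add: u_def)
  qed
  have seg: "\<bar>fst u\<bar> \<le> cmod (slice_pt w u)" "cmod (slice_pt w u) \<le> norm u" if "norm w = 1" for w
    using abs_Re_le_cmod[of "slice_pt w u"] norm_slice_pt[OF that, of u] by (simp_all add: slice_pt_def)
  have pw: "plane_wave (vderivs k Ga) u = plane_wave (vderivs k G) x"
  proof -
    have "vderivs k Ga (slice_pt w u) = vderivs k G (slice_pt w x)" for w
      using higher_deriv_translate[of k "\<lambda>z. G z $ A" "of_real a" "slice_pt w u" for A]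
      by (simp add: vderivs_def Ga_def u_def slice_pt_translate)
    thus ?thesis by (simp add: plane_wave_def)
  qed
  obtain R1 where R1: "norm u < R1" "R1 < R" using dense[OF u(3)] by blast
  have R1_pos: "R1 > 0" using R1(1) by (rule le_less_trans[OF norm_ge_zero])
  have "((\<lambda>j. tau_power j u \<star> c j) has_sum fueter_gamma CARD('n) *s plane_wave (vderivs k Ga) u) UNIV"
  proof (cases "r < 0")
    case True
    have R: "R > 0" using R1 R1_pos by linarith
    have "ball (complex_of_real a) R \<subseteq> \<Omega>"
    proof
      fix z assume "z \<in> ball (complex_of_real a) R"
      hence "cmod (z - of_real a) < R" by (simp add: dist_norm norm_minus_commute)
      moreover have "r < cmod (z - of_real a)" using True norm_ge_zero by (rule less_le_trans)
      ultimately show "z \<in> \<Omega>" using sub by blast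
    qed
    hence holR: "vholomorphic_on G (ball (of_real a) R)"
      using hol unfolding vholomorphic_on_def by (meson holomorphic_on_subset)
    have "c 0 = G (of_real a)"
    proof -
      have "(\<lambda>j. of_real 0 powi j *s c j) = (\<lambda>j. if j = 0 then c 0 else 0)" by (auto simp: fun_eq_iff power_int_0_left_if)
      hence "((\<lambda>j :: int. if j = 0 then c 0 else 0) has_sum G (of_real a)) UNIV"
        using real[of 0] True R by (simp add: Ga_def)
      moreover have "((\<lambda>j :: int. if j = 0 then c 0 else 0) has_sum c 0) UNIV"
        by (rule has_sum_finite_neutralI[of "{0}"]) auto
      ultimately show ?thesis using has_sum_unique by blast
    qed
    hence c: "c j = (if j \<ge> 0 then vderivs (nat j) G (of_real a) /\<^sub>R fact (nat j) else 0)" for j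
      by (rule taylor_coefficients_unique[OF R holR]) (use real True in \<open>auto simp: Ga_def\<close>)
    have "((\<lambda>j. tau_power j u \<star> c j) has_sum fueter_gamma CARD('n) *s plane_wave (vderivs k Ga) u) {0..}"
      unfolding k_def
    proof (rule tau_sum)
      show "open (ball (0 :: complex) R1)" by simp
      show "slice_pt w u \<in> ball 0 R1" if "norm w = 1" for w
        using seg(2)[OF that] R1 by simp
      show "norm (z powi j *s c j) \<le> norm (of_real R1 powi j *s c j)" if "j \<in> {0..}" "z \<in> ball 0 R1" for j z
      proof -
        obtain n where n: "j = int n" using \<open>j \<in> {0..}\<close> nonneg_int_cases by auto
        have "cmod z ^ n \<le> R1 ^ n" using that by (intro power_mono) auto
        thus ?thesis using R1_pos by (auto simp: n norm_scale norm_power intro!: mult_right_mono)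
      qed
      have "(\<lambda>j. norm (of_real R1 powi j *s c j)) summable_on UNIV"
        using real[of R1] R1 R1_pos True by (intro vec_summable_norm has_sum_imp_summable) auto
      thus "(\<lambda>j. norm (of_real R1 powi j *s c j)) summable_on {0..}"
        by (rule summable_on_subset_banach) simp
      show "((\<lambda>j. z powi j *s c j) has_sum Ga z) {0..}" if "z \<in> ball 0 R1" for z
      proof -
        have bij0: "bij_betw int UNIV {0..}"
          by (rule bij_betwI[of _ _ _ nat]) auto
        have "((\<lambda>n. z powi int n *s c (int n)) has_sum Ga z) UNIV"
          using taylor_vec_has_sum[OF holR, of z] that R1 by (simp add: c Ga_def scaleR_eq_scale divide_inverse)
        thus ?thesis by (subst (asm) has_sum_reindex_bij_betw[OF bij0, of "\<lambda>j. z powi j *s c j"])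
      qed
    qed auto
    moreover have "((\<lambda>j. tau_power j u \<star> c j) has_sum S) {0..} \<longleftrightarrow> ((\<lambda>j. tau_power j u \<star> c j) has_sum S) UNIV" for S
      by (rule has_sum_cong_neutral) (auto simp: c cl.zero_right)
    ultimately show ?thesis by simp
  next
    case False
    obtain r1 where r1: "r < r1" "r1 < \<bar>fst u\<bar>" using dense rx u(1) by metis
    have r1_pos: "r1 > 0" using False r1(1) by linarith
    have r1R1: "r1 < R1" using r1(2) u(2) R1(1) by linarith
    have "(+) (of_real a) ` {z. r1 < cmod z \<and> cmod z < R1} \<subseteq> \<Omega>"
    proof
      fix y assume "y \<in> (+) (of_real a) ` {z. r1 < cmod z \<and> cmod z < R1}"
      then obtain z where z: "y = of_real a + z" "r1 < cmod z" "cmod z < R1" by blast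
      have "y \<in> {z. r < cmod (z - of_real a) \<and> cmod (z - of_real a) < R}" using z r1(1) R1(2) by simp
      thus "y \<in> \<Omega>" using sub by blast
    qed
    hence holW: "vholomorphic_on G ((+) (of_real a) ` {z. r1 < cmod z \<and> cmod z < R1})"
      using hol unfolding vholomorphic_on_def by (meson holomorphic_on_subset)
    have serW: "((\<lambda>j. of_real s powi j *s c j) has_sum G (of_real a + of_real s)) UNIV" if "r1 \<le> s" "s \<le> R1" for s
      using real[of s] that r1(1) R1(2) r1_pos by (simp add: Ga_def)
    obtain M where M: "M summable_on UNIV" "\<And>z j. r1 < cmod z \<Longrightarrow> cmod z < R1 \<Longrightarrow> norm (z powi j *s c j) \<le> M j"
      using laurent_annulus(1)[OF r1_pos r1R1 holW serW] by blast
    show ?thesis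
      unfolding k_def
    proof (rule tau_sum[where W = "{z. r1 < cmod z \<and> cmod z < R1}"])
      show "open {z. r1 < cmod z \<and> cmod z < R1}"
        by (intro open_Collect_conj open_Collect_less continuous_intros)
      show "slice_pt w u \<in> {z. r1 < cmod z \<and> cmod z < R1}" if "norm w = 1" for w
        using seg[OF that] r1(2) R1(1) by simp
      show "j \<ge> 0 \<or> 0 \<notin> {z. r1 < cmod z \<and> cmod z < R1} \<and> fst u \<noteq> 0" for j :: int
        using r1_pos r1(2) by auto
      show "((\<lambda>j. z powi j *s c j) has_sum Ga z) UNIV" if "z \<in> {z. r1 < cmod z \<and> cmod z < R1}" for z
        unfolding Ga_def by (rule laurent_annulus(2)[OF r1_pos r1R1 holW serW]) (use that in auto)
    qed (use M in auto)
  qed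
  thus ?thesis unfolding pw by (simp add: u_def k_def)
qed

corollary tau_slice_vec:
  fixes G :: "complex \<Rightarrow> 'n::{finite,linorder} clifford"
  assumes \<Omega>: "intrinsic_domain \<Omega>" and G: "vintrinsic_on \<Omega> G" and x: "x \<in> wave_domain \<Omega>"
  shows "x \<in> tau_dom \<Omega> (slice_vec G)"
    and "tau \<Omega> (slice_vec G) x = fueter_gamma CARD('n) *s plane_wave (vderivs (CARD('n) - 1) G) x"
proof -
  let ?v = "fueter_gamma CARD('n) *s plane_wave (vderivs (CARD('n) - 1) G) x"
  have v: "has_tau \<Omega> (slice_vec G) x ?v"
    unfolding has_tau_def using tau_expansion_exists[OF assms] tau_expansion_value[OF G] by blast
  thus "x \<in> tau_dom \<Omega> (slice_vec G)" unfolding tau_dom_def by blast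
  show "tau \<Omega> (slice_vec G) x = ?v"
    unfolding tau_def
  proof (rule the_equality[where P = "has_tau \<Omega> (slice_vec G) x", OF v])
    fix v' assume "has_tau \<Omega> (slice_vec G) x v'"
    with v show "v' = ?v" unfolding has_tau_def using has_sum_unique by blast
  qed
qed

section \<open>The dual Radon transform\<close>

lemma polar_in_domain:
  assumes "x \<in> wave_domain \<Omega>" "norm w = 1"
  shows "polar (fst x, (snd x \<bullet> w) *\<^sub>R w) \<in> \<Omega>"
proof -
  obtain \<rho> where \<rho>: "norm (snd x) < \<rho>" "ball (of_real (fst x)) \<rho> \<subseteq> \<Omega>" using assms by (auto simp: wave_domain_def)
  have "\<bar>snd x \<bullet> w\<bar> < \<rho>" using inner_sphere_le[OF assms(2), of "snd x"] \<rho>(1) by simp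
  hence "Complex (fst x) \<bar>snd x \<bullet> w\<bar> \<in> ball (of_real (fst x)) \<rho>"
    by (simp add: dist_norm cmod_def)
  thus ?thesis using \<rho>(2) assms(2) by (auto simp: polar_def)
qed

text \<open>
  At \<open>x\<^sub>0 + \<langle>v, \<omega>\<rangle> \<omega>\<close> the slice function is the
  mean of the two plane wave integrands for \<open>\<omega>\<close> and \<open>- \<omega>\<close>,
  whose integrals are equal.
\<close>

lemma slice_vec_dual_radon:
  fixes G :: "complex \<Rightarrow> 'n::{finite,linorder} clifford"
  assumes \<Omega>: "open \<Omega>" and G: "vintrinsic_on \<Omega> G" and x: "x \<in> wave_domain \<Omega>"
  shows "(LINT w|sphere_measure. slice_vec G (fst x, (snd x \<bullet> w) *\<^sub>R w)) = sphere_area CARD('n) *\<^sub>R plane_wave G x"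
proof -
  let ?g = "\<lambda>w. wave_kernel w \<star> G (slice_pt w x)"
  obtain \<delta> where "wave_expansion G \<Omega> x \<delta>"
    using wave_domain_expansion[OF \<Omega> vintrinsic_vholomorphic[OF G] x] by blast
  then interpret wave_expansion G \<Omega> x \<delta> .
  have cont: "continuous_on (sphere 0 1) ?g"
    using continuous_on_vderivs_slice_pt[of 0] by (intro cl.continuous_on continuous_intros) simp
  have cont': "continuous_on (sphere 0 1) (\<lambda>w. ?g (- w))"
    by (rule continuous_on_compose2[OF cont]) (auto intro!: continuous_intros)
  have pt: "slice_vec G (fst x, (snd x \<bullet> w) *\<^sub>R w) = (?g w + ?g (- w)) /\<^sub>R 2" if w: "norm w = 1" for w
  proof -
    define s where "s = snd x \<bullet> w"
    have in\<Omega>: "polar (fst x, s *\<^sub>R w) \<in> \<Omega>" unfolding s_def by (rule polar_in_domain[OF x w])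
    have sp: "slice_pt w x = Complex (fst x) s" "slice_pt (- w) x = Complex (fst x) (- s)"
      by (simp_all add: slice_pt_def s_def)
    have sg: "sgn (s *\<^sub>R w) = sgn s *\<^sub>R w" using w by (simp add: sgn_scaleR sgn_div_norm)
    have po: "polar (fst x, s *\<^sub>R w) = Complex (fst x) \<bar>s\<bar>" using w by (simp add: polar_def)
    have cn: "cnj (Complex p q) = Complex p (- q)" for p q by (simp add: complex_eq_iff)
    have "slice_vec G (fst x, s *\<^sub>R w) = stem_lift (sgn s *\<^sub>R w) G (Complex (fst x) \<bar>s\<bar>)"
      using slice_vec_stem_lift[OF G in\<Omega>] unfolding po by (simp add: sg)
    also have "\<dots> = (?g w + ?g (- w)) /\<^sub>R 2"
    proof (cases s "0 :: real" rule: linorder_cases)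
      case less
      thus ?thesis unfolding stem_lift_def sp cn by (simp add: add.commute)
    next
      case equal
      have "wave_kernel w \<star> G (Complex (fst x) 0) + wave_kernel (- w) \<star> G (Complex (fst x) 0) = 2 *\<^sub>R G (Complex (fst x) 0)"
        unfolding cl.add_left[symmetric] wave_kernel_add by (simp add: cl.scaleR_left cl_one_left)
      thus ?thesis unfolding stem_lift_def sp cn equal
        by (simp add: wave_kernel_def sc.zero_right cl_one_left scaleR_2[symmetric])
    next
      case greater
      thus ?thesis unfolding stem_lift_def sp cn by simp
    qed
    finally show ?thesis by (simp add: s_def)
  qed
  have "(LINT w|sphere_measure. slice_vec G (fst x, (snd x \<bullet> w) *\<^sub>R w)) = (LINT w|sphere_measure. (?g w + ?g (- w)) /\<^sub>R 2)"
    by (intro Bochner_Integration.integral_cong refl) (simp add: pt)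
  also have "\<dots> = ((LINT w|sphere_measure. ?g w) + (LINT w|sphere_measure. ?g (- w))) /\<^sub>R 2"
    using integrable_sphere_measure[OF cont] integrable_sphere_measure[OF cont'] by simp
  also have "(LINT w|sphere_measure. ?g (- w)) = (LINT w|sphere_measure. ?g w)"
    by (rule integral_sphere_orthogonal[where T = uminus, OF _ cont]) (simp add: orthogonal_transformation_def linear_uminus)
  also have "((LINT w|sphere_measure. ?g w) + (LINT w|sphere_measure. ?g w)) /\<^sub>R 2 = (LINT w|sphere_measure. ?g w)"
    by (simp add: scaleR_2[symmetric])
  also have "\<dots> = sphere_area CARD('n) *\<^sub>R plane_wave G x"
    using sphere_area_pos[of "CARD('n)"] by (simp add: plane_wave_def)
  finally show ?thesis .
qed

lemma slice_vec_cong: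
  assumes "G (polar x) = G' (polar x)"
  shows "slice_vec G x = slice_vec G' x"
  using assms by (simp add: slice_vec_def slice_ext_def polar_def)

section \<open>Holomorphic extensions\<close>

text \<open>
  If \<open>\<Omega>\<close> missed the real axis, the two half planes would disconnect it, since it
  is symmetric.
\<close>

lemma real_trace_interval:
  assumes "intrinsic_domain \<Omega>"
  shows "\<exists>p q. p < q \<and> {p<..<q} \<subseteq> real_trace \<Omega>"
proof -
  have o: "open \<Omega>" "connected \<Omega>" and sym: "\<And>z. z \<in> \<Omega> \<Longrightarrow> cnj z \<in> \<Omega>" and ne: "\<Omega> \<noteq> {}"
    using assms by (auto simp: intrinsic_domain_def)
  have "\<exists>z\<in>\<Omega>. Im z = 0"
  proof (rule ccontr)
    assume n: "\<not> (\<exists>z\<in>\<Omega>. Im z = 0)"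
    let ?A = "{z. Im z > 0}" and ?B = "{z. Im z < 0}"
    have "?A \<inter> \<Omega> = {} \<or> ?B \<inter> \<Omega> = {}"
      by (rule connectedD[OF o(2)]) (use n in \<open>auto intro!: open_halfspace_Im_gt open_halfspace_Im_lt simp: not_less_iff_gr_or_eq\<close>)
    moreover obtain z where z: "z \<in> \<Omega>" using ne by blast
    have "Im z \<noteq> 0" using n z by blast
    ultimately show False using z sym[OF z] by (cases "Im z > 0") force+
  qed
  then obtain z where z: "z \<in> \<Omega>" "Im z = 0" by blast
  define t where "t = Re z"
  have "of_real t \<in> \<Omega>" using z by (simp add: t_def complex_is_Real_iff complex_eq_iff)
  then obtain e where e: "e > 0" "ball (complex_of_real t) e \<subseteq> \<Omega>" using o(1) open_contains_ball by blast
  have "{t - e<..<t + e} \<subseteq> real_trace \<Omega>"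
  proof
    fix s assume "s \<in> {t - e<..<t + e}"
    hence "complex_of_real s \<in> ball (of_real t) e" unfolding mem_ball dist_of_real by (auto simp: dist_real_def)
    thus "s \<in> real_trace \<Omega>" using e(2) by (auto simp: real_trace_def)
  qed
  thus ?thesis using e(1) by (intro exI[of _ "t - e"] exI[of _ "t + e"]) auto
qed

lemma hol_extends_unique:
  assumes \<Omega>: "intrinsic_domain \<Omega>" and g: "hol_extends \<Omega> f g" and g': "hol_extends \<Omega> f g'" and z: "z \<in> \<Omega>"
  shows "g z = g' z"
proof -
  obtain p q where pq: "p < q" "{p<..<q} \<subseteq> real_trace \<Omega>" using real_trace_interval[OF \<Omega>] by blast
  have "g z - g' z = 0"
  proof (rule holomorphic_zero_on_real_interval[OF _ _ _ pq(1) _ _ z])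
    show "(\<lambda>z. g z - g' z) holomorphic_on \<Omega>" using g g' by (auto simp: hol_extends_def intro!: holomorphic_intros)
    fix s assume "p < s" "s < q"
    hence "s \<in> real_trace \<Omega>" using pq(2) by auto
    thus "complex_of_real s \<in> \<Omega>" "g (of_real s) - g' (of_real s) = 0"
      using g g' by (auto simp: real_trace_def hol_extends_def)
  qed (use \<Omega> in \<open>auto simp: intrinsic_domain_def\<close>)
  thus ?thesis by simp
qed

text \<open>The reflected function extends the same real function.\<close>

lemma hol_extends_intrinsic:
  assumes \<Omega>: "intrinsic_domain \<Omega>" and g: "hol_extends \<Omega> f g"
  shows "intrinsic_on \<Omega> g"
proof -
  have sym: "cnj ` \<Omega> = \<Omega>" using \<Omega> by (force simp: intrinsic_domain_def image_iff)
  have "hol_extends \<Omega> f (cnj \<circ> g \<circ> cnj)"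
    unfolding hol_extends_def
  proof
    show "cnj \<circ> g \<circ> cnj holomorphic_on \<Omega>"
      using g \<Omega> by (intro holomorphic_on_compose_cnj_cnj) (auto simp: sym hol_extends_def intrinsic_domain_def)
  qed (use g in \<open>auto simp: hol_extends_def\<close>)
  hence "g z = cnj (g (cnj z))" if "z \<in> \<Omega>" for z
    using hol_extends_unique[OF \<Omega> g _ that] by (simp add: o_def)
  hence "g (cnj z) = cnj (g z)" if "z \<in> \<Omega>" for z using that by (metis complex_cnj_cnj)
  thus ?thesis using g by (simp add: intrinsic_on_def hol_extends_def)
qed

lemma hol_ext_extends:
  assumes "f \<in> analytic_space \<Omega>"
  shows "hol_extends \<Omega> f (hol_ext \<Omega> f)"
  unfolding hol_ext_def by (rule someI_ex[where P = "hol_extends \<Omega> f"]) (use assms in \<open>simp add: analytic_space_def\<close>)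

lemma hol_extends_vderiv:
  fixes f\<^sub>0 :: "real \<Rightarrow> real ^ 'i::finite"
  assumes \<Omega>: "open \<Omega>" and G: "\<And>A. hol_extends \<Omega> (\<lambda>t. f\<^sub>0 t $ A) (\<lambda>z. G z $ A)"
  shows "hol_extends \<Omega> (\<lambda>t. vderiv f\<^sub>0 t $ A) (\<lambda>z. vderivs 1 G z $ A)"
  unfolding hol_extends_def
proof
  have hol: "(\<lambda>z. G z $ A) holomorphic_on \<Omega>" for A using G by (simp add: hol_extends_def)
  show "(\<lambda>z. vderivs 1 G z $ A) holomorphic_on \<Omega>"
    using hol[of A] \<Omega> by (simp add: vderivs_def holomorphic_deriv)
  show "\<forall>t\<in>real_trace \<Omega>. vderivs 1 G (of_real t) $ A = of_real (vderiv f\<^sub>0 t $ A)"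
  proof
    fix t assume t: "t \<in> real_trace \<Omega>"
    have ot: "open (real_trace \<Omega>)"
    proof -
      have "real_trace \<Omega> = of_real -` \<Omega>" by (auto simp: real_trace_def)
      thus ?thesis using \<Omega> by (simp add: open_vimage continuous_on_of_real)
    qed
    define D where "D = (\<lambda>A. deriv (\<lambda>z. G z $ A) (of_real t))"
    have "((\<lambda>s. complex_of_real (f\<^sub>0 s $ A)) has_vector_derivative D A) (at t)" for A
    proof -
      have "((\<lambda>z. G z $ A) has_field_derivative D A) (at (of_real t))"
        unfolding D_def using holomorphic_derivI[OF hol[of A] \<Omega>] t by (simp add: real_trace_def)
      hence "((\<lambda>s. G (of_real s) $ A) has_vector_derivative D A) (at t)"
        by (rule has_vector_derivative_real_field)
      thus ?thesis
        by (rule has_vector_derivative_transform_within_open[OF _ ot t]) (use G in \<open>auto simp: hol_extends_def\<close>)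
    qed
    note dc = this
    have dr: "((\<lambda>s. f\<^sub>0 s $ A) has_real_derivative Re (D A)) (at t)" for A
      using bounded_linear.has_vector_derivative[OF bounded_linear_Re dc[of A]]
      by (simp add: has_real_derivative_iff_has_vector_derivative)
    have "((\<lambda>s. Im (complex_of_real (f\<^sub>0 s $ A))) has_vector_derivative Im (D A)) (at t)" for A
      by (rule bounded_linear.has_vector_derivative[OF bounded_linear_Im dc])
    hence Im: "Im (D A) = 0" for A
      using vector_derivative_unique_at[of "\<lambda>_. 0 :: real" "Im (D A)" t 0] by simp
    have "(f\<^sub>0 has_vector_derivative (\<chi> A. Re (D A))) (at t)"
      unfolding has_vector_derivative_def has_derivative_componentwise_within[of f\<^sub>0]
      using dr by (auto simp: Basis_vec_def inner_axis has_field_derivative_def mult_commute_abs)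
    hence "vderiv f\<^sub>0 t = (\<chi> A. Re (D A))" unfolding vderiv_def by (rule vector_derivative_at)
    thus "vderivs 1 G (of_real t) $ A = of_real (vderiv f\<^sub>0 t $ A)"
      using Im[of A] by (simp add: vderivs_def D_def complex_eq_iff)
  qed
qed

lemma hol_extends_higher_vderiv:
  fixes f\<^sub>0 :: "real \<Rightarrow> real ^ 'i::finite"
  assumes \<Omega>: "open \<Omega>" and G: "\<And>A. hol_extends \<Omega> (\<lambda>t. f\<^sub>0 t $ A) (\<lambda>z. G z $ A)"
  shows "hol_extends \<Omega> (\<lambda>t. (vderiv ^^ k) f\<^sub>0 t $ A) (\<lambda>z. vderivs k G z $ A)"
proof (induction k arbitrary: A)
  case (Suc k)
  from hol_extends_vderiv[OF \<Omega> Suc] show ?case by (simp add: vderivs_vderivs)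
qed (use G in simp)

section \<open>The factorization\<close>

text \<open>
  Both parts of the final theorem are instances: the stem \<open>G\<close> is \<open>f\<close> times
  the unit in the first, and the family of the extensions of the coordinate functions in the second.
\<close>

theorem tau_eq_GCK_eq_dual_radon:
  fixes G :: "complex \<Rightarrow> 'n::{finite,linorder} clifford"
  assumes \<Omega>: "intrinsic_domain \<Omega>" and G: "vintrinsic_on \<Omega> G"
    and f: "\<forall>t\<in>real_trace \<Omega>. f t = vderivs (CARD('n) - 1) G (of_real t)"
  shows "axial_nbhd (real_trace \<Omega>) (wave_domain \<Omega> :: 'n paravector set)"
    and "wave_domain \<Omega> \<subseteq> tau_dom \<Omega> (slice_vec G)"
    and "is_GCK (real_trace \<Omega>) f (wave_domain \<Omega>) (GCK (real_trace \<Omega>) f)"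
    and "x \<in> wave_domain \<Omega> \<Longrightarrow> tau \<Omega> (slice_vec G) x = fueter_gamma CARD('n) *s GCK (real_trace \<Omega>) f x"
    and "x \<in> wave_domain \<Omega> \<Longrightarrow> sphere_area CARD('n) *\<^sub>R GCK (real_trace \<Omega>) f x =
       (LINT w|sphere_measure. slice_vec (vderivs (CARD('n) - 1) G) (fst x, (snd x \<bullet> w) *\<^sub>R w))"
proof -
  let ?G = "vderivs (CARD('n) - 1) G"
  have open\<Omega>: "open \<Omega>" using \<Omega> by (simp add: intrinsic_domain_def)
  have G': "vintrinsic_on \<Omega> ?G" by (rule vintrinsic_vderivs[OF \<Omega> G])
  have gck: "is_GCK (real_trace \<Omega>) f (wave_domain \<Omega>) (plane_wave ?G)"
    by (rule is_GCK_cong[OF is_GCK_plane_wave[OF open\<Omega> vintrinsic_vholomorphic[OF G']]]) (simp_all add: f)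
  have eq: "GCK (real_trace \<Omega>) f x = plane_wave ?G x" if "x \<in> wave_domain \<Omega>" for x
    by (rule GCK_eq[OF gck that])
  show "axial_nbhd (real_trace \<Omega>) (wave_domain \<Omega> :: 'n paravector set)" by (rule axial_nbhd_wave_domain[OF open\<Omega>])
  show "wave_domain \<Omega> \<subseteq> tau_dom \<Omega> (slice_vec G)" using tau_slice_vec(1)[OF \<Omega> G] by blast
  show "is_GCK (real_trace \<Omega>) f (wave_domain \<Omega>) (GCK (real_trace \<Omega>) f)"
    by (rule is_GCK_cong[OF gck]) (simp_all add: eq)
  show "x \<in> wave_domain \<Omega> \<Longrightarrow> tau \<Omega> (slice_vec G) x = fueter_gamma CARD('n) *s GCK (real_trace \<Omega>) f x"
    using tau_slice_vec(2)[OF \<Omega> G] eq by simp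
  show "x \<in> wave_domain \<Omega> \<Longrightarrow> sphere_area CARD('n) *\<^sub>R GCK (real_trace \<Omega>) f x =
       (LINT w|sphere_measure. slice_vec ?G (fst x, (snd x \<bullet> w) *\<^sub>R w))"
    using slice_vec_dual_radon[OF open\<Omega> G'] eq by simp
qed

lemma slice_vec_scalar: "slice_vec (\<lambda>z. f z *s cl_one) = (slice_ext f :: 'n::{finite,linorder} paravector \<Rightarrow> _)"
proof
  fix x :: "'n paravector"
  have "slice_ext (\<lambda>z. (f z *s (cl_one :: 'n clifford)) $ A) x \<star> cl_basis A = (if A = {} then slice_ext f x else 0)" for A
    by (simp add: cl_basis_def axis_def slice_ext_def Let_def sc.zero_left cl.zero_left)
       (simp add: cl_one_right flip: cl_basis_def axis_def)
  thus "slice_vec (\<lambda>z. f z *s cl_one) x = slice_ext f x" by (simp add: slice_vec_def)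
qed

theorem theorem5p3:
  fixes \<Omega>\<^sub>2 :: "complex set" and \<Omega>\<^sub>1 :: "real set" and m :: nat
  assumes "m = CARD('n::{finite,linorder})"
    and "intrinsic_domain \<Omega>\<^sub>2" and "\<Omega>\<^sub>1 = real_trace \<Omega>\<^sub>2"
  shows
    "(\<forall>f. intrinsic_on \<Omega>\<^sub>2 f \<longrightarrow>
        (\<exists>U :: 'n paravector set. axial_nbhd \<Omega>\<^sub>1 U \<and>
           U \<subseteq> tau_dom \<Omega>\<^sub>2 (slice_ext f) \<and>
           is_GCK \<Omega>\<^sub>1 (\<lambda>t. (deriv ^^ (m - 1)) f (of_real t) *s cl_one) U
             (GCK \<Omega>\<^sub>1 (\<lambda>t. (deriv ^^ (m - 1)) f (of_real t) *s cl_one)) \<and>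
           (\<forall>x\<in>U.
              tau \<Omega>\<^sub>2 (slice_ext f) x =
                fueter_gamma m *s GCK \<Omega>\<^sub>1 (\<lambda>t. (deriv ^^ (m - 1)) f (of_real t) *s cl_one) x \<and>
              fueter_gamma m *s GCK \<Omega>\<^sub>1 (\<lambda>t. (deriv ^^ (m - 1)) f (of_real t) *s cl_one) x =
                (fueter_gamma m / of_real (sphere_area m)) *s
                  (LINT \<omega>|sphere_measure.
                     slice_ext ((deriv ^^ (m - 1)) f) (fst x, (snd x \<bullet> \<omega>) *\<^sub>R \<omega>)))))
     \<and>
     (\<forall>f\<^sub>0 :: real \<Rightarrow> real ^ ('n set). f\<^sub>0 \<in> analytic_tensor \<Omega>\<^sub>2 \<longrightarrow>
        (\<exists>U :: 'n paravector set. axial_nbhd \<Omega>\<^sub>1 U \<and>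
           U \<subseteq> tau_dom \<Omega>\<^sub>2 (slice_op \<Omega>\<^sub>2 f\<^sub>0) \<and>
           is_GCK \<Omega>\<^sub>1 (complexify \<circ> (vderiv ^^ (m - 1)) f\<^sub>0) U
             (GCK \<Omega>\<^sub>1 (complexify \<circ> (vderiv ^^ (m - 1)) f\<^sub>0)) \<and>
           (\<forall>x\<in>U.
              tau \<Omega>\<^sub>2 (slice_op \<Omega>\<^sub>2 f\<^sub>0) x =
                fueter_gamma m *s GCK \<Omega>\<^sub>1 (complexify \<circ> (vderiv ^^ (m - 1)) f\<^sub>0) x \<and>
              fueter_gamma m *s GCK \<Omega>\<^sub>1 (complexify \<circ> (vderiv ^^ (m - 1)) f\<^sub>0) x =
                fueter_gamma m *s dual_radon (slice_op \<Omega>\<^sub>2 ((vderiv ^^ (m - 1)) f\<^sub>0)) x)))"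
proof -
  let ?U = "wave_domain \<Omega>\<^sub>2 :: 'n paravector set"
  note \<Omega> = assms(2)
  have open\<Omega>: "open \<Omega>\<^sub>2" using \<Omega> by (simp add: intrinsic_domain_def)
  have \<sigma>: "sphere_area m > 0" unfolding assms(1) by (rule sphere_area_pos) simp
  show ?thesis
    unfolding assms(3)
  proof (intro conjI allI impI)
    fix f assume f: "intrinsic_on \<Omega>\<^sub>2 f"
    define G where "G = (\<lambda>z. f z *s (cl_one :: 'n clifford))"
    have hol: "f holomorphic_on \<Omega>\<^sub>2" using f by (simp add: intrinsic_on_def)
    have G: "vintrinsic_on \<Omega>\<^sub>2 G"
      using f by (auto simp: vintrinsic_on_def intrinsic_on_def G_def cl_basis_def axis_def intro!: holomorphic_intros)
    have dG: "vderivs (m - 1) G z = (deriv ^^ (m - 1)) f z *s cl_one" if "z \<in> \<Omega>\<^sub>2" for z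
      unfolding G_def by (rule vderivs_scale[OF hol open\<Omega> that])
    have sG: "slice_vec G = slice_ext f" unfolding G_def by (rule slice_vec_scalar)
    let ?f = "\<lambda>t. (deriv ^^ (m - 1)) f (of_real t) *s (cl_one :: 'n clifford)"
    have ft: "\<forall>t\<in>real_trace \<Omega>\<^sub>2. ?f t = vderivs (CARD('n) - 1) G (of_real t)"
      using dG by (simp add: real_trace_def assms(1))
    note main = tau_eq_GCK_eq_dual_radon[OF \<Omega> G, of ?f, OF ft, unfolded sG, folded assms(1)]
    have int: "fueter_gamma m *s GCK (real_trace \<Omega>\<^sub>2) ?f x = (fueter_gamma m / of_real (sphere_area m)) *s
                  (LINT \<omega>|sphere_measure. slice_ext ((deriv ^^ (m - 1)) f) (fst x, (snd x \<bullet> \<omega>) *\<^sub>R \<omega>))"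
      if x: "x \<in> ?U" for x
    proof -
      have "(LINT \<omega>|sphere_measure. slice_ext ((deriv ^^ (m - 1)) f) (fst x, (snd x \<bullet> \<omega>) *\<^sub>R \<omega>) :: 'n clifford) =
        (LINT \<omega>|sphere_measure. slice_vec (vderivs (m - 1) G) (fst x, (snd x \<bullet> \<omega>) *\<^sub>R \<omega>))"
        unfolding slice_vec_scalar[symmetric]
        by (intro Bochner_Integration.integral_cong refl slice_vec_cong) (auto simp: dG polar_in_domain[OF x] simp del: One_nat_def)
      also have "\<dots> = sphere_area m *\<^sub>R GCK (real_trace \<Omega>\<^sub>2) ?f x" using main(5)[OF x] by simp
      finally show ?thesis using \<sigma> by (simp add: scaleR_eq_scale)
    qed
    show "\<exists>U :: 'n paravector set. axial_nbhd (real_trace \<Omega>\<^sub>2) U \<and> U \<subseteq> tau_dom \<Omega>\<^sub>2 (slice_ext f) \<and>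
        is_GCK (real_trace \<Omega>\<^sub>2) ?f U (GCK (real_trace \<Omega>\<^sub>2) ?f) \<and>
        (\<forall>x\<in>U. tau \<Omega>\<^sub>2 (slice_ext f) x = fueter_gamma m *s GCK (real_trace \<Omega>\<^sub>2) ?f x \<and>
           fueter_gamma m *s GCK (real_trace \<Omega>\<^sub>2) ?f x = (fueter_gamma m / of_real (sphere_area m)) *s
                  (LINT \<omega>|sphere_measure. slice_ext ((deriv ^^ (m - 1)) f) (fst x, (snd x \<bullet> \<omega>) *\<^sub>R \<omega>)))"
      by (intro exI[of _ ?U] conjI ballI main(1-4) int)
  next
    fix f\<^sub>0 :: "real \<Rightarrow> real ^ ('n set)" assume f\<^sub>0: "f\<^sub>0 \<in> analytic_tensor \<Omega>\<^sub>2"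
    define G where "G = (\<lambda>z. \<chi> A. hol_ext \<Omega>\<^sub>2 (\<lambda>t. f\<^sub>0 t $ A) z)"
    have ext: "hol_extends \<Omega>\<^sub>2 (\<lambda>t. f\<^sub>0 t $ A) (\<lambda>z. G z $ A)" for A
      using f\<^sub>0 hol_ext_extends[of "\<lambda>t. f\<^sub>0 t $ A" \<Omega>\<^sub>2] by (simp add: G_def analytic_tensor_def)
    have G: "vintrinsic_on \<Omega>\<^sub>2 G"
      unfolding vintrinsic_on_def using hol_extends_intrinsic[OF \<Omega> ext] by blast
    have sG: "slice_vec G = slice_op \<Omega>\<^sub>2 f\<^sub>0" by (simp add: fun_eq_iff slice_vec_def slice_op_def G_def)
    define f\<^sub>1 where "f\<^sub>1 = (vderiv ^^ (m - 1)) f\<^sub>0"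
    have ext1: "hol_extends \<Omega>\<^sub>2 (\<lambda>t. f\<^sub>1 t $ A) (\<lambda>z. vderivs (m - 1) G z $ A)" for A
      unfolding f\<^sub>1_def by (rule hol_extends_higher_vderiv[OF open\<Omega> ext])
    have ft: "\<forall>t\<in>real_trace \<Omega>\<^sub>2. (complexify \<circ> f\<^sub>1) t = vderivs (CARD('n) - 1) G (of_real t)"
      using ext1 by (simp add: vec_eq_iff complexify_def hol_extends_def assms(1))
    note main = tau_eq_GCK_eq_dual_radon[OF \<Omega> G, of "complexify \<circ> f\<^sub>1", OF ft, unfolded sG, folded assms(1)]
    define H where "H = (\<lambda>z. \<chi> A. hol_ext \<Omega>\<^sub>2 (\<lambda>t. f\<^sub>1 t $ A) z)"
    have H: "H z = vderivs (m - 1) G z" if "z \<in> \<Omega>\<^sub>2" for z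
    proof -
      have "hol_extends \<Omega>\<^sub>2 (\<lambda>t. f\<^sub>1 t $ A) (hol_ext \<Omega>\<^sub>2 (\<lambda>t. f\<^sub>1 t $ A))" for A
        unfolding hol_ext_def by (rule someI[where P = "hol_extends \<Omega>\<^sub>2 (\<lambda>t. f\<^sub>1 t $ A)", OF ext1[of A]])
      thus ?thesis unfolding H_def using hol_extends_unique[OF \<Omega> _ ext1 that] by (simp add: vec_eq_iff)
    qed
    have int: "fueter_gamma m *s GCK (real_trace \<Omega>\<^sub>2) (complexify \<circ> f\<^sub>1) x = fueter_gamma m *s dual_radon (slice_op \<Omega>\<^sub>2 f\<^sub>1) x"
      if x: "x \<in> ?U" for x
    proof -
      have "slice_op \<Omega>\<^sub>2 f\<^sub>1 = slice_vec H" by (simp add: fun_eq_iff slice_vec_def slice_op_def H_def)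
      hence "(LINT \<omega>|sphere_measure. slice_op \<Omega>\<^sub>2 f\<^sub>1 (fst x, (snd x \<bullet> \<omega>) *\<^sub>R \<omega>)) =
        (LINT \<omega>|sphere_measure. slice_vec (vderivs (m - 1) G) (fst x, (snd x \<bullet> \<omega>) *\<^sub>R \<omega>))"
        by (intro Bochner_Integration.integral_cong refl) (auto intro!: slice_vec_cong simp: H polar_in_domain[OF x] simp del: One_nat_def)
      also have "\<dots> = sphere_area m *\<^sub>R GCK (real_trace \<Omega>\<^sub>2) (complexify \<circ> f\<^sub>1) x" using main(5)[OF x] by simp
      finally show ?thesis using \<sigma> unfolding dual_radon_def assms(1)[symmetric] by simp
    qed
    show "\<exists>U :: 'n paravector set. axial_nbhd (real_trace \<Omega>\<^sub>2) U \<and> U \<subseteq> tau_dom \<Omega>\<^sub>2 (slice_op \<Omega>\<^sub>2 f\<^sub>0) \<and>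
        is_GCK (real_trace \<Omega>\<^sub>2) (complexify \<circ> (vderiv ^^ (m - 1)) f\<^sub>0) U (GCK (real_trace \<Omega>\<^sub>2) (complexify \<circ> (vderiv ^^ (m - 1)) f\<^sub>0)) \<and>
        (\<forall>x\<in>U. tau \<Omega>\<^sub>2 (slice_op \<Omega>\<^sub>2 f\<^sub>0) x = fueter_gamma m *s GCK (real_trace \<Omega>\<^sub>2) (complexify \<circ> (vderiv ^^ (m - 1)) f\<^sub>0) x \<and>
           fueter_gamma m *s GCK (real_trace \<Omega>\<^sub>2) (complexify \<circ> (vderiv ^^ (m - 1)) f\<^sub>0) x = fueter_gamma m *s dual_radon (slice_op \<Omega>\<^sub>2 ((vderiv ^^ (m - 1)) f\<^sub>0)) x)"
      unfolding f\<^sub>1_def[symmetric] by (intro exI[of _ ?U] conjI ballI main(1-4) int)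
  qed
qed

end
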